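(* Let $\Gamma$ be a compact metric tree with Dirichlet conditions on all external vertices and standard conditions at all other vertices, and let $\lambda_1<\lambda_2\le\lambda_3\le\dots$ be the eigenvalues of $-\Delta$ on $\Gamma$. Then the quantity $$D_n:=\left(\frac3n\sum_{j=1}^n\lambda_j\right)^{2}-\frac5n\sum_{j=1}^n\lambda_j^2$$ satisfies $D_n\ge0$ for all $n\ge2$. Furthermore, the eigenvalues satisfy the inequalities $$\lambda_n\ge\frac3n\sum_{j=1}^n\lambda_j-\sqrt{D_n},\qquad \lambda_{n+1}\le\frac3n\sum_{j=1}^n\lambda_j+\sqrt{D_n},$$ and hence $$\lambda_{n+1}-\lambda_n\le2\sqrt{D_n}.$$
   Context: A compact metric tree is a connected compact metric graph (finitely many edges, each identified with a compact interval of positive length, glued at vertices) with no cycles. External vertices are the vertices of degree one. $-\Delta$ is the self-adjoint operator on $L^2(\Gamma)$ associated to the quadratic form $\|u'\|^2$ with domain $\{u\in H^1(\Gamma):u=0\text{ at all external vertices}\}$, where $H^1(\Gamma)$ consists of continuous functions on $\Gamma$ that are $H^1$ on each edge. Thus it acts as $-d^2/dx^2$ on edges, with Dirichlet conditions at external vertices and standard (Kirchhoff--Neumann) conditions at the others: continuity, and vanishing of the sum of outgoing derivatives. Eigenvalues are listed in ascending order with multiplicity. The inequalities are asserted for all $n\ge2$. *)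

theory Defs
  imports
    "Graph_Theory.Graph_Theory"
    "HOL-Analysis.Analysis"
    "HOL-Library.Function_Algebras"
begin

section \<open>Compact metric trees\<close>

text \<open>
  The combinatorial graph is a finite multigraph \<open>G\<close> whose arcs carry an orientation only in order
  to fix coordinates: the edge \<open>e\<close> is identified with \<open>{0..L e}\<close>, the point \<open>0\<close> being glued
  to \<open>tail G e\<close> and the point \<open>L e\<close> to \<open>head G e\<close>.  Edges may be traversed both ways, so the
  constants \<open>forest\<close> and \<open>tree\<close> of the graph library, which exclude cycles of directed walks,
  do not express the absence of cycles of the metric graph.  In \<open>undirected_cycle\<close> a step is an edge
  paired with the direction of traversal (\<open>True\<close> from tail to head); a loop is a cycle of length
  one and two parallel edges form a cycle of length two.
\<close>

fun step_source :: "('v, 'e) pre_digraph \<Rightarrow> 'e \<times> bool \<Rightarrow> 'v" where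
  "step_source G (e, d) = (if d then tail G e else head G e)"

fun step_target :: "('v, 'e) pre_digraph \<Rightarrow> 'e \<times> bool \<Rightarrow> 'v" where
  "step_target G (e, d) = (if d then head G e else tail G e)"

definition undirected_cycle :: "('v, 'e) pre_digraph \<Rightarrow> ('e \<times> bool) list \<Rightarrow> bool" where
  "undirected_cycle G p \<longleftrightarrow>
     p \<noteq> [] \<and> fst ` set p \<subseteq> arcs G \<and>
     distinct (map fst p) \<and> distinct (map (step_source G) p) \<and>
     (\<forall>i<length p. step_target G (p ! i) = step_source G (p ! (Suc i mod length p)))"

text \<open>\<open>Digraph_Component.connected\<close> is connectedness of the underlying undirected graph.\<close>

locale compact_metric_tree = fin_digraph G
  for G :: "('v, 'e) pre_digraph" +
  fixes L :: "'e \<Rightarrow> real"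
  assumes edge_length_pos: "e \<in> arcs G \<Longrightarrow> 0 < L e"
    and graph_connected: "Digraph_Component.connected G"
    and no_cycles: "\<not> undirected_cycle G p"

definition vertex_degree :: "('v, 'e) pre_digraph \<Rightarrow> 'v \<Rightarrow> nat" where
  "vertex_degree G v = in_degree G v + out_degree G v"

definition external_vertices :: "('v, 'e) pre_digraph \<Rightarrow> 'v set" where
  "external_vertices G = {v \<in> verts G. vertex_degree G v = 1}"

section \<open>Function spaces\<close>

text \<open>
  \<open>H1_interval l\<close> is \<open>H\<^sup>1(0,l)\<close>, each element being given by its absolutely continuous
  representative on \<open>{0..l}\<close>.  The derivative is determined up to a null set, so
  that the integrals below do not depend on the choice made in \<open>weak_deriv\<close>.
\<close>

definition L2_interval :: "real \<Rightarrow> (real \<Rightarrow> complex) set" where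
  "L2_interval l = {g. set_borel_measurable lborel {0..l} g \<and>
                       set_integrable lborel {0..l} (\<lambda>x. (cmod (g x))\<^sup>2)}"

definition has_weak_deriv :: "real \<Rightarrow> (real \<Rightarrow> complex) \<Rightarrow> (real \<Rightarrow> complex) \<Rightarrow> bool" where
  "has_weak_deriv l u g \<longleftrightarrow>
     g \<in> L2_interval l \<and> (\<forall>x\<in>{0..l}. u x = u 0 + (LINT t:{0..x}|lborel. g t))"

definition H1_interval :: "real \<Rightarrow> (real \<Rightarrow> complex) set" where
  "H1_interval l = {u. \<exists>g. has_weak_deriv l u g}"

definition weak_deriv :: "real \<Rightarrow> (real \<Rightarrow> complex) \<Rightarrow> real \<Rightarrow> complex" where
  "weak_deriv l u = (SOME g. has_weak_deriv l u g)"

text \<open>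
  A function on the metric graph is a family \<open>u\<close> with \<open>u e x\<close> its value at the point with coordinate
  \<open>x\<close> of the edge \<open>e\<close>.  Elements of \<open>H1_graph\<close> vanish at all \<open>(e, x)\<close> that are not points of the
  graph, so that equality in \<open>H1_graph\<close> is equality of functions on the graph.  In its definition
  \<open>\<phi>\<close> consists of the common values at the vertices; its existence is continuity across vertices.
\<close>

type_synonym 'e graph_fun = "'e \<Rightarrow> real \<Rightarrow> complex"

definition L2_graph :: "('v, 'e) pre_digraph \<Rightarrow> ('e \<Rightarrow> real) \<Rightarrow> 'e graph_fun set" where
  "L2_graph G L = {f. \<forall>e\<in>arcs G. f e \<in> L2_interval (L e)}"

definition L2_inner :: "('v, 'e) pre_digraph \<Rightarrow> ('e \<Rightarrow> real) \<Rightarrow> 'e graph_fun \<Rightarrow> 'e graph_fun \<Rightarrow> complex" where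
  "L2_inner G L f g = (\<Sum>e\<in>arcs G. LINT x:{0..L e}|lborel. f e x * cnj (g e x))"

definition vertex_values :: "('v, 'e) pre_digraph \<Rightarrow> ('e \<Rightarrow> real) \<Rightarrow> 'e graph_fun \<Rightarrow> ('v \<Rightarrow> complex) \<Rightarrow> bool" where
  "vertex_values G L u \<phi> \<longleftrightarrow>
     (\<forall>e\<in>arcs G. u e 0 = \<phi> (tail G e) \<and> u e (L e) = \<phi> (head G e))"

definition H1_graph :: "('v, 'e) pre_digraph \<Rightarrow> ('e \<Rightarrow> real) \<Rightarrow> 'e graph_fun set" where
  "H1_graph G L = {u.
     (\<forall>e x. e \<notin> arcs G \<or> x \<notin> {0..L e} \<longrightarrow> u e x = 0) \<and>
     (\<forall>e\<in>arcs G. continuous_on {0..L e} (u e) \<and> u e \<in> H1_interval (L e)) \<and>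
     (\<exists>\<phi>. vertex_values G L u \<phi>)}"

definition form_domain :: "('v, 'e) pre_digraph \<Rightarrow> ('e \<Rightarrow> real) \<Rightarrow> 'e graph_fun set" where
  "form_domain G L = {u \<in> H1_graph G L.
     \<exists>\<phi>. vertex_values G L u \<phi> \<and> (\<forall>v\<in>external_vertices G. \<phi> v = 0)}"

section \<open>The Laplacian and its eigenvalues\<close>

text \<open>The sesquilinear form whose quadratic form is the squared \<open>L\<^sup>2\<close> norm of the derivative.\<close>

definition dirichlet_form :: "('v, 'e) pre_digraph \<Rightarrow> ('e \<Rightarrow> real) \<Rightarrow> 'e graph_fun \<Rightarrow> 'e graph_fun \<Rightarrow> complex" where
  "dirichlet_form G L u v =
     L2_inner G L (\<lambda>e. weak_deriv (L e) (u e)) (\<lambda>e. weak_deriv (L e) (v e))"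

text \<open>
  The graph of the operator associated with the form: \<open>neg_laplacian G L u f\<close> says that \<open>u\<close> is in the
  operator domain and that \<open>-\<Delta>u = f\<close> in \<open>L\<^sup>2\<close>.
\<close>

definition neg_laplacian :: "('v, 'e) pre_digraph \<Rightarrow> ('e \<Rightarrow> real) \<Rightarrow> 'e graph_fun \<Rightarrow> 'e graph_fun \<Rightarrow> bool" where
  "neg_laplacian G L u f \<longleftrightarrow>
     u \<in> form_domain G L \<and> f \<in> L2_graph G L \<and>
     (\<forall>v\<in>form_domain G L. dirichlet_form G L u v = L2_inner G L f v)"

definition gscale :: "complex \<Rightarrow> 'e graph_fun \<Rightarrow> 'e graph_fun" where
  "gscale c u = (\<lambda>e x. c * u e x)"

global_interpretation graph_fun: vector_space gscale
  by unfold_locales (auto simp: gscale_def fun_eq_iff algebra_simps)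

definition eigenspace :: "('v, 'e) pre_digraph \<Rightarrow> ('e \<Rightarrow> real) \<Rightarrow> real \<Rightarrow> 'e graph_fun set" where
  "eigenspace G L \<mu> = {u. neg_laplacian G L u (gscale (of_real \<mu>) u)}"

text \<open>
  \<open>ev 1, ev 2, \<dots>\<close> is the list of all eigenvalues: every real \<open>\<mu>\<close> occurs in it as often as the
  dimension of its eigenspace, which is zero unless \<open>\<mu>\<close> is an eigenvalue.  The value \<open>ev 0\<close> is unused.
  The finite basis is explicit because \<open>graph_fun.dim\<close> is zero on infinite-dimensional spaces.
\<close>

definition eigenvalue_list :: "('v, 'e) pre_digraph \<Rightarrow> ('e \<Rightarrow> real) \<Rightarrow> (nat \<Rightarrow> real) \<Rightarrow> bool" where
  "eigenvalue_list G L ev \<longleftrightarrow>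
     mono_on {1..} ev \<and>
     (\<forall>\<mu>. finite {j. 1 \<le> j \<and> ev j = \<mu>} \<and>
        (\<exists>B. finite B \<and> B \<subseteq> eigenspace G L \<mu> \<and> graph_fun.independent B \<and>
             eigenspace G L \<mu> \<subseteq> graph_fun.span B \<and> card B = card {j. 1 \<le> j \<and> ev j = \<mu>}))"

definition gap_discriminant :: "(nat \<Rightarrow> real) \<Rightarrow> nat \<Rightarrow> real" where
  "gap_discriminant ev n =
     (3 / real n * (\<Sum>j=1..n. ev j))\<^sup>2 - 5 / real n * (\<Sum>j=1..n. (ev j)\<^sup>2)"

end

theory Submission
  imports Defs "HOL-Complex_Analysis.Great_Picard"
begin

text \<open>
  The proof is a commutator argument in the style of Yang and of Harrell and Stubbe.  Its outcome is

    \<open>\<Sum>j\<le>n. (z - \<lambda>\<^sub>j)\<^sup>2 \<le> 4 (\<Sum>j\<le>n. (z - \<lambda>\<^sub>j) \<lambda>\<^sub>j)\<close>  for  \<open>\<lambda>\<^sub>n \<le> z \<le> \<lambda>\<^sub>n\<^sub>+\<^sub>1\<close>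

  (\<open>yang_inequality\<close>).  This is a quadratic inequality in \<open>z\<close>; that it holds at \<open>\<lambda>\<^sub>n\<close> and at
  \<open>\<lambda>\<^sub>n\<^sub>+\<^sub>1\<close> means that the discriminant is nonnegative and that both eigenvalues lie between the roots.

  On an interval the commutator of \<open>-d\<^sup>2/dx\<^sup>2\<close> is taken with multiplication by \<open>x\<close>.  On a tree
  the coordinate \<open>x\<close> is replaced by a continuous, edgewise affine function \<open>\<phi>\<close> with
  \<open>|\<phi>'| = 1\<close> whose outgoing slopes add up to zero at every vertex that is not external, so that
  integration by parts leaves no vertex terms (\<open>boundary_terms_cancel\<close>).  A real function of
  this kind need not exist, for instance at a vertex of degree three, but a complex one does: at a vertex of degree \<open>d\<close> the outgoing
  slopes are proportional to the \<open>d\<close>-th roots of unity.  As there are no cycles, such slopes can be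
  continued from vertex to vertex and integrated to a potential (\<open>unimodular_flow\<close>).  The abstract
  inequality \<open>commutator_bound\<close>, applied to the real and the imaginary part of \<open>\<phi>\<close>
  and summed, gives the claim.

  The trial functions in this argument are orthogonal to the first \<open>n\<close> eigenfunctions, and the lower
  bound \<open>\<lambda>\<^sub>n\<^sub>+\<^sub>1\<close> for their Rayleigh quotients is needed.  The Rayleigh quotient attains its
  infimum on this orthogonal complement at an eigenfunction (\<open>minimizer\<close>), and
  the multiplicities of the listed eigenvalues then exclude a smaller infimum (\<open>no_further_eigenvector\<close>).
  The existence of a minimizer rests on the compact embedding of the form domain into \<open>L\<^sup>2\<close>
  (\<open>compact_embedding\<close>, by the Arzela-Ascoli theorem) and on its completeness (\<open>form_complete\<close>,
  by the Riesz-Fischer theorem \<open>lsq_complete\<close>).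
\<close>

section \<open>Hermitian forms and orthonormal families\<close>

text \<open>
  A positive semidefinite Hermitian form \<open>ip\<close>, linear in the first argument, on a subspace \<open>H\<close> of
  a complex vector space.  Definiteness is not required, because the \<open>L\<^sup>2\<close> inner product
  only sees functions up to null sets.
\<close>

locale hermitian_form = vector_space scale
  for scale :: "complex \<Rightarrow> 'a::ab_group_add \<Rightarrow> 'a" +
  fixes H :: "'a set" and ip :: "'a \<Rightarrow> 'a \<Rightarrow> complex"
  assumes sub: "subspace H"
    and ip_add: "\<lbrakk>f \<in> H; g \<in> H; h \<in> H\<rbrakk> \<Longrightarrow> ip (f + g) h = ip f h + ip g h"
    and ip_scale: "\<lbrakk>f \<in> H; h \<in> H\<rbrakk> \<Longrightarrow> ip (scale c f) h = c * ip f h"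
    and ip_sym: "\<lbrakk>f \<in> H; h \<in> H\<rbrakk> \<Longrightarrow> ip f h = cnj (ip h f)"
    and ip_nonneg: "f \<in> H \<Longrightarrow> 0 \<le> Re (ip f f)"
begin

lemma H_add: "f \<in> H \<Longrightarrow> g \<in> H \<Longrightarrow> f + g \<in> H" using sub by (rule subspace_add)
lemma H_diff: "f \<in> H \<Longrightarrow> g \<in> H \<Longrightarrow> f - g \<in> H" using sub by (rule subspace_diff)
lemma H_scale: "f \<in> H \<Longrightarrow> scale c f \<in> H" using sub by (rule subspace_scale)
lemma H_zero: "0 \<in> H" using sub by (rule subspace_0)
lemma H_sum: "(\<And>k. k \<in> J \<Longrightarrow> u k \<in> H) \<Longrightarrow> sum u J \<in> H" by (rule subspace_sum[OF sub])

lemmas H_closed = H_add H_diff H_scale H_zero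

lemma ip_add_right: "\<lbrakk>f \<in> H; g \<in> H; h \<in> H\<rbrakk> \<Longrightarrow> ip h (f + g) = ip h f + ip h g"
  by (metis H_add complex_cnj_add ip_add ip_sym)

lemma ip_scale_right: "\<lbrakk>f \<in> H; h \<in> H\<rbrakk> \<Longrightarrow> ip h (scale c f) = cnj c * ip h f"
  by (metis H_scale complex_cnj_mult ip_scale ip_sym)

lemma ip_zero: "h \<in> H \<Longrightarrow> ip 0 h = 0"
  using ip_scale[of 0 h 0] H_zero by simp

lemma ip_diff: "\<lbrakk>f \<in> H; g \<in> H; h \<in> H\<rbrakk> \<Longrightarrow> ip (f - g) h = ip f h - ip g h"
  using ip_add[of "f - g" g h] H_diff[of f g] by simp

lemma ip_diff_right: "\<lbrakk>f \<in> H; g \<in> H; h \<in> H\<rbrakk> \<Longrightarrow> ip h (f - g) = ip h f - ip h g"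
  using ip_add_right[of "f - g" g h] H_diff[of f g] by simp

lemmas ip_simps = ip_add ip_add_right ip_scale ip_scale_right ip_diff ip_diff_right H_closed

lemma ip_sum: "\<lbrakk>\<And>k. k \<in> J \<Longrightarrow> u k \<in> H; h \<in> H\<rbrakk>
    \<Longrightarrow> ip (\<Sum>k\<in>J. scale (c k) (u k)) h = (\<Sum>k\<in>J. c k * ip (u k) h)"
proof (induction J rule: infinite_finite_induct)
  case (insert k J)
  have "(\<Sum>k\<in>J. scale (c k) (u k)) \<in> H" using insert by (intro H_sum H_scale) auto
  then show ?case using insert by (simp add: ip_simps)
qed (simp_all add: ip_zero)

lemma ip_self_real: "f \<in> H \<Longrightarrow> ip f f = of_real (Re (ip f f))"
  using ip_sym[of f f] by (metis Reals_cnj_iff complex_is_Real_iff of_real_Re)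

lemma norm_add: "\<lbrakk>f \<in> H; g \<in> H\<rbrakk>
    \<Longrightarrow> Re (ip (f + g) (f + g)) = Re (ip f f) + 2 * Re (ip f g) + Re (ip g g)"
  using ip_sym[of g f] by (simp add: ip_simps)

lemma norm_diff: "\<lbrakk>f \<in> H; g \<in> H\<rbrakk>
    \<Longrightarrow> Re (ip (f - g) (f - g)) = Re (ip f f) - 2 * Re (ip f g) + Re (ip g g)"
  using ip_sym[of g f] by (simp add: ip_simps)

lemma norm_scale: "f \<in> H \<Longrightarrow> Re (ip (scale c f) (scale c f)) = (cmod c)\<^sup>2 * Re (ip f f)"
proof -
  assume f: "f \<in> H"
  have "ip (scale c f) (scale c f) = c * cnj c * ip f f" using f by (simp add: ip_simps)
  also have "c * cnj c = of_real ((cmod c)\<^sup>2)" by (rule complex_norm_square[symmetric])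
  finally show ?thesis by simp
qed

lemma Cauchy_Schwarz:
  assumes "f \<in> H" "g \<in> H"
  shows "(cmod (ip f g))\<^sup>2 \<le> Re (ip f f) * Re (ip g g)"
proof -
  let ?p = "(cmod (ip f g))\<^sup>2"
  have key: "0 \<le> Re (ip f f) - 2 * t * ?p + t\<^sup>2 * ?p * Re (ip g g)" for t :: real
  proof -
    let ?c = "of_real t * ip f g"
    have "0 \<le> Re (ip (f - scale ?c g) (f - scale ?c g))"
      using assms by (intro ip_nonneg H_closed)
    also have "\<dots> = Re (ip f f) - 2 * Re (cnj ?c * ip f g) + (cmod ?c)\<^sup>2 * Re (ip g g)"
      unfolding norm_diff[OF assms(1) H_scale[OF assms(2)]] norm_scale[OF assms(2)]
        ip_scale_right[OF assms(2,1)] by simp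
    also have "Re (cnj ?c * ip f g) = t * ?p"
      unfolding cmod_power2 by (simp add: power2_eq_square algebra_simps)
    finally show ?thesis by (simp add: norm_mult power_mult_distrib algebra_simps)
  qed
  show ?thesis
  proof (cases "Re (ip g g) = 0")
    case True
    have "?p = 0"
    proof (rule ccontr)
      assume "?p \<noteq> 0"
      with key[of "(Re (ip f f) + 1) / (2 * ?p)"] True show False by (simp add: field_simps)
    qed
    then show ?thesis using True by simp
  next
    case False
    then have "0 < Re (ip g g)" using ip_nonneg[of g] assms by simp
    with key[of "1 / Re (ip g g)"] show ?thesis
      by (simp add: field_simps power2_eq_square)
  qed
qed

lemma ip_null: "\<lbrakk>f \<in> H; g \<in> H; Re (ip f f) = 0\<rbrakk> \<Longrightarrow> ip f g = 0"
  using Cauchy_Schwarz[of f g] by simp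

text \<open>
  Orthonormality of the finite family of the \<open>u k\<close> with \<open>k \<in> J\<close>.
\<close>

definition orthonormal :: "(nat \<Rightarrow> 'a) \<Rightarrow> nat set \<Rightarrow> bool" where
  "orthonormal u J \<longleftrightarrow> finite J \<and> (\<forall>k\<in>J. u k \<in> H) \<and>
     (\<forall>j\<in>J. \<forall>k\<in>J. ip (u j) (u k) = (if j = k then 1 else 0))"

text \<open>
  The component of \<open>x\<close> orthogonal to the orthonormal family \<open>u\<close>.
\<close>

definition residual :: "(nat \<Rightarrow> 'a) \<Rightarrow> nat set \<Rightarrow> 'a \<Rightarrow> 'a" where
  "residual u J x = x - (\<Sum>k\<in>J. scale (ip x (u k)) (u k))"

context
  fixes u J
  assumes on: "orthonormal u J"
begin

lemma orthonormal_in: "k \<in> J \<Longrightarrow> u k \<in> H" using on by (simp add: orthonormal_def)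

lemma residual_in: "x \<in> H \<Longrightarrow> residual u J x \<in> H"
  unfolding residual_def by (intro H_diff H_sum H_scale orthonormal_in)

lemma ip_residual: "\<lbrakk>x \<in> H; y \<in> H\<rbrakk>
    \<Longrightarrow> ip (residual u J x) y = ip x y - (\<Sum>k\<in>J. ip x (u k) * ip (u k) y)"
  unfolding residual_def
  by (subst ip_diff) (auto simp: ip_sum orthonormal_in intro!: H_sum H_scale)

lemma residual_orth: "\<lbrakk>x \<in> H; k \<in> J\<rbrakk> \<Longrightarrow> ip (residual u J x) (u k) = 0"
proof -
  assume x: "x \<in> H" and k: "k \<in> J"
  have "(\<Sum>j\<in>J. ip x (u j) * ip (u j) (u k)) = (\<Sum>j\<in>J. if j = k then ip x (u j) else 0)"
    using on k by (intro sum.cong) (auto simp: orthonormal_def)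
  also have "\<dots> = ip x (u k)" using on k by (simp add: orthonormal_def)
  finally show ?thesis using x k by (simp add: ip_residual orthonormal_in)
qed

lemma residual_orth': "\<lbrakk>x \<in> H; k \<in> J\<rbrakk> \<Longrightarrow> ip (u k) (residual u J x) = 0"
  using residual_orth[of x k] ip_sym[of "u k" "residual u J x"] residual_in orthonormal_in by simp

lemma ip_residual_residual: "\<lbrakk>x \<in> H; y \<in> H\<rbrakk>
    \<Longrightarrow> ip (residual u J x) (residual u J y) = ip x (residual u J y)"
  by (subst ip_residual) (auto simp: residual_in residual_orth')

lemma ip_residual_right: "\<lbrakk>x \<in> H; y \<in> H\<rbrakk>
    \<Longrightarrow> ip x (residual u J y) = ip x y - (\<Sum>k\<in>J. ip x (u k) * cnj (ip y (u k)))"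
proof -
  assume a: "x \<in> H" "y \<in> H"
  have "ip x (residual u J y) = cnj (ip (residual u J y) x)"
    using a residual_in by (intro ip_sym)
  also have "\<dots> = cnj (ip y x) - (\<Sum>k\<in>J. cnj (ip y (u k)) * cnj (ip (u k) x))"
    using a by (simp add: ip_residual)
  also have "\<dots> = ip x y - (\<Sum>k\<in>J. ip x (u k) * cnj (ip y (u k)))"
    using a orthonormal_in by (simp add: ip_sym[symmetric] mult.commute)
  finally show ?thesis .
qed

lemma residual_subspace: "\<lbrakk>subspace D; \<And>k. k \<in> J \<Longrightarrow> u k \<in> D; x \<in> D\<rbrakk> \<Longrightarrow> residual u J x \<in> D"
  unfolding residual_def by (intro subspace_diff subspace_sum subspace_scale)

lemma orthonormal_independent: "independent (u ` J) \<and> inj_on u J"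
proof
  show inj: "inj_on u J"
  proof
    fix j k assume "j \<in> J" "k \<in> J" "u j = u k"
    then show "j = k" using on unfolding orthonormal_def by (metis zero_neq_one)
  qed
  have fin: "finite J" using on by (simp add: orthonormal_def)
  show "independent (u ` J)"
  proof (subst independent_explicit_finite_subsets, intro allI impI ballI)
    fix S c x
    assume S: "S \<subseteq> u ` J" "finite S" and z: "(\<Sum>v\<in>S. scale (c v) v) = 0" and x: "x \<in> S"
    have SH: "v \<in> H" if "v \<in> S" for v using that S orthonormal_in by auto
    have "0 = ip (\<Sum>v\<in>S. scale (c v) v) x" using z x SH by (simp add: ip_zero)
    also have "\<dots> = (\<Sum>v\<in>S. c v * ip v x)"
    proof -
      have "S \<subseteq> H" using SH by auto
      with S(2) show ?thesis
      proof (induction S)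
        case (insert k S)
        have "(\<Sum>k\<in>S. scale (c k) k) \<in> H" using insert by (intro H_sum H_scale) auto
        then show ?case using insert SH x by (simp add: ip_simps)
      qed (use SH x in \<open>simp add: ip_zero\<close>)
    qed
    also have "\<dots> = (\<Sum>v\<in>S. if v = x then c v else 0)"
    proof (rule sum.cong)
      fix v assume "v \<in> S"
      then obtain j k where "j \<in> J" "k \<in> J" "v = u j" "x = u k" using S x by blast
      then show "c v * ip v x = (if v = x then c v else 0)" 
        using on inj by (auto simp: orthonormal_def inj_on_def)
    qed simp
    also have "\<dots> = c x" using S x by simp
    finally show "c x = 0" by simp
  qed
qed

end

end

section \<open>Rayleigh quotients\<close>

text \<open>
  An inner product \<open>ip\<close> on \<open>H\<close> together with a form \<open>q\<close> on a subspace \<open>D\<close>, the form domain.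
  The operator is represented by the form only: \<open>eigvec \<mu> u\<close> is the weak eigenvalue equation.
  The zero vector counts as an \<open>eigvec\<close>, so that these vectors form a subspace.
\<close>

locale form_pair = hermitian_form scale H ip + q: hermitian_form scale D q
  for scale :: "complex \<Rightarrow> 'a::ab_group_add \<Rightarrow> 'a" and H ip D q +
  assumes DH: "D \<subseteq> H"
begin

lemma D_in: "x \<in> D \<Longrightarrow> x \<in> H" using DH by auto

definition eigvec :: "real \<Rightarrow> 'a \<Rightarrow> bool" where
  "eigvec \<mu> u \<longleftrightarrow> u \<in> D \<and> (\<forall>w\<in>D. q u w = of_real \<mu> * ip u w)"

lemma eigvec_orth:
  assumes "eigvec \<mu> u" "eigvec \<nu> v" "\<mu> \<noteq> \<nu>"
  shows "ip u v = 0"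
proof -
  have uv: "u \<in> D" "v \<in> D" using assms by (auto simp: eigvec_def)
  have "of_real \<mu> * ip u v = q u v" using assms by (simp add: eigvec_def)
  also have "\<dots> = cnj (q v u)" using uv by (intro q.ip_sym)
  also have "\<dots> = cnj (of_real \<nu> * ip v u)" using assms by (simp add: eigvec_def)
  also have "\<dots> = of_real \<nu> * ip u v" using ip_sym[of u v] D_in uv by simp
  finally show ?thesis using assms(3) by simp
qed

text \<open>
  Cauchy sequences with respect to the seminorm of a form \<open>f\<close>, used for \<open>ip\<close> and for \<open>q\<close>.
\<close>

definition cauchy :: "('a \<Rightarrow> 'a \<Rightarrow> complex) \<Rightarrow> (nat \<Rightarrow> 'a) \<Rightarrow> bool" where
  "cauchy f v \<longleftrightarrow> (\<forall>e>0. \<exists>N. \<forall>i\<ge>N. \<forall>j\<ge>N. Re (f (v i - v j) (v i - v j)) < e)"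

end

lemma (in hermitian_form) ip_tendsto:
  assumes lim: "(\<lambda>m. Re (ip (v m - x) (v m - x))) \<longlonglongrightarrow> 0"
    and in_H: "\<And>m. v m \<in> H" "x \<in> H" "y \<in> H"
  shows "(\<lambda>m. ip (v m) y) \<longlonglongrightarrow> ip x y"
proof -
  have "(\<lambda>m. ip (v m - x) y) \<longlonglongrightarrow> 0"
  proof (rule Lim_null_comparison)
    show "\<forall>\<^sub>F m in sequentially. norm (ip (v m - x) y)
        \<le> sqrt (Re (ip (v m - x) (v m - x)) * Re (ip y y))"
      using Cauchy_Schwarz[OF H_diff[OF in_H(1,2)] in_H(3)]
      by (intro always_eventually allI) (simp add: real_le_rsqrt)
    show "(\<lambda>m. sqrt (Re (ip (v m - x) (v m - x)) * Re (ip y y))) \<longlonglongrightarrow> 0"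
      using tendsto_real_sqrt[OF tendsto_mult_left_zero[OF lim, of "Re (ip y y)"]] by simp
  qed
  then have "(\<lambda>m. ip (v m - x) y + ip x y) \<longlonglongrightarrow> 0 + ip x y" by (intro tendsto_intros)
  then show ?thesis using in_H by (simp add: ip_diff)
qed

lemma (in hermitian_form) norm_tendsto:
  assumes lim: "(\<lambda>m. Re (ip (v m - x) (v m - x))) \<longlonglongrightarrow> 0"
    and in_H: "\<And>m. v m \<in> H" "x \<in> H"
  shows "(\<lambda>m. Re (ip (v m) (v m))) \<longlonglongrightarrow> Re (ip x x)"
proof -
  have "(\<lambda>m. Re (ip (v m - x) (v m - x)) + 2 * Re (ip (v m) x) - Re (ip x x))
      \<longlonglongrightarrow> 0 + 2 * Re (ip x x) - Re (ip x x)"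
    by (intro tendsto_intros lim ip_tendsto[OF lim in_H in_H(2)])
  then show ?thesis using in_H by (simp add: norm_diff)
qed

text \<open>
  If bounded sequences in \<open>D\<close> have \<open>ip\<close>-Cauchy subsequences and \<open>D\<close> is complete, then a
  Rayleigh quotient below \<open>z\<close> on the orthogonal complement of some eigenvectors forces an eigenvalue
  below \<open>z\<close> with an eigenvector in this complement.  The infimum of the quotient is attained: along a
  minimizing sequence that is \<open>ip\<close>-Cauchy, the parallelogram identity for \<open>q\<close> makes the sequence
  \<open>q\<close>-Cauchy too.  A minimizer \<open>v\<close> is a null vector of the nonnegative form \<open>q - \<mu> ip\<close> on the
  complement, and the Cauchy-Schwarz inequality turns this into the eigenvalue equation.
\<close>

lemma (in form_pair) minimizer:
  assumes compact: "\<And>v C. (\<And>m. v m \<in> D \<and> Re (ip (v m) (v m)) \<le> C \<and> Re (q (v m) (v m)) \<le> C)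
      \<Longrightarrow> \<exists>k::nat \<Rightarrow> nat. strict_mono k \<and> cauchy ip (v \<circ> k)"
    and complete: "\<And>v. (\<And>m. v m \<in> D) \<Longrightarrow> cauchy ip v \<Longrightarrow> cauchy q v \<Longrightarrow>
      \<exists>x\<in>D. (\<lambda>m. Re (ip (v m - x) (v m - x))) \<longlonglongrightarrow> 0 \<and> (\<lambda>m. Re (q (v m - x) (v m - x))) \<longlonglongrightarrow> 0"
    and on: "orthonormal u J" and eig: "\<And>k. k \<in> J \<Longrightarrow> eigvec (l k) (u k)"
    and x: "x \<in> D" "\<And>k. k \<in> J \<Longrightarrow> ip x (u k) = 0" "Re (q x x) < z * Re (ip x x)"
  shows "\<exists>v \<mu>. eigvec \<mu> v \<and> \<mu> < z \<and> ip v v = 1 \<and> (\<forall>k\<in>J. ip v (u k) = 0)"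
proof -
  define W where "W = {v \<in> D. \<forall>k\<in>J. ip v (u k) = 0}"
  define R where "R = {Re (q w w) |w. w \<in> W \<and> Re (ip w w) = 1}"
  define \<mu> where "\<mu> = Inf R"
  have uD: "u k \<in> D" if "k \<in> J" for k using eig that by (simp add: eigvec_def)
  have WD: "w \<in> D" "w \<in> H" if "w \<in> W" for w using that D_in by (auto simp: W_def)
  have subW: "subspace W"
    using q.sub uD D_in H_zero
    by (auto simp: subspace_def W_def ip_simps ip_zero)
  have W_cl: "a + b \<in> W" "a - b \<in> W" "scale c a \<in> W" if "a \<in> W" "b \<in> W" for a b c
    using that subW by (auto intro: subspace_add subspace_diff subspace_scale)
  have R_lb: "0 \<le> r" if "r \<in> R" for r
    using that q.ip_nonneg WD unfolding R_def by auto
  have bdd: "bdd_below R" using R_lb by (rule bdd_belowI)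
  have normalize: "Re (q w w) / Re (ip w w) \<in> R" if w: "w \<in> W" "0 < Re (ip w w)" for w
  proof -
    let ?c = "of_real (1 / sqrt (Re (ip w w))) :: complex"
    have c: "(cmod ?c)\<^sup>2 = 1 / Re (ip w w)" using w by (simp add: norm_divide power_divide)
    have "scale ?c w \<in> W" using w subW by (intro subspace_scale)
    moreover have "Re (ip (scale ?c w) (scale ?c w)) = 1"
      unfolding norm_scale[OF WD(2)[OF w(1)]] c using w by simp
    moreover have "Re (q (scale ?c w) (scale ?c w)) = Re (q w w) / Re (ip w w)"
      unfolding q.norm_scale[OF WD(1)[OF w(1)]] c by simp
    ultimately show ?thesis unfolding R_def by (intro CollectI exI[of _ "scale ?c w"]) simp
  qed
  have xW: "x \<in> W" using x by (simp add: W_def)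
  have xpos: "0 < Re (ip x x)"
    using q.ip_nonneg[OF x(1)] x(3) ip_nonneg[OF D_in[OF x(1)]] by (cases "Re (ip x x) = 0") auto
  have Rne: "R \<noteq> {}" using normalize[OF xW xpos] by auto
  have \<mu>0: "0 \<le> \<mu>" unfolding \<mu>_def using Rne R_lb by (intro cInf_greatest)
  have \<mu>z: "\<mu> < z"
  proof -
    have "\<mu> \<le> Re (q x x) / Re (ip x x)"
      unfolding \<mu>_def using normalize[OF xW xpos] bdd by (rule cInf_lower)
    also have "\<dots> < z" using x(3) xpos by (simp add: field_simps)
    finally show ?thesis .
  qed
  have low: "\<mu> * Re (ip w w) \<le> Re (q w w)" if w: "w \<in> W" for w
  proof (cases "0 < Re (ip w w)")
    case True
    have "\<mu> \<le> Re (q w w) / Re (ip w w)"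
      unfolding \<mu>_def using normalize[OF w True] bdd by (rule cInf_lower)
    then show ?thesis using True by (simp add: field_simps)
  next
    case False
    then have "Re (ip w w) = 0" using ip_nonneg[OF WD(2)[OF w]] by simp
    then show ?thesis using q.ip_nonneg[OF WD(1)[OF w]] by simp
  qed
  have "\<exists>w. w \<in> W \<and> Re (ip w w) = 1 \<and> Re (q w w) < \<mu> + 1 / real (Suc m)" for m
  proof -
    have "Inf R < \<mu> + 1 / real (Suc m)" by (simp add: \<mu>_def)
    then obtain r where "r \<in> R" "r < \<mu> + 1 / real (Suc m)"
      using cInf_less_iff[OF Rne bdd] by blast
    then show ?thesis unfolding R_def by auto
  qed
  then obtain w0 where w0: "\<And>m. w0 m \<in> W" "\<And>m. Re (ip (w0 m) (w0 m)) = 1"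
      "\<And>m. Re (q (w0 m) (w0 m)) < \<mu> + 1 / real (Suc m)"
    by metis
  have "\<exists>k::nat \<Rightarrow> nat. strict_mono k \<and> cauchy ip (w0 \<circ> k)"
  proof (rule compact[of _ "\<mu> + 1"])
    fix m
    have "1 / real (Suc m) \<le> 1" by simp
    then have "Re (q (w0 m) (w0 m)) \<le> \<mu> + 1" using w0(3)[of m] by linarith
    then show "w0 m \<in> D \<and> Re (ip (w0 m) (w0 m)) \<le> \<mu> + 1 \<and> Re (q (w0 m) (w0 m)) \<le> \<mu> + 1"
      using w0 WD \<mu>0 by simp
  qed
  then obtain k :: "nat \<Rightarrow> nat" where k: "strict_mono k" "cauchy ip (w0 \<circ> k)" by blast
  define w where "w = w0 \<circ> k"
  have w: "w m \<in> W" "Re (ip (w m) (w m)) = 1" for m using w0 by (simp_all add: w_def)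
  have qw: "Re (q (w m) (w m)) < \<mu> + 1 / real (Suc m)" for m
  proof -
    have "1 / real (Suc (k m)) \<le> 1 / real (Suc m)"
      using seq_suble[OF k(1), of m] by (simp add: field_simps)
    then show ?thesis using w0(3)[of "k m"] unfolding w_def by simp
  qed
  have ip_cau: "cauchy ip w" using k by (simp add: w_def)
  have q_cau: "cauchy q w"
    unfolding cauchy_def
  proof (intro allI impI)
    fix e :: real assume e: "0 < e"
    define d where "d = e / (2 * (\<mu> + 1))"
    have d: "0 < d" using e \<mu>0 by (simp add: d_def)
    obtain N1 where N1: "\<And>i j. i \<ge> N1 \<Longrightarrow> j \<ge> N1 \<Longrightarrow> Re (ip (w i - w j) (w i - w j)) < d"
      using ip_cau d unfolding cauchy_def by metis
    obtain N2 where N2: "1 / real (Suc N2) < e / 8" using e nat_approx_posE[of "e / 8"] by auto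
    show "\<exists>N. \<forall>i\<ge>N. \<forall>j\<ge>N. Re (q (w i - w j) (w i - w j)) < e"
    proof (intro exI[of _ "max N1 N2"] allI impI)
      fix i j assume ij: "max N1 N2 \<le> i" "max N1 N2 \<le> j"
      have near: "Re (q (w m) (w m)) < \<mu> + e / 8" if "N2 \<le> m" for m
      proof -
        have "1 / real (Suc m) \<le> 1 / real (Suc N2)" using that by (simp add: field_simps)
        then show ?thesis using qw[of m] N2 by linarith
      qed
      have H: "w i \<in> H" "w j \<in> H" and D: "w i \<in> D" "w j \<in> D" using w WD by auto
      have "\<mu> * Re (ip (w i + w j) (w i + w j)) \<le> Re (q (w i + w j) (w i + w j))"
        using w by (intro low W_cl)
      moreover have "Re (ip (w i + w j) (w i + w j)) = 4 - Re (ip (w i - w j) (w i - w j))"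
        using H w by (simp add: norm_add norm_diff)
      moreover have "Re (q (w i - w j) (w i - w j)) =
          2 * Re (q (w i) (w i)) + 2 * Re (q (w j) (w j)) - Re (q (w i + w j) (w i + w j))"
        using D by (simp add: q.norm_add q.norm_diff)
      moreover have "Re (q (w i) (w i)) < \<mu> + e / 8" "Re (q (w j) (w j)) < \<mu> + e / 8"
        using near ij by auto
      moreover have "\<mu> * Re (ip (w i - w j) (w i - w j)) \<le> \<mu> * d"
        using N1[of i j] ij \<mu>0 by (intro mult_left_mono) auto
      moreover have "\<mu> * d \<le> e / 2" using \<mu>0 e by (simp add: d_def field_simps)
      ultimately show "Re (q (w i - w j) (w i - w j)) < e"
        by (simp add: algebra_simps)
    qed
  qed
  obtain v where v: "v \<in> D" "(\<lambda>m. Re (ip (w m - v) (w m - v))) \<longlonglongrightarrow> 0"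
      "(\<lambda>m. Re (q (w m - v) (w m - v))) \<longlonglongrightarrow> 0"
    using complete[OF _ ip_cau q_cau] w WD by blast
  have wH: "\<And>m. w m \<in> H" and wD: "\<And>m. w m \<in> D" and vH: "v \<in> H" using w WD v D_in by auto
  have orth: "ip v (u j) = 0" if "j \<in> J" for j
  proof -
    have "(\<lambda>m. ip (w m) (u j)) \<longlonglongrightarrow> ip v (u j)"
      using that by (intro ip_tendsto[OF v(2) wH vH] D_in uD)
    moreover have "(\<lambda>m. ip (w m) (u j)) = (\<lambda>m. 0)" using w that by (auto simp: W_def)
    ultimately show ?thesis by (metis LIMSEQ_const_iff)
  qed
  then have vW: "v \<in> W" using v by (simp add: W_def)
  have "(\<lambda>m. Re (ip (w m) (w m))) \<longlonglongrightarrow> Re (ip v v)" by (rule norm_tendsto[OF v(2) wH vH])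
  then have nv: "Re (ip v v) = 1" using w by (simp add: LIMSEQ_const_iff)
  have "(\<lambda>m. Re (q (w m) (w m))) \<longlonglongrightarrow> Re (q v v)" by (rule q.norm_tendsto[OF v(3) wD v(1)])
  moreover have "(\<lambda>m. \<mu> + 1 / real (Suc m)) \<longlonglongrightarrow> \<mu> + 0"
    by (intro tendsto_intros LIMSEQ_Suc[OF lim_1_over_n])
  ultimately have "Re (q v v) \<le> \<mu>" using qw by (auto intro: LIMSEQ_le less_imp_le)
  then have qv: "Re (q v v) = \<mu>" using low[OF vW] nv by simp
  interpret r: hermitian_form scale W "\<lambda>f g. q f g - of_real \<mu> * ip f g"
  proof
    show "subspace W" by (rule subW)
  next
    fix f h assume fh: "f \<in> W" "h \<in> W"
    show "q f h - of_real \<mu> * ip f h = cnj (q h f - of_real \<mu> * ip h f)"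
      using q.ip_sym[of f h] ip_sym[of f h] fh WD by simp
  next
    fix f assume "f \<in> W"
    then show "0 \<le> Re (q f f - of_real \<mu> * ip f f)" using low by simp
  qed (simp_all add: ip_simps q.ip_simps WD algebra_simps)
  have "eigvec \<mu> v"
    unfolding eigvec_def
  proof (intro conjI ballI)
    fix y assume y: "y \<in> D"
    have ry: "residual u J y \<in> W"
      using y residual_subspace[OF on q.sub] residual_orth[OF on] uD D_in by (auto simp: W_def)
    have "q v (residual u J y) = of_real \<mu> * ip v (residual u J y)"
      using r.ip_null[OF vW ry] qv nv by simp
    moreover have "ip v (residual u J y) = ip v y"
      using y vH D_in orth by (simp add: ip_residual_right[OF on])
    moreover have "q v (residual u J y) = q v y"
    proof -
      have S: "(\<Sum>k\<in>J. scale (ip y (u k)) (u k)) \<in> D" using uD by (intro q.H_sum q.H_scale)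
      have "q (\<Sum>k\<in>J. scale (ip y (u k)) (u k)) v = (\<Sum>k\<in>J. ip y (u k) * q (u k) v)"
        using uD v by (intro q.ip_sum)
      also have "\<dots> = 0"
      proof (rule sum.neutral, rule ballI)
        fix j assume j: "j \<in> J"
        have "q (u j) v = of_real (l j) * ip (u j) v" using eig[OF j] v by (simp add: eigvec_def)
        also have "ip (u j) v = 0" using ip_sym[of "u j" v] orth[OF j] vH D_in uD[OF j] by simp
        finally show "ip y (u j) * q (u j) v = 0" by simp
      qed
      finally have "q v (\<Sum>k\<in>J. scale (ip y (u k)) (u k)) = 0"
        using q.ip_sym[OF v(1) S] by simp
      then show ?thesis unfolding residual_def using y v S by (simp add: q.ip_diff_right)
    qed
    ultimately show "q v y = of_real \<mu> * ip v y" by simp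
  qed (rule v(1))
  moreover have "ip v v = 1" using ip_self_real[OF vH] nv by simp
  ultimately show ?thesis using \<mu>z orth by blast
qed

section \<open>The commutator inequality\<close>

text \<open>
  Yang's inequality for one symmetric multiplier, in abstract form: \<open>M j\<close> stands for the multiplier
  applied to \<open>u j\<close>, and \<open>comm\<close> says that the commutator of the operator with the multiplier maps
  \<open>u j\<close> to \<open>-2 T j\<close>.  Put \<open>a j k = ip (M j) (u k)\<close>; then \<open>ip (T j) (u k)\<close> is
  \<open>(l j - l k) / 2 * a j k\<close>.  The residual of \<open>M j\<close> is a trial vector for \<open>gap\<close>.  The bounds
  for the individual \<open>j\<close> contain multiples of \<open>|a j k|\<^sup>2\<close> summed over \<open>k\<close>, which cancel after
  weighting with \<open>z - l j\<close> and summing over \<open>j\<close>, because \<open>|a j k|\<close> is symmetric.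
\<close>

lemma (in form_pair) commutator_bound:
  fixes l :: "nat \<Rightarrow> real" and z :: real
  assumes on: "orthonormal u J" and eig: "\<And>k. k \<in> J \<Longrightarrow> eigvec (l k) (u k)"
    and gap: "\<And>v. v \<in> D \<Longrightarrow> (\<And>k. k \<in> J \<Longrightarrow> ip v (u k) = 0) \<Longrightarrow> z * Re (ip v v) \<le> Re (q v v)"
    and z: "\<And>k. k \<in> J \<Longrightarrow> l k \<le> z"
    and M: "\<And>j. j \<in> J \<Longrightarrow> M j \<in> D" and T: "\<And>j. j \<in> J \<Longrightarrow> T j \<in> H"
    and M_sym: "\<And>j k. j \<in> J \<Longrightarrow> k \<in> J \<Longrightarrow> ip (M j) (u k) = cnj (ip (M k) (u j))"
    and comm: "\<And>j w. j \<in> J \<Longrightarrow> w \<in> D \<Longrightarrow> q (M j) w = of_real (l j) * ip (M j) w - 2 * ip (T j) w"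
  shows "(\<Sum>j\<in>J. (z - l j)\<^sup>2 * (- 2 * Re (ip (T j) (M j)))) \<le> 4 * (\<Sum>j\<in>J. (z - l j) * Re (ip (T j) (T j)))"
proof -
  define a where "a j k = ip (M j) (u k)" for j k
  define N where "N j k = (cmod (a j k))\<^sup>2" for j k
  have fin: "finite J" using on by (simp add: orthonormal_def)
  have uD: "u k \<in> D" and uH: "u k \<in> H" if "k \<in> J" for k
    using eig that D_in by (auto simp: eigvec_def)
  have MH: "M j \<in> H" if "j \<in> J" for j using M D_in that by blast
  have N_sym: "N j k = N k j" if "j \<in> J" "k \<in> J" for j k
    unfolding N_def a_def by (subst M_sym[OF that]) simp
  have b: "ip (T j) (u k) = of_real ((l j - l k) / 2) * a j k" if jk: "j \<in> J" "k \<in> J" for j k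
  proof -
    have "q (M j) (u k) = cnj (q (u k) (M j))" using M uD jk by (intro q.ip_sym) auto
    also have "\<dots> = cnj (of_real (l k) * ip (u k) (M j))"
      using eig[OF jk(2)] M[OF jk(1)] by (simp add: eigvec_def)
    also have "\<dots> = of_real (l k) * a j k"
      using ip_sym[of "M j" "u k"] MH uH jk by (simp add: a_def)
    finally show ?thesis using comm[OF jk(1) uD[OF jk(2)]] by (simp add: a_def field_simps)
  qed
  have step: "(z - l j) * (- 2 * Re (ip (T j) (M j)) + (\<Sum>k\<in>J. (l j - l k) * N j k))
      \<le> 4 * Re (ip (T j) (T j)) - (\<Sum>k\<in>J. (l j - l k)\<^sup>2 * N j k)" if j: "j \<in> J" for j
  proof -
    define v where "v = residual u J (M j)"
    define t where "t = residual u J (T j)"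
    define P where "P = - 2 * Re (ip (T j) v)"
    have vD: "v \<in> D" unfolding v_def by (rule residual_subspace[OF on q.sub uD M[OF j]])
    then have vH: "v \<in> H" by (rule D_in)
    have tH: "t \<in> H" unfolding t_def by (rule residual_in[OF on T[OF j]])
    have v_orth: "ip v (u k) = 0" if "k \<in> J" for k
      unfolding v_def using residual_orth[OF on MH[OF j] that] .
    have nn: "a j k * cnj (a j k) = of_real (N j k)" for k
      unfolding N_def by (rule complex_norm_square[symmetric])
    have P: "P = - 2 * Re (ip (T j) (M j)) + (\<Sum>k\<in>J. (l j - l k) * N j k)"
    proof -
      have "(\<Sum>k\<in>J. ip (T j) (u k) * cnj (ip (M j) (u k))) = (\<Sum>k\<in>J. of_real ((l j - l k) / 2 * N j k))"
      proof (rule sum.cong)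
        fix k assume k: "k \<in> J"
        have "ip (T j) (u k) * cnj (ip (M j) (u k)) = of_real ((l j - l k) / 2) * (a j k * cnj (a j k))"
          unfolding b[OF j k] by (simp only: a_def mult.assoc)
        then show "ip (T j) (u k) * cnj (ip (M j) (u k)) = of_real ((l j - l k) / 2 * N j k)"
          unfolding nn by simp
      qed simp
      then show ?thesis
        unfolding P_def v_def ip_residual_right[OF on T[OF j] MH[OF j]]
        by (simp add: sum_distrib_left flip: of_real_sum)
    qed
    have tt: "4 * Re (ip t t) = 4 * Re (ip (T j) (T j)) - (\<Sum>k\<in>J. (l j - l k)\<^sup>2 * N j k)"
    proof -
      have "(\<Sum>k\<in>J. ip (T j) (u k) * cnj (ip (T j) (u k))) = (\<Sum>k\<in>J. of_real (((l j - l k) / 2)\<^sup>2 * N j k))"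
      proof (rule sum.cong)
        fix k assume k: "k \<in> J"
        have "ip (T j) (u k) * cnj (ip (T j) (u k))
            = of_real ((l j - l k) / 2) * of_real ((l j - l k) / 2) * (a j k * cnj (a j k))"
          unfolding b[OF j k] by (simp only: complex_cnj_mult complex_cnj_complex_of_real mult.assoc mult.left_commute)
        then show "ip (T j) (u k) * cnj (ip (T j) (u k)) = of_real (((l j - l k) / 2)\<^sup>2 * N j k)"
          unfolding nn by (simp add: power2_eq_square)
      qed simp
      then show ?thesis
        unfolding t_def ip_residual_residual[OF on T[OF j] T[OF j]] ip_residual_right[OF on T[OF j] T[OF j]]
        by (simp add: sum_distrib_left power_divide flip: of_real_sum)
    qed
    have tv: "Re (ip t v) = - P / 2"
      unfolding t_def v_def ip_residual_residual[OF on T[OF j] MH[OF j]] P_def by simp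
    have qv: "(z - l j) * Re (ip v v) \<le> P"
    proof -
      have Mv: "ip (M j) v = ip v v"
        unfolding v_def ip_residual_residual[OF on MH[OF j] MH[OF j]] ..
      have S: "(\<Sum>k\<in>J. scale (a j k) (u k)) \<in> D" using uD by (intro q.H_sum q.H_scale)
      have "q (\<Sum>k\<in>J. scale (a j k) (u k)) v = (\<Sum>k\<in>J. a j k * q (u k) v)"
        using uD vD by (intro q.ip_sum)
      also have "\<dots> = 0"
      proof (rule sum.neutral, rule ballI)
        fix k assume k: "k \<in> J"
        have "q (u k) v = of_real (l k) * ip (u k) v" using eig[OF k] vD by (simp add: eigvec_def)
        also have "ip (u k) v = 0" using ip_sym[of "u k" v] v_orth[OF k] vH uH[OF k] by simp
        finally show "a j k * q (u k) v = 0" by simp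
      qed
      finally have "q v v = q (M j) v"
        using S M[OF j] vD q.ip_diff[of "M j" "\<Sum>k\<in>J. scale (a j k) (u k)" v]
        by (simp add: v_def residual_def a_def)
      then have "Re (q v v) = l j * Re (ip v v) + P"
        using comm[OF j vD] by (simp add: Mv P_def)
      then show ?thesis using gap[OF vD v_orth] by (simp add: algebra_simps)
    qed
    \<comment> \<open>Expanding the square norm of \<open>(z - l j) v + 2 t\<close> replaces a Cauchy-Schwarz estimate of \<open>ip t v\<close>.\<close>
    let ?c = "of_real (z - l j) :: complex"
    have "0 \<le> Re (ip (scale ?c v + scale 2 t) (scale ?c v + scale 2 t))"
      using vH tH by (intro ip_nonneg H_closed)
    also have "\<dots> = (z - l j)\<^sup>2 * Re (ip v v) + 4 * (z - l j) * Re (ip t v) + 4 * Re (ip t t)"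
    proof -
      have "ip v t = cnj (ip t v)" using vH tH by (rule ip_sym)
      then have "Re (ip (scale ?c v) (scale 2 t)) = 2 * (z - l j) * Re (ip t v)"
        unfolding ip_scale[OF vH H_scale[OF tH]] ip_scale_right[OF tH vH] by simp
      then show ?thesis
        unfolding norm_add[OF H_scale[OF vH] H_scale[OF tH]] norm_scale[OF vH] norm_scale[OF tH] norm_of_real
        by simp
    qed
    also have "\<dots> = (z - l j) * ((z - l j) * Re (ip v v)) - 2 * (z - l j) * P + 4 * Re (ip t t)"
      unfolding tv by (simp add: power2_eq_square algebra_simps)
    also have "\<dots> \<le> (z - l j) * P - 2 * (z - l j) * P + 4 * Re (ip t t)"
      using mult_left_mono[OF qv, of "z - l j"] z[OF j] by simp
    finally have "(z - l j) * P \<le> 4 * Re (ip t t)" by (simp add: algebra_simps)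
    then show ?thesis unfolding P tt .
  qed
  let ?w = "\<lambda>j. - 2 * Re (ip (T j) (M j))"
  have "(\<Sum>j\<in>J. (z - l j) * ((z - l j) * (?w j + (\<Sum>k\<in>J. (l j - l k) * N j k))))
      \<le> (\<Sum>j\<in>J. (z - l j) * (4 * Re (ip (T j) (T j)) - (\<Sum>k\<in>J. (l j - l k)\<^sup>2 * N j k)))"
    using step z by (intro sum_mono mult_left_mono) auto
  moreover have "(\<Sum>j\<in>J. (z - l j) * ((z - l j) * (?w j + (\<Sum>k\<in>J. (l j - l k) * N j k))))
      = (\<Sum>j\<in>J. (z - l j)\<^sup>2 * ?w j) + (\<Sum>j\<in>J. \<Sum>k\<in>J. (z - l j)\<^sup>2 * (l j - l k) * N j k)"
    unfolding sum.distrib[symmetric]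
    by (intro sum.cong) (simp_all add: sum_distrib_left power2_eq_square algebra_simps)
  moreover have "(\<Sum>j\<in>J. (z - l j) * (4 * Re (ip (T j) (T j)) - (\<Sum>k\<in>J. (l j - l k)\<^sup>2 * N j k)))
      = 4 * (\<Sum>j\<in>J. (z - l j) * Re (ip (T j) (T j))) - (\<Sum>j\<in>J. \<Sum>k\<in>J. (z - l j) * (l j - l k)\<^sup>2 * N j k)"
    unfolding sum_distrib_left sum_subtractf[symmetric]
    by (intro sum.cong) (simp_all add: sum_distrib_left algebra_simps)
  moreover have "(\<Sum>j\<in>J. \<Sum>k\<in>J. (z - l j)\<^sup>2 * (l j - l k) * N j k)
      = - (\<Sum>j\<in>J. \<Sum>k\<in>J. (z - l j) * (l j - l k)\<^sup>2 * N j k)"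
  proof -
    have swap: "(\<Sum>j\<in>J. \<Sum>k\<in>J. F j k) = (\<Sum>j\<in>J. \<Sum>k\<in>J. F k j)" for F :: "nat \<Rightarrow> nat \<Rightarrow> real"
      by (rule sum.swap)
    let ?F = "\<lambda>j k. (z - l j)\<^sup>2 * (l j - l k) * N j k + (z - l j) * (l j - l k)\<^sup>2 * N j k"
    have "(\<Sum>j\<in>J. \<Sum>k\<in>J. ?F j k) + (\<Sum>j\<in>J. \<Sum>k\<in>J. ?F k j) = 0"
      unfolding sum.distrib[symmetric]
    proof (intro sum.neutral ballI)
      fix j k assume "j \<in> J" "k \<in> J"
      then have "N k j = N j k" by (rule N_sym[symmetric])
      then show "?F j k + ?F k j = 0" by (simp only:) (simp add: power2_eq_square algebra_simps)
    qed
    then have "(\<Sum>j\<in>J. \<Sum>k\<in>J. ?F j k) = 0" using swap[of ?F] by simp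
    then show ?thesis by (simp add: sum.distrib)
  qed
  ultimately show ?thesis by simp
qed

section \<open>Eigenvalues with multiplicity\<close>

lemma (in form_pair) eigenspace_subspace: "subspace {u. eigvec \<mu> u}"
  using q.sub D_in
  by (auto simp: subspace_def eigvec_def q.ip_simps ip_simps q.ip_zero ip_zero algebra_simps)

text \<open>
  The form has the eigenvalue list \<open>ev 1 \<le> ev 2 \<le> \<dots>\<close>, counted with multiplicity.  Completeness of
  the eigenvectors is not assumed.
\<close>

locale discrete_spectrum = form_pair scale H ip D q
  for scale :: "complex \<Rightarrow> 'a::ab_group_add \<Rightarrow> 'a" and H ip D q +
  fixes ev :: "nat \<Rightarrow> real"
  assumes definite: "u \<in> D \<Longrightarrow> Re (ip u u) = 0 \<Longrightarrow> u = 0"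
    and ev_mono: "mono_on {1..} ev"
    and ev_mult: "finite {j. 1 \<le> j \<and> ev j = \<mu>}"
      "\<exists>B. finite B \<and> B \<subseteq> {u. eigvec \<mu> u} \<and> independent B \<and> {u. eigvec \<mu> u} \<subseteq> span B \<and>
           card B = card {j. 1 \<le> j \<and> ev j = \<mu>}"
begin

lemma orthonormal_eigenvectors:
  "\<exists>u. orthonormal u {1..n} \<and> (\<forall>j\<in>{1..n}. eigvec (ev j) (u j))"
proof (induction n)
  case 0
  show ?case by (simp add: orthonormal_def)
next
  case (Suc n)
  then obtain u where u: "orthonormal u {1..n}" "\<And>j. j \<in> {1..n} \<Longrightarrow> eigvec (ev j) (u j)" by blast
  define \<mu> where "\<mu> = ev (Suc n)"
  define J where "J = {j \<in> {1..n}. ev j = \<mu>}"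
  have onJ: "orthonormal u J" using u(1) unfolding orthonormal_def J_def by auto
  obtain B where B: "finite B" "B \<subseteq> {u. eigvec \<mu> u}" "independent B"
      "card B = card {j. 1 \<le> j \<and> ev j = \<mu>}"
    using ev_mult(2)[of \<mu>] by blast
  have less: "card J < card B"
  proof -
    have "Suc n \<in> {j. 1 \<le> j \<and> ev j = \<mu>} - J" by (simp add: J_def \<mu>_def)
    moreover have "J \<subseteq> {j. 1 \<le> j \<and> ev j = \<mu>}" by (auto simp: J_def)
    ultimately have "J \<subset> {j. 1 \<le> j \<and> ev j = \<mu>}" by blast
    then show ?thesis unfolding B(4) by (rule psubset_card_mono[OF ev_mult(1)])
  qed
  \<comment> \<open>Fewer than \<open>card B\<close> of the chosen vectors lie in this eigenspace, so they do not span it.\<close>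
  have "\<not> B \<subseteq> span (u ` J)"
  proof
    assume "B \<subseteq> span (u ` J)"
    then have "card B \<le> card (u ` J)"
      using independent_span_bound[of "u ` J" B] B by (simp add: J_def)
    also have "\<dots> \<le> card J" by (rule card_image_le) (simp add: J_def)
    finally show False using less by simp
  qed
  then obtain x where x: "x \<in> B" "x \<notin> span (u ` J)" by blast
  have xe: "eigvec \<mu> x" using x B by auto
  then have xH: "x \<in> H" by (auto simp: eigvec_def D_in)
  define r where "r = residual u J x"
  have re: "eigvec \<mu> r"
    using residual_subspace[OF onJ eigenspace_subspace[of \<mu>], of x] u(2) xe
    by (auto simp: r_def J_def)
  then have rD: "r \<in> D" and rH: "r \<in> H" by (auto simp: eigvec_def D_in)
  have "r \<noteq> 0"
  proof
    assume "r = 0"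
    then have "x = (\<Sum>k\<in>J. scale (ip x (u k)) (u k))" by (simp add: r_def residual_def)
    also have "\<dots> \<in> span (u ` J)" by (intro span_sum span_scale span_base) auto
    finally show False using x by simp
  qed
  then have pos: "0 < Re (ip r r)" using definite[OF rD] ip_nonneg[OF rH] by fastforce
  define c where "c = (of_real (1 / sqrt (Re (ip r r))) :: complex)"
  define y where "y = scale c r"
  have ye: "eigvec \<mu> y"
    using re subspace_scale[OF eigenspace_subspace[of \<mu>], of r c] by (simp add: y_def)
  then have yH: "y \<in> H" by (auto simp: eigvec_def D_in)
  have "Re (ip y y) = 1"
    using pos unfolding y_def norm_scale[OF rH] by (simp add: c_def norm_divide power_divide)
  then have yy: "ip y y = 1" using ip_self_real[OF yH] by simp
  have y_orth: "ip y (u j) = 0" if j: "j \<in> {1..n}" for j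
  proof (cases "ev j = \<mu>")
    case True
    then have "j \<in> J" using j by (simp add: J_def)
    then have "ip r (u j) = 0" unfolding r_def by (rule residual_orth[OF onJ xH])
    moreover have "u j \<in> H" using u(1) j by (simp add: orthonormal_def)
    ultimately show ?thesis unfolding y_def using rH by (simp add: ip_scale)
  next
    case False
    then show ?thesis using eigvec_orth[OF ye u(2)[OF j]] by simp
  qed
  have y_orth': "ip (u j) y = 0" if "j \<in> {1..n}" for j
    using ip_sym[of "u j" y] y_orth[OF that] yH u(1) that by (simp add: orthonormal_def)
  show ?case
  proof (intro exI[of _ "u(Suc n := y)"] conjI ballI)
    have S: "{1..Suc n} = insert (Suc n) {1..n}" by auto
    show "orthonormal (u(Suc n := y)) {1..Suc n}"
      unfolding S using u(1) yH yy y_orth y_orth' by (auto simp: orthonormal_def)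
  next
    fix j assume "j \<in> {1..Suc n}"
    then show "eigvec (ev j) ((u(Suc n := y)) j)"
      using u(2) ye by (cases "j = Suc n") (auto simp: \<mu>_def)
  qed
qed

text \<open>
  An eigenvector orthogonal to the first \<open>n\<close> eigenvectors cannot belong to an eigenvalue below
  \<open>ev (n + 1)\<close>: its eigenspace would contain more independent vectors than the multiplicity permits.
\<close>

lemma no_further_eigenvector:
  assumes u: "orthonormal u {1..n}" "\<And>j. j \<in> {1..n} \<Longrightarrow> eigvec (ev j) (u j)"
    and v: "eigvec \<mu> v" "ip v v = 1" "\<And>k. k \<in> {1..n} \<Longrightarrow> ip v (u k) = 0"
  shows "ev (n + 1) \<le> \<mu>"
proof (rule ccontr)
  assume less: "\<not> ev (n + 1) \<le> \<mu>"
  define J where "J = {j. 1 \<le> j \<and> ev j = \<mu>}"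
  have J: "J \<subseteq> {1..n}"
  proof
    fix j assume j: "j \<in> J"
    have "\<not> n + 1 \<le> j"
    proof
      assume "n + 1 \<le> j"
      then have "ev (n + 1) \<le> ev j" using ev_mono by (auto simp: mono_on_def)
      then show False using j less by (simp add: J_def)
    qed
    then show "j \<in> {1..n}" using j by (simp add: J_def)
  qed
  obtain B where B: "finite B" "{u. eigvec \<mu> u} \<subseteq> span B" "card B = card J"
    using ev_mult(2)[of \<mu>] unfolding J_def by blast
  have vH: "v \<in> H" using v(1) by (auto simp: eigvec_def D_in)
  have v_orth': "ip (u k) v = 0" if "k \<in> {1..n}" for k
    using ip_sym[of "u k" v] v(3)[OF that] vH u(1) that by (simp add: orthonormal_def)
  define w where "w = u(0 := v)"
  have "orthonormal w (insert 0 J)"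
    using u(1) v J vH v_orth' finite_subset[OF J] unfolding orthonormal_def w_def
    by (auto simp: subset_iff)
  then have ind: "independent (w ` insert 0 J)" and inj: "inj_on w (insert 0 J)"
    using orthonormal_independent by blast+
  have "w ` insert 0 J \<subseteq> {u. eigvec \<mu> u}"
    using u(2) v(1) J by (auto simp: w_def J_def)
  then have "card (w ` insert 0 J) \<le> card B"
    using independent_span_bound[OF B(1) ind] B(2) by blast
  moreover have "card (w ` insert 0 J) = Suc (card J)"
    unfolding card_image[OF inj] using J finite_subset[OF J] by (subst card_insert_disjoint) auto
  ultimately show False using B(3) by simp
qed

end

section \<open>Square-integrable functions\<close>

text \<open>
  Square-integrable complex functions on a measure space, not identified up to null sets.
\<close>

definition lsq :: "'a measure \<Rightarrow> ('a \<Rightarrow> complex) set" where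
  "lsq M = {f \<in> borel_measurable M. integrable M (\<lambda>x. (cmod (f x))\<^sup>2)}"

definition pscale :: "complex \<Rightarrow> ('a \<Rightarrow> complex) \<Rightarrow> 'a \<Rightarrow> complex" where
  "pscale c f = (\<lambda>x. c * f x)"

global_interpretation pfun: vector_space pscale
  by unfold_locales (auto simp: pscale_def fun_eq_iff algebra_simps)

lemma lsq_bound:
  assumes "f \<in> lsq M" "g \<in> borel_measurable M" "AE x in M. cmod (g x) \<le> C * cmod (f x)"
  shows "g \<in> lsq M"
proof -
  have [measurable]: "g \<in> borel_measurable M" by fact
  have "integrable M (\<lambda>x. C\<^sup>2 * (cmod (f x))\<^sup>2)" using assms by (simp add: lsq_def)
  then have "integrable M (\<lambda>x. (cmod (g x))\<^sup>2)"
  proof (rule Bochner_Integration.integrable_bound)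
    show "AE x in M. norm ((cmod (g x))\<^sup>2) \<le> norm (C\<^sup>2 * (cmod (f x))\<^sup>2)"
      using assms(3)
    proof eventually_elim
      case (elim x)
      then have "(cmod (g x))\<^sup>2 \<le> (C * cmod (f x))\<^sup>2" by (intro power_mono) auto
      then show ?case by (simp add: power_mult_distrib)
    qed
  qed measurable
  then show ?thesis using assms by (simp add: lsq_def)
qed

lemma lsq_scale: "f \<in> lsq M \<Longrightarrow> (\<lambda>x. c * f x) \<in> lsq M"
  by (auto simp: lsq_def norm_mult power_mult_distrib)

lemma lsq_cnj: "f \<in> lsq M \<Longrightarrow> (\<lambda>x. cnj (f x)) \<in> lsq M"
proof -
  assume f: "f \<in> lsq M"
  have "cnj \<in> borel_measurable borel" by (intro borel_measurable_continuous_onI continuous_intros)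
  then show ?thesis using f measurable_compose[of f M borel cnj borel] by (simp add: lsq_def)
qed

lemma cmod_sum_square: "(cmod (a + b))\<^sup>2 \<le> 2 * (cmod a)\<^sup>2 + 2 * (cmod b)\<^sup>2"
proof -
  have "(cmod (a + b))\<^sup>2 \<le> (cmod a + cmod b)\<^sup>2" by (intro power_mono norm_triangle_ineq) simp
  also have "\<dots> \<le> 2 * (cmod a)\<^sup>2 + 2 * (cmod b)\<^sup>2"
    using zero_le_power2[of "cmod a - cmod b"] by (simp add: power2_eq_square algebra_simps)
  finally show ?thesis .
qed

lemma lsq_add: 
  assumes "f \<in> lsq M" "g \<in> lsq M"
  shows "(\<lambda>x. f x + g x) \<in> lsq M"
proof -
  have [measurable]: "f \<in> borel_measurable M" "g \<in> borel_measurable M" using assms by (auto simp: lsq_def)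
  have "integrable M (\<lambda>x. 2 * (cmod (f x))\<^sup>2 + 2 * (cmod (g x))\<^sup>2)" using assms by (simp add: lsq_def)
  then have "integrable M (\<lambda>x. (cmod (f x + g x))\<^sup>2)"
    by (rule Bochner_Integration.integrable_bound) (auto simp: cmod_sum_square)
  then show ?thesis by (simp add: lsq_def)
qed

lemma lsq_diff: "f \<in> lsq M \<Longrightarrow> g \<in> lsq M \<Longrightarrow> (\<lambda>x. f x - g x) \<in> lsq M"
  using lsq_add[of f M "\<lambda>x. (-1) * g x"] lsq_scale[of g M "-1"] by simp

lemma lsq_zero: "(\<lambda>x. 0) \<in> lsq M" by (simp add: lsq_def)

lemma lsq_mult:
  assumes "f \<in> lsq M" "g \<in> lsq M"
  shows "integrable M (\<lambda>x. f x * g x)"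
proof -
  have [measurable]: "f \<in> borel_measurable M" "g \<in> borel_measurable M" using assms by (auto simp: lsq_def)
  have "integrable M (\<lambda>x. (cmod (f x))\<^sup>2 + (cmod (g x))\<^sup>2)" using assms by (simp add: lsq_def)
  then show ?thesis
  proof (rule Bochner_Integration.integrable_bound)
    show "AE x in M. norm (f x * g x) \<le> norm ((cmod (f x))\<^sup>2 + (cmod (g x))\<^sup>2)"
    proof (rule AE_I2)
      fix x
      have "cmod (f x) * cmod (g x) \<le> (cmod (f x))\<^sup>2 + (cmod (g x))\<^sup>2"
        using zero_le_power2[of "cmod (f x) - cmod (g x)"] mult_nonneg_nonneg[OF norm_ge_zero[of "f x"] norm_ge_zero[of "g x"]]
        unfolding power2_diff by linarith
      then show "norm (f x * g x) \<le> norm ((cmod (f x))\<^sup>2 + (cmod (g x))\<^sup>2)"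
        by (simp add: norm_mult)
    qed
  qed measurable
qed

lemma lsq_mult_cnj: "f \<in> lsq M \<Longrightarrow> g \<in> lsq M \<Longrightarrow> integrable M (\<lambda>x. f x * cnj (g x))"
  by (rule lsq_mult[OF _ lsq_cnj])

lemma integral_mult_cnj_self: "(\<integral>x. f x * cnj (f x) \<partial>M) = of_real (\<integral>x. (cmod (f x))\<^sup>2 \<partial>M)"
  by (simp only: complex_norm_square[symmetric] integral_complex_of_real)

lemma lsq_form: "hermitian_form pscale (lsq M) (\<lambda>f g. \<integral>x. f x * cnj (g x) \<partial>M)"
proof
  show "pfun.subspace (lsq M)"
    using lsq_add[of _ M] lsq_scale[of _ M] lsq_zero[of M]
    unfolding pfun.subspace_def pscale_def plus_fun_def zero_fun_def by blast
next
  fix f g h assume "f \<in> lsq M" "g \<in> lsq M" "h \<in> lsq M"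
  then show "(\<integral>x. (f + g) x * cnj (h x) \<partial>M) = (\<integral>x. f x * cnj (h x) \<partial>M) + (\<integral>x. g x * cnj (h x) \<partial>M)"
    by (simp add: distrib_right lsq_mult_cnj)
next
  fix f h c assume "f \<in> lsq M" "h \<in> lsq M"
  then show "(\<integral>x. pscale c f x * cnj (h x) \<partial>M) = c * (\<integral>x. f x * cnj (h x) \<partial>M)"
    by (simp add: pscale_def mult.assoc)
next
  fix f h
  show "(\<integral>x. f x * cnj (h x) \<partial>M) = cnj (\<integral>x. h x * cnj (f x) \<partial>M)"
    using Bochner_Integration.integral_cnj[of M "\<lambda>x. h x * cnj (f x)"] by (simp add: mult.commute)
next
  fix f
  show "0 \<le> Re (\<integral>x. f x * cnj (f x) \<partial>M)" by (simp add: integral_mult_cnj_self)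
qed

lemma lsq_Cauchy_Schwarz:
  assumes "f \<in> lsq M" "g \<in> lsq M"
  shows "(cmod (\<integral>x. f x * cnj (g x) \<partial>M))\<^sup>2 \<le> (\<integral>x. (cmod (f x))\<^sup>2 \<partial>M) * (\<integral>x. (cmod (g x))\<^sup>2 \<partial>M)"
  using hermitian_form.Cauchy_Schwarz[OF lsq_form assms] by (simp add: integral_mult_cnj_self)

context finite_measure
begin

lemma lsq_bounded:
  assumes "f \<in> borel_measurable M" "\<And>x. x \<in> space M \<Longrightarrow> cmod (f x) \<le> C"
  shows "f \<in> lsq M"
proof -
  have "(\<lambda>x. 1) \<in> lsq M" by (simp add: lsq_def)
  then show ?thesis
    by (rule lsq_bound[of _ _ _ C]) (use assms in auto)
qed

lemma lsq_integrable: "f \<in> lsq M \<Longrightarrow> integrable M f"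
  using lsq_mult[of f M "\<lambda>x. 1"] lsq_bounded[of "\<lambda>x. 1" 1] by simp

lemma lsq_L1_bound:
  assumes "f \<in> lsq M"
  shows "(\<integral>x. cmod (f x) \<partial>M)\<^sup>2 \<le> measure M (space M) * (\<integral>x. (cmod (f x))\<^sup>2 \<partial>M)"
proof -
  have 1: "(\<lambda>x. of_real (cmod (f x)) :: complex) \<in> lsq M" "(\<lambda>x. 1) \<in> lsq M"
    using assms lsq_bounded[of "\<lambda>x. 1" 1] by (auto simp: lsq_def)
  show ?thesis using lsq_Cauchy_Schwarz[OF 1] by (simp add: mult.commute)
qed

text \<open>
  The Riesz-Fischer theorem.  A subsequence with geometrically decreasing increments converges almost
  everywhere, and Fatou's lemma identifies its limit as the limit in square mean.
\<close>

theorem lsq_complete: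
  fixes f :: "nat \<Rightarrow> 'a \<Rightarrow> complex"
  assumes f: "\<And>n. f n \<in> lsq M"
    and cauchy: "\<And>e. 0 < e \<Longrightarrow> \<exists>N. \<forall>i\<ge>N. \<forall>j\<ge>N. (\<integral>x. (cmod (f i x - f j x))\<^sup>2 \<partial>M) < e"
  shows "\<exists>g\<in>lsq M. (\<lambda>n. \<integral>x. (cmod (f n x - g x))\<^sup>2 \<partial>M) \<longlonglongrightarrow> 0"
proof -
  have fm [measurable]: "f n \<in> borel_measurable M" for n using f by (simp add: lsq_def)
  have "\<exists>N. \<forall>n. \<forall>i\<ge>N n. \<forall>j\<ge>N n. (\<integral>x. (cmod (f i x - f j x))\<^sup>2 \<partial>M) < (1/4) ^ n"
    by (rule choice) (intro allI cauchy, simp)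
  then obtain N where N: "\<And>n i j. i \<ge> N n \<Longrightarrow> j \<ge> N n \<Longrightarrow> (\<integral>x. (cmod (f i x - f j x))\<^sup>2 \<partial>M) < (1/4) ^ n"
    by blast
  \<comment> \<open>A nondecreasing choice of indices with \<open>N n \<le> k n\<close> and \<open>n \<le> k n\<close>.\<close>
  define k where "k n = (\<Sum>i\<le>n. N i) + n" for n
  have kN: "N n \<le> k n" for n unfolding k_def by (rule trans_le_add1, rule member_le_sum) auto
  have kS: "k n \<le> k (Suc n)" for n by (simp add: k_def)
  have kn: "n \<le> k n" for n by (simp add: k_def)
  define d where "d n x = f (k (Suc n)) x - f (k n) x" for n x
  have d: "d n \<in> lsq M" for n unfolding d_def by (intro lsq_diff f)
  have [measurable]: "d n \<in> borel_measurable M" for n using d by (simp add: lsq_def)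
  define \<mu> where "\<mu> = sqrt (measure M (space M))"
  have d1: "(\<integral>x. cmod (d n x) \<partial>M) \<le> \<mu> * (1/2) ^ n" for n
  proof -
    have "(\<integral>x. cmod (d n x) \<partial>M)\<^sup>2 \<le> measure M (space M) * (\<integral>x. (cmod (d n x))\<^sup>2 \<partial>M)"
      by (rule lsq_L1_bound[OF d])
    also have "\<dots> \<le> measure M (space M) * (1/4) ^ n"
      using N[of n "k (Suc n)" "k n"] kN kS[of n] order_trans[OF kN kS, of n]
      by (intro mult_left_mono) (auto simp: d_def)
    also have "\<dots> = (\<mu> * (1/2) ^ n)\<^sup>2"
      by (simp add: \<mu>_def power_mult_distrib power_divide flip: power_mult) (simp add: power_mult mult.commute[of n 2])
    finally show ?thesis by (rule power2_le_imp_le) (simp add: \<mu>_def)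
  qed
  have "(\<integral>\<^sup>+x. (\<Sum>n. ennreal (cmod (d n x))) \<partial>M) = (\<Sum>n. (\<integral>\<^sup>+x. ennreal (cmod (d n x)) \<partial>M))"
    by (rule nn_integral_suminf) measurable
  also have "\<dots> = (\<Sum>n. ennreal (\<integral>x. cmod (d n x) \<partial>M))"
    by (intro suminf_cong nn_integral_eq_integral) (auto intro: lsq_integrable[OF d])
  also have "\<dots> < top"
  proof -
    have "summable (\<lambda>n. \<integral>x. cmod (d n x) \<partial>M)"
      by (rule summable_comparison_test'[of "\<lambda>n. \<mu> * (1/2) ^ n" 0]) (use d1 in \<open>auto intro: summable_mult\<close>)
    then show ?thesis by (subst suminf_ennreal2) (auto simp: less_top)
  qed
  finally have "AE x in M. (\<Sum>n. ennreal (cmod (d n x))) \<noteq> \<infinity>"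
    by (intro nn_integral_noteq_infinite) auto
  then have conv: "AE x in M. convergent (\<lambda>n. f (k n) x)"
  proof eventually_elim
    case (elim x)
    then have "summable (\<lambda>n. cmod (d n x))" by (intro summable_suminf_not_top) auto
    then have "summable (\<lambda>n. d n x)" by (rule summable_norm_cancel)
    then have "convergent (\<lambda>n. \<Sum>i<n. d i x)" by (simp add: summable_iff_convergent)
    then have "convergent (\<lambda>n. (\<Sum>i<n. d i x) + f (k 0) x)" by (simp add: convergent_add_const_right_iff)
    moreover have "(\<Sum>i<n. d i x) + f (k 0) x = f (k n) x" for n
      unfolding d_def sum_lessThan_telescope[of "\<lambda>n. f (k n) x"] by simp
    ultimately show ?case by simp
  qed
  define g where "g x = lim (\<lambda>n. f (k n) x)" for x
  have [measurable]: "g \<in> borel_measurable M" unfolding g_def by (rule borel_measurable_lim_metric) measurable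
  have bound: "(\<integral>\<^sup>+x. ennreal ((cmod (f m x - g x))\<^sup>2) \<partial>M) \<le> ennreal e"
    if m: "\<And>i j. N0 \<le> i \<Longrightarrow> N0 \<le> j \<Longrightarrow> (\<integral>x. (cmod (f i x - f j x))\<^sup>2 \<partial>M) < e" "N0 \<le> m" for m e N0
  proof -
    have "(\<integral>\<^sup>+x. ennreal ((cmod (f m x - g x))\<^sup>2) \<partial>M)
        = (\<integral>\<^sup>+x. liminf (\<lambda>n. ennreal ((cmod (f m x - f (k n) x))\<^sup>2)) \<partial>M)"
    proof (rule nn_integral_cong_AE)
      show "AE x in M. ennreal ((cmod (f m x - g x))\<^sup>2) = liminf (\<lambda>n. ennreal ((cmod (f m x - f (k n) x))\<^sup>2))"
        using conv
      proof eventually_elim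
        case (elim x)
        then have "(\<lambda>n. f (k n) x) \<longlonglongrightarrow> g x" unfolding g_def by (simp add: convergent_LIMSEQ_iff)
        then have "(\<lambda>n. ennreal ((cmod (f m x - f (k n) x))\<^sup>2)) \<longlonglongrightarrow> ennreal ((cmod (f m x - g x))\<^sup>2)"
          by (intro tendsto_intros)
        then show ?case by (intro lim_imp_Liminf[symmetric]) auto
      qed
    qed
    also have "\<dots> \<le> liminf (\<lambda>n. \<integral>\<^sup>+x. ennreal ((cmod (f m x - f (k n) x))\<^sup>2) \<partial>M)"
      by (rule nn_integral_liminf) measurable
    also have "\<dots> \<le> ennreal e"
    proof (rule Liminf_le)
      show "\<forall>\<^sub>F n in sequentially. (\<integral>\<^sup>+x. ennreal ((cmod (f m x - f (k n) x))\<^sup>2) \<partial>M) \<le> ennreal e"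
        using eventually_ge_at_top[of N0]
      proof eventually_elim
        case (elim n)
        have "(\<integral>\<^sup>+x. ennreal ((cmod (f m x - f (k n) x))\<^sup>2) \<partial>M) = ennreal (\<integral>x. (cmod (f m x - f (k n) x))\<^sup>2 \<partial>M)"
          using lsq_diff[OF f f] by (intro nn_integral_eq_integral) (auto simp: lsq_def)
        also have "\<dots> \<le> ennreal e"
          using m(1)[OF m(2), of "k n"] elim kn[of n] by (intro ennreal_leI) auto
        finally show ?case .
      qed
    qed simp
    finally show ?thesis .
  qed
  have diff: "(\<lambda>x. f m x - g x) \<in> lsq M" if "\<And>i j. N0 \<le> i \<Longrightarrow> N0 \<le> j \<Longrightarrow> (\<integral>x. (cmod (f i x - f j x))\<^sup>2 \<partial>M) < e" "N0 \<le> m" for m e N0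
  proof -
    have "integrable M (\<lambda>x. (cmod (f m x - g x))\<^sup>2)"
      using bound[OF that] by (intro integrableI_bounded) (auto simp: less_top[symmetric] top_unique)
    then show ?thesis by (simp add: lsq_def)
  qed
  obtain N1 where N1: "\<And>i j. N1 \<le> i \<Longrightarrow> N1 \<le> j \<Longrightarrow> (\<integral>x. (cmod (f i x - f j x))\<^sup>2 \<partial>M) < 1"
    using cauchy[of 1] by auto
  have "(\<lambda>x. f N1 x - (f N1 x - g x)) \<in> lsq M" by (intro lsq_diff f diff[OF N1]) auto
  then have g: "g \<in> lsq M" by simp
  moreover have "(\<lambda>n. \<integral>x. (cmod (f n x - g x))\<^sup>2 \<partial>M) \<longlonglongrightarrow> 0"
  proof (rule LIMSEQ_I)
    fix r :: real assume r: "0 < r"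
    obtain N0 where N0: "\<And>i j. N0 \<le> i \<Longrightarrow> N0 \<le> j \<Longrightarrow> (\<integral>x. (cmod (f i x - f j x))\<^sup>2 \<partial>M) < r / 2"
      using cauchy[of "r / 2"] r by auto
    have half: "(\<integral>x. (cmod (f n x - g x))\<^sup>2 \<partial>M) \<le> r / 2" if n: "N0 \<le> n" for n
    proof -
      have "ennreal (\<integral>x. (cmod (f n x - g x))\<^sup>2 \<partial>M) = (\<integral>\<^sup>+x. ennreal ((cmod (f n x - g x))\<^sup>2) \<partial>M)"
        using lsq_diff[OF f g] by (intro nn_integral_eq_integral[symmetric]) (auto simp: lsq_def)
      also have "\<dots> \<le> ennreal (r / 2)" by (rule bound[OF N0 n])
      finally show ?thesis using r by (simp add: ennreal_le_iff)
    qed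
    show "\<exists>no. \<forall>n\<ge>no. norm ((\<integral>x. (cmod (f n x - g x))\<^sup>2 \<partial>M) - 0) < r"
    proof (intro exI[of _ N0] allI impI)
      fix n assume "N0 \<le> n"
      from half[OF this] show "norm ((\<integral>x. (cmod (f n x - g x))\<^sup>2 \<partial>M) - 0) < r" using r by simp
    qed
  qed
  ultimately show ?thesis by blast
qed

end

section \<open>Weak derivatives on an interval\<close>

text \<open>
  Lebesgue measure on \<open>{0..l}\<close> as a finite measure space.
\<close>

abbreviation leb :: "real \<Rightarrow> real measure" where
  "leb l \<equiv> restrict_space lborel {0..l}"

lemma finite_leb: "finite_measure (leb l)"
proof
  show "emeasure (leb l) (space (leb l)) \<noteq> \<infinity>"
    by (simp add: emeasure_restrict_space space_restrict_space emeasure_lborel_Icc_eq)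
qed

interpretation leb: finite_measure "leb l" for l by (rule finite_leb)

lemma measure_leb: "0 \<le> l \<Longrightarrow> measure (leb l) {0..l} = l"
  by (simp add: measure_restrict_space)

lemma space_leb [simp]: "space (leb l) = {0..l}" by (simp add: space_restrict_space)

lemma set_measurable_leb: "set_borel_measurable lborel {0..l} g \<longleftrightarrow> g \<in> borel_measurable (leb l)"
  for g :: "real \<Rightarrow> 'b::real_normed_vector"
  by (simp add: set_borel_measurable_def borel_measurable_restrict_space_iff)

lemma set_integrable_leb: "set_integrable lborel {0..l} g \<longleftrightarrow> integrable (leb l) g"
  for g :: "real \<Rightarrow> 'b::{banach,second_countable_topology}"
  by (simp add: set_integrable_def integrable_restrict_space)

lemma set_integral_leb: "(LINT x:{0..l}|lborel. g x) = integral\<^sup>L (leb l) g"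
  for g :: "real \<Rightarrow> 'b::{banach,second_countable_topology}"
  by (simp add: set_lebesgue_integral_def integral_restrict_space)

lemma L2_interval_lsq: "L2_interval l = lsq (leb l)"
  unfolding L2_interval_def lsq_def
  by (simp add: set_measurable_leb set_integrable_leb)

lemma integral_initial: "x \<le> l \<Longrightarrow> (LINT t:{0..x}|lborel. g t) = (LINT t|leb l. indicator {0..x} t *\<^sub>R g t)"
  for g :: "real \<Rightarrow> 'b::{banach,second_countable_topology}"
  unfolding set_integral_leb[symmetric] set_lebesgue_integral_def
  by (intro Bochner_Integration.integral_cong) (auto simp: indicator_def)

text \<open>
  A function whose primitive vanishes is zero almost everywhere: its integral vanishes on the
  half-lines, hence on all Borel sets by Dynkin's argument.
\<close>

lemma primitive_zero_AE:
  fixes f :: "real \<Rightarrow> complex"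
  assumes f: "integrable (leb l) f" and z: "\<And>x. x \<in> {0..l} \<Longrightarrow> (LINT t:{0..x}|lborel. f t) = 0"
  shows "AE x in leb l. f x = 0"
proof -
  define F where "F x = indicator {0..l} x *\<^sub>R f x" for x
  have F: "integrable lborel F" using f unfolding F_def by (simp add: integrable_restrict_space)
  have FA: "set_integrable lborel A F" if "A \<in> sets borel" for A
    unfolding set_integrable_def using F that by (intro integrable_mult_indicator) auto
  have init: "set_lebesgue_integral lborel {..a} F = 0" for a
  proof -
    have "set_lebesgue_integral lborel {..a} F = (LINT t:{0..min a l}|lborel. f t)"
      unfolding set_lebesgue_integral_def F_def
      by (intro Bochner_Integration.integral_cong) (auto simp: indicator_def)
    also have "\<dots> = 0"
    proof (cases "0 \<le> min a l")
      case True
      then show ?thesis by (intro z) auto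
    next
      case False
      then have "{0..min a l} = {}" by auto
      then show ?thesis by (simp add: set_lebesgue_integral_def)
    qed
    finally show ?thesis .
  qed
  have tot: "integral\<^sup>L lborel F = 0"
  proof -
    have "integral\<^sup>L lborel F = set_lebesgue_integral lborel {..l} F"
      unfolding set_lebesgue_integral_def F_def
      by (intro Bochner_Integration.integral_cong) (auto simp: indicator_def)
    then show ?thesis using init by simp
  qed
  have all: "set_lebesgue_integral lborel A F = 0" if "A \<in> sets borel" for A
  proof -
    let ?G = "range (\<lambda>a::real. {..a})"
    show ?thesis
    proof (rule sigma_sets_induct_disjoint[of ?G UNIV A "\<lambda>A. set_lebesgue_integral lborel A F = 0"])
      show "Int_stable ?G" by (auto simp: Int_stable_def)
      show "A \<in> sigma_sets UNIV ?G" using that by (simp add: borel_eq_atMost)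
      show "set_lebesgue_integral lborel {} F = 0" by (simp add: set_lebesgue_integral_def)
    next
      fix A assume "A \<in> ?G"
      then show "set_lebesgue_integral lborel A F = 0" using init by auto
    next
      fix A assume A: "A \<in> sigma_sets UNIV ?G" "set_lebesgue_integral lborel A F = 0"
      then have "A \<in> sets borel" by (simp add: borel_eq_atMost)
      then have "set_lebesgue_integral lborel (A \<union> (UNIV - A)) F = set_lebesgue_integral lborel A F + set_lebesgue_integral lborel (UNIV - A) F"
        by (intro set_integral_Un FA) auto
      then show "set_lebesgue_integral lborel (UNIV - A) F = 0"
        using A tot by (simp add: set_lebesgue_integral_def)
    next
      fix A :: "nat \<Rightarrow> real set"
      assume A: "disjoint_family A" "range A \<subseteq> sigma_sets UNIV ?G" "\<And>i. set_lebesgue_integral lborel (A i) F = 0"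
      then have "A i \<in> sets borel" for i by (auto simp: borel_eq_atMost)
      then have "set_lebesgue_integral lborel (\<Union>i. A i) F = (\<Sum>i. set_lebesgue_integral lborel (A i) F)"
        using A(1) FA[of "\<Union>i. A i"]
        by (intro lebesgue_integral_countable_add) (auto simp: disjoint_family_on_def)
      then show "set_lebesgue_integral lborel (\<Union>i. A i) F = 0" using A by simp
    qed auto
  qed
  have "AE x in lborel. F x = 0"
    by (rule sigma_finite_measure.density_zero[OF lborel.sigma_finite_measure_axioms F]) (use all in simp)
  then have "AE x in lborel. x \<in> {0..l} \<longrightarrow> f x = 0" by eventually_elim (auto simp: F_def)
  then show ?thesis by (simp add: AE_restrict_space_iff)
qed

lemma has_weak_deriv_lsq: "has_weak_deriv l u g \<Longrightarrow> g \<in> lsq (leb l)"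
  by (simp add: has_weak_deriv_def L2_interval_lsq)

lemma has_weak_deriv_integrable: "has_weak_deriv l u g \<Longrightarrow> integrable (leb l) g"
  by (intro leb.lsq_integrable has_weak_deriv_lsq)

lemma integrable_initial: "integrable (leb l) g \<Longrightarrow> x \<le> l \<Longrightarrow> set_integrable lborel {0..x} g"
  for g :: "real \<Rightarrow> complex"
  unfolding set_integrable_leb[symmetric] by (erule set_integrable_subset) auto

lemma has_weak_deriv_unique:
  assumes "has_weak_deriv l u g" "has_weak_deriv l u h"
  shows "AE x in leb l. g x = h x"
proof -
  have "AE x in leb l. g x - h x = 0"
  proof (rule primitive_zero_AE)
    show "integrable (leb l) (\<lambda>x. g x - h x)"
      using assms by (intro Bochner_Integration.integrable_diff has_weak_deriv_integrable)
    fix x assume x: "x \<in> {0..l}"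
    have "(LINT t:{0..x}|lborel. g t - h t) = (LINT t:{0..x}|lborel. g t) - (LINT t:{0..x}|lborel. h t)"
      using assms x by (intro set_integral_diff integrable_initial has_weak_deriv_integrable) auto
    also have "\<dots> = (u x - u 0) - (u x - u 0)"
      using assms x unfolding has_weak_deriv_def by (metis add_diff_cancel_left')
    finally show "(LINT t:{0..x}|lborel. g t - h t) = 0" by simp
  qed
  then show ?thesis by eventually_elim simp
qed

lemma weak_deriv: "u \<in> H1_interval l \<Longrightarrow> has_weak_deriv l u (weak_deriv l u)"
  using someI_ex[of "has_weak_deriv l u"] by (simp add: weak_deriv_def H1_interval_def)

lemma has_weak_derivI:
  assumes "g \<in> lsq (leb l)" "\<And>x. x \<in> {0..l} \<Longrightarrow> u x = u 0 + (LINT t:{0..x}|lborel. g t)"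
  shows "has_weak_deriv l u g"
  unfolding has_weak_deriv_def L2_interval_lsq using assms by blast

lemma has_weak_derivD: "has_weak_deriv l u g \<Longrightarrow> x \<in> {0..l} \<Longrightarrow> u x = u 0 + (LINT t:{0..x}|lborel. g t)"
  unfolding has_weak_deriv_def by blast

lemma has_weak_deriv_add:
  assumes "has_weak_deriv l u g" "has_weak_deriv l v h"
  shows "has_weak_deriv l (\<lambda>x. u x + v x) (\<lambda>x. g x + h x)"
proof (rule has_weak_derivI)
  show "(\<lambda>x. g x + h x) \<in> lsq (leb l)" using assms by (intro lsq_add has_weak_deriv_lsq)
  fix x assume x: "x \<in> {0..l}"
  have "(LINT t:{0..x}|lborel. g t + h t) = (LINT t:{0..x}|lborel. g t) + (LINT t:{0..x}|lborel. h t)"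
    using assms x by (intro set_integral_add integrable_initial has_weak_deriv_integrable) auto
  then show "u x + v x = u 0 + v 0 + (LINT t:{0..x}|lborel. g t + h t)"
    using has_weak_derivD[OF assms(1) x] has_weak_derivD[OF assms(2) x] by (simp add: algebra_simps)
qed

lemma has_weak_deriv_scale:
  assumes "has_weak_deriv l u g"
  shows "has_weak_deriv l (\<lambda>x. c * u x) (\<lambda>x. c * g x)"
proof (rule has_weak_derivI)
  show "(\<lambda>x. c * g x) \<in> lsq (leb l)" using assms by (intro lsq_scale has_weak_deriv_lsq)
  fix x assume x: "x \<in> {0..l}"
  show "c * u x = c * u 0 + (LINT t:{0..x}|lborel. c * g t)"
    using has_weak_derivD[OF assms x] by (simp add: algebra_simps)
qed

lemma has_weak_deriv_cnj:
  assumes "has_weak_deriv l u g"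
  shows "has_weak_deriv l (\<lambda>x. cnj (u x)) (\<lambda>x. cnj (g x))"
proof (rule has_weak_derivI)
  show "(\<lambda>x. cnj (g x)) \<in> lsq (leb l)" using assms by (intro lsq_cnj has_weak_deriv_lsq)
  fix x assume x: "x \<in> {0..l}"
  have "(LINT t:{0..x}|lborel. cnj (g t)) = cnj (LINT t:{0..x}|lborel. g t)"
    using Bochner_Integration.integral_cnj[of lborel "\<lambda>t. indicator {0..x} t *\<^sub>R g t"]
    by (simp add: set_lebesgue_integral_def)
  then show "cnj (u x) = cnj (u 0) + (LINT t:{0..x}|lborel. cnj (g t))"
    using has_weak_derivD[OF assms x] by simp
qed

lemma has_weak_deriv_affine: "0 \<le> l \<Longrightarrow> has_weak_deriv l (\<lambda>x. c + a * of_real x) (\<lambda>x. a)"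
proof (rule has_weak_derivI)
  show "(\<lambda>x. a) \<in> lsq (leb l)" by (rule leb.lsq_bounded) auto
  fix x assume "x \<in> {0..l}"
  then show "c + a * of_real x = c + a * of_real 0 + (LINT t:{0..x}|lborel. a)"
    by (simp add: set_integral_const scaleR_conv_of_real mult.commute)
qed

text \<open>
  Functions in \<open>H\<^sup>1\<close> are Hoelder continuous with exponent \<open>1/2\<close>.
\<close>

lemma has_weak_deriv_Hoelder:
  assumes u: "has_weak_deriv l u g" and xy: "x \<in> {0..l}" "y \<in> {0..l}"
  shows "(cmod (u x - u y))\<^sup>2 \<le> \<bar>x - y\<bar> * (LINT t|leb l. (cmod (g t))\<^sup>2)"
proof -
  have main: "(cmod (u b - u a))\<^sup>2 \<le> (b - a) * (LINT t|leb l. (cmod (g t))\<^sup>2)"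
    if ab: "a \<in> {0..l}" "b \<in> {0..l}" "a \<le> b" for a b
  proof -
    have ind: "(\<lambda>t. indicator {a<..b} t :: complex) \<in> lsq (leb l)"
      by (rule leb.lsq_bounded[of _ _ 1]) (auto simp: indicator_def intro: measurable_restrict_space1)
    have si: "set_integrable lborel {0..l} g" using has_weak_deriv_integrable[OF u] by (simp add: set_integrable_leb)
    have "{0..b} = {0..a} \<union> {a<..b}" using ab by auto
    then have "(LINT t:{0..b}|lborel. g t) = (LINT t:{0..a}|lborel. g t) + (LINT t:{a<..b}|lborel. g t)"
      using ab by (simp only:) (intro set_integral_Un set_integrable_subset[OF si]; auto)
    then have "u b - u a = (LINT t:{a<..b}|lborel. g t)"
      using has_weak_derivD[OF u ab(1)] has_weak_derivD[OF u ab(2)] by simp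
    also have "\<dots> = (LINT t|leb l. g t * cnj (indicator {a<..b} t))"
      unfolding set_integral_leb[symmetric] set_lebesgue_integral_def using ab
      by (intro Bochner_Integration.integral_cong) (auto simp: indicator_def)
    finally have "(cmod (u b - u a))\<^sup>2 \<le> (LINT t|leb l. (cmod (g t))\<^sup>2) * (LINT t|leb l. (cmod (indicator {a<..b} t))\<^sup>2)"
      using lsq_Cauchy_Schwarz[OF has_weak_deriv_lsq[OF u] ind] by simp
    also have "(LINT t|leb l. (cmod (indicator {a<..b} t))\<^sup>2) = (LINT t|lborel. indicator {a<..b} t)"
      unfolding set_integral_leb[symmetric] set_lebesgue_integral_def using ab
      by (intro Bochner_Integration.integral_cong) (auto simp: indicator_def)
    also have "\<dots> = b - a" using ab by simp
    finally show ?thesis by (simp add: mult.commute)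
  qed
  show ?thesis
  proof (cases "x \<le> y")
    case True
    then show ?thesis using main[OF xy True] by (simp add: norm_minus_commute)
  next
    case False
    then show ?thesis using main[OF xy(2,1)] by simp
  qed
qed

lemma has_weak_deriv_continuous:
  assumes u: "has_weak_deriv l u g"
  shows "continuous_on {0..l} u"
proof (rule continuous_onI)
  define C where "C = (LINT t|leb l. (cmod (g t))\<^sup>2)"
  have C: "0 \<le> C" by (simp add: C_def)
  fix x e assume x: "x \<in> {0..l}" and e: "(0::real) < e"
  show "\<exists>d>0. \<forall>x'\<in>{0..l}. dist x' x < d \<longrightarrow> dist (u x') (u x) \<le> e"
  proof (intro exI[of _ "e\<^sup>2 / (C + 1)"] conjI ballI impI)
    show "0 < e\<^sup>2 / (C + 1)" using e C by simp
    fix y assume y: "y \<in> {0..l}" "dist y x < e\<^sup>2 / (C + 1)"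
    have "(cmod (u y - u x))\<^sup>2 \<le> \<bar>y - x\<bar> * C" unfolding C_def by (rule has_weak_deriv_Hoelder[OF u y(1) x])
    also have "\<dots> \<le> \<bar>y - x\<bar> * (C + 1)" by (intro mult_left_mono) auto
    also have "\<dots> \<le> e\<^sup>2" using y(2) C by (simp add: dist_real_def field_simps)
    finally show "dist (u y) (u x) \<le> e" using e by (auto simp: dist_norm intro: power2_le_imp_le)
  qed
qed

lemma continuous_measurable_leb: "continuous_on {0..l} u \<Longrightarrow> u \<in> borel_measurable (leb l)"
  for u :: "real \<Rightarrow> complex"
  using borel_measurable_continuous_on_restrict[of "{0..l}" u]
  by (simp cong: measurable_cong_sets add: sets_restrict_space)

lemma continuous_lsq: "continuous_on {0..l} u \<Longrightarrow> u \<in> lsq (leb l)"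
proof -
  assume u: "continuous_on {0..l} u"
  then have "bounded (u ` {0..l})" by (intro compact_imp_bounded compact_continuous_image) auto
  then obtain C where "\<And>x. x \<in> {0..l} \<Longrightarrow> cmod (u x) \<le> C" unfolding bounded_iff by blast
  then show ?thesis by (intro leb.lsq_bounded[of _ _ C] continuous_measurable_leb u) auto
qed

lemma continuous_mult_lsq:
  assumes u: "continuous_on {0..l} u" and g: "g \<in> lsq (leb l)"
  shows "(\<lambda>x. u x * g x) \<in> lsq (leb l)"
proof -
  have "bounded (u ` {0..l})" using u by (intro compact_imp_bounded compact_continuous_image) auto
  then obtain C where C: "\<And>x. x \<in> {0..l} \<Longrightarrow> cmod (u x) \<le> C" unfolding bounded_iff by blast
  show ?thesis
  proof (rule lsq_bound[OF g, of _ C])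
    show "(\<lambda>x. u x * g x) \<in> borel_measurable (leb l)"
      using continuous_measurable_leb[OF u] g by (intro borel_measurable_times) (auto simp: lsq_def)
    show "AE x in leb l. cmod (u x * g x) \<le> C * cmod (g x)"
      using C by (intro AE_I2) (auto simp: norm_mult intro!: mult_right_mono)
  qed
qed

text \<open>
  Averaging the Hoelder estimate over the second point bounds the supremum by the \<open>H\<^sup>1\<close> norm.
\<close>

lemma has_weak_deriv_sup_bound:
  assumes u: "has_weak_deriv l u g" and l: "0 < l" and x: "x \<in> {0..l}"
  shows "(cmod (u x))\<^sup>2 \<le> 2 / l * (LINT t|leb l. (cmod (u t))\<^sup>2) + 2 * l * (LINT t|leb l. (cmod (g t))\<^sup>2)"
proof -
  define C where "C = (LINT t|leb l. (cmod (g t))\<^sup>2)"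
  have C: "0 \<le> C" by (simp add: C_def)
  have uL: "u \<in> lsq (leb l)" by (rule continuous_lsq[OF has_weak_deriv_continuous[OF u]])
  have "(LINT t|leb l. (cmod (u x))\<^sup>2) \<le> (LINT t|leb l. 2 * (cmod (u t))\<^sup>2 + 2 * (l * C))"
  proof (rule integral_mono)
    show "integrable (leb l) (\<lambda>t. 2 * (cmod (u t))\<^sup>2 + 2 * (l * C))" using uL by (auto simp: lsq_def)
    fix t assume "t \<in> space (leb l)"
    then have t: "t \<in> {0..l}" by simp
    have "(cmod (u x))\<^sup>2 = (cmod (u t + (u x - u t)))\<^sup>2" by simp
    also have "\<dots> \<le> 2 * (cmod (u t))\<^sup>2 + 2 * (cmod (u x - u t))\<^sup>2" by (rule cmod_sum_square)
    also have "(cmod (u x - u t))\<^sup>2 \<le> \<bar>x - t\<bar> * C" unfolding C_def by (rule has_weak_deriv_Hoelder[OF u x t])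
    also have "\<dots> \<le> l * C" using x t C by (intro mult_right_mono) auto
    finally show "(cmod (u x))\<^sup>2 \<le> 2 * (cmod (u t))\<^sup>2 + 2 * (l * C)" by simp
  qed simp
  also have "\<dots> = 2 * (LINT t|leb l. (cmod (u t))\<^sup>2) + 2 * l * C * l"
    using uL l by (subst Bochner_Integration.integral_add) (auto simp: lsq_def measure_leb)
  finally have "l * (cmod (u x))\<^sup>2 \<le> 2 * (LINT t|leb l. (cmod (u t))\<^sup>2) + 2 * l * C * l"
    using l by (simp add: measure_leb)
  then have "(cmod (u x))\<^sup>2 \<le> (2 * (LINT t|leb l. (cmod (u t))\<^sup>2) + 2 * l * C * l) / l"
    using l by (simp add: field_simps)
  then show ?thesis using l by (simp add: C_def field_simps)
qed

section \<open>Integration by parts\<close>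

lemma integrable_tensor:
  fixes f g :: "real \<Rightarrow> complex"
  assumes f: "integrable lborel f" and g: "integrable lborel g"
  shows "integrable (lborel \<Otimes>\<^sub>M lborel) (\<lambda>(s, t). f s * g t)"
proof (rule lborel_pair.Fubini_integrable)
  have [measurable]: "f \<in> borel_measurable borel" "g \<in> borel_measurable borel" using f g by auto
  show "(\<lambda>(s, t). f s * g t) \<in> borel_measurable (lborel \<Otimes>\<^sub>M lborel)" by measurable
  show "integrable lborel (\<lambda>s. LINT t|lborel. norm (case (s, t) of (s, t) \<Rightarrow> f s * g t))"
    using f by (simp add: norm_mult)
  show "AE s in lborel. integrable lborel (\<lambda>t. case (s, t) of (s, t) \<Rightarrow> f s * g t)"
    using g by simp
qed

text \<open>
  Fubini's theorem on the two triangles into which the diagonal cuts the plane.  It is the product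
  rule for the primitives of \<open>f\<close> and \<open>g\<close>.
\<close>

lemma integral_triangles:
  fixes f g :: "real \<Rightarrow> complex"
  assumes f: "integrable lborel f" and g: "integrable lborel g"
  shows "(LINT s|lborel. f s) * (LINT t|lborel. g t) =
    (LINT s|lborel. f s * (LINT t:{..s}|lborel. g t)) + (LINT t|lborel. (LINT s:{..t}|lborel. f s) * g t)"
    and "integrable lborel (\<lambda>s. f s * (LINT t:{..s}|lborel. g t))"
    and "integrable lborel (\<lambda>t. (LINT s:{..t}|lborel. f s) * g t)"
proof -
  let ?P = "lborel \<Otimes>\<^sub>M lborel :: (real \<times> real) measure"
  have [measurable]: "f \<in> borel_measurable borel" "g \<in> borel_measurable borel" using f g by auto
  define A B where "A s t = (if t \<le> s then f s * g t else 0)" and "B s t = (if t \<le> s then 0 else f s * g t)" for s t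
  have Am: "(\<lambda>(s, t). A s t) \<in> borel_measurable ?P" and Bm: "(\<lambda>(s, t). B s t) \<in> borel_measurable ?P"
    unfolding A_def B_def by measurable
  have A: "integrable ?P (\<lambda>(s, t). A s t)"
    by (rule Bochner_Integration.integrable_bound[OF integrable_tensor[OF f g] Am]) (auto simp: A_def)
  have B: "integrable ?P (\<lambda>(s, t). B s t)"
    by (rule Bochner_Integration.integrable_bound[OF integrable_tensor[OF f g] Bm]) (auto simp: B_def)
  have A1: "(LINT t|lborel. A s t) = f s * (LINT t:{..s}|lborel. g t)" for s
  proof -
    have "(LINT t|lborel. A s t) = (LINT t|lborel. f s * (indicator {..s} t *\<^sub>R g t))"
      by (intro Bochner_Integration.integral_cong) (auto simp: A_def)
    then show ?thesis unfolding set_lebesgue_integral_def by (simp only: integral_mult_right_zero)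
  qed
  have B1: "(LINT s|lborel. B s t) = (LINT s:{..t}|lborel. f s) * g t" for t
  proof -
    have "(LINT s|lborel. B s t) = (LINT s|lborel. (indicator {..t} s *\<^sub>R f s) * g t)"
      by (rule integral_cong_AE)
        (use AE_lborel_singleton[of t] in \<open>auto simp: B_def indicator_def elim!: eventually_mono\<close>)
    then show ?thesis unfolding set_lebesgue_integral_def by (simp only: integral_mult_left_zero)
  qed
  have "(LINT s|lborel. f s) * (LINT t|lborel. g t) = (LINT s|lborel. (LINT t|lborel. f s * g t))" by simp
  also have "\<dots> = (LINT z|?P. (case z of (s, t) \<Rightarrow> f s * g t))"
    by (rule lborel_pair.integral_fst[OF integrable_tensor[OF f g]])
  also have "\<dots> = (LINT z|?P. (case z of (s, t) \<Rightarrow> A s t) + (case z of (s, t) \<Rightarrow> B s t))"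
    by (intro Bochner_Integration.integral_cong) (auto simp: A_def B_def)
  also have "\<dots> = (LINT z|?P. (case z of (s, t) \<Rightarrow> A s t)) + (LINT z|?P. (case z of (s, t) \<Rightarrow> B s t))"
    by (rule Bochner_Integration.integral_add[OF A B])
  also have "(LINT z|?P. (case z of (s, t) \<Rightarrow> A s t)) = (LINT s|lborel. (LINT t|lborel. A s t))"
    by (rule lborel_pair.integral_fst[OF A, symmetric])
  also have "(LINT z|?P. (case z of (s, t) \<Rightarrow> B s t)) = (LINT t|lborel. (LINT s|lborel. B s t))"
    by (rule lborel_pair.integral_snd[OF B, symmetric])
  finally show "(LINT s|lborel. f s) * (LINT t|lborel. g t) =
    (LINT s|lborel. f s * (LINT t:{..s}|lborel. g t)) + (LINT t|lborel. (LINT s:{..t}|lborel. f s) * g t)"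
    by (simp add: A1 B1)
  show "integrable lborel (\<lambda>s. f s * (LINT t:{..s}|lborel. g t))"
    using lborel_pair.integrable_fst[OF A] by (simp add: A1)
  show "integrable lborel (\<lambda>t. (LINT s:{..t}|lborel. f s) * g t)"
    using lborel_pair.integrable_snd[OF B] by (simp add: B1)
qed

lemma has_weak_deriv_mult:
  assumes u: "has_weak_deriv l u g" and w: "has_weak_deriv l w h"
  shows "has_weak_deriv l (\<lambda>x. u x * w x) (\<lambda>x. g x * w x + u x * h x)"
proof (rule has_weak_derivI)
  have cont: "continuous_on {0..l} u" "continuous_on {0..l} w"
    using u w by (auto intro: has_weak_deriv_continuous)
  have gw: "(\<lambda>x. g x * w x) \<in> lsq (leb l)"
    using continuous_mult_lsq[OF cont(2) has_weak_deriv_lsq[OF u]] by (simp add: mult.commute)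
  have uh: "(\<lambda>x. u x * h x) \<in> lsq (leb l)"
    by (rule continuous_mult_lsq[OF cont(1) has_weak_deriv_lsq[OF w]])
  show "(\<lambda>x. g x * w x + u x * h x) \<in> lsq (leb l)" by (rule lsq_add[OF gw uh])
  fix x assume x: "x \<in> {0..l}"
  define G H where "G t = indicator {0..x} t *\<^sub>R g t" and "H t = indicator {0..x} t *\<^sub>R h t" for t
  have si: "set_integrable lborel {0..x} g" "set_integrable lborel {0..x} h"
    using x u w by (auto intro: integrable_initial has_weak_deriv_integrable)
  have G: "integrable lborel G" and H: "integrable lborel H"
    using si by (simp_all add: G_def[abs_def] H_def[abs_def] set_integrable_def)
  have cut: "(LINT t:{..s}|lborel. indicator {0..x} t *\<^sub>R k t) = (LINT t:{0..s}|lborel. k t)"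
    if "s \<in> {0..x}" for s and k :: "real \<Rightarrow> complex"
    unfolding set_lebesgue_integral_def using that
    by (intro Bochner_Integration.integral_cong) (auto simp: indicator_def)
  have intG: "(LINT t|lborel. G t) = u x - u 0" and intH: "(LINT t|lborel. H t) = w x - w 0"
    using has_weak_derivD[OF u x] has_weak_derivD[OF w x] by (simp_all add: G_def H_def set_lebesgue_integral_def)
  have inside: "s \<in> {0..x} \<Longrightarrow> (LINT t:{..s}|lborel. H t) = w s - w 0 \<and> (LINT t:{..s}|lborel. G t) = u s - u 0" for s
    using has_weak_derivD[OF u, of s] has_weak_derivD[OF w, of s] x by (simp add: G_def H_def cut)
  have GH: "G s * (LINT t:{..s}|lborel. H t) = G s * w s - G s * w 0" for s
    using inside[of s] by (cases "s \<in> {0..x}") (auto simp: G_def right_diff_distrib)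
  have HG: "(LINT t:{..s}|lborel. G t) * H s = u s * H s - u 0 * H s" for s
    using inside[of s] by (cases "s \<in> {0..x}") (auto simp: H_def left_diff_distrib)
  have si2: "set_integrable lborel {0..x} (\<lambda>t. g t * w t)" "set_integrable lborel {0..x} (\<lambda>t. u t * h t)"
    using x gw uh by (auto intro: integrable_initial leb.lsq_integrable)
  have Gw: "integrable lborel (\<lambda>t. G t * w t)" and uH: "integrable lborel (\<lambda>t. u t * H t)"
    using si2 by (simp_all add: G_def H_def set_integrable_def)
  have "(u x - u 0) * (w x - w 0) = (LINT s|lborel. G s * w s - G s * w 0) + (LINT t|lborel. u t * H t - u 0 * H t)"
    using integral_triangles(1)[OF G H] unfolding intG intH GH HG .
  also have "\<dots> = (LINT s|lborel. G s * w s) - (u x - u 0) * w 0 + ((LINT t|lborel. u t * H t) - u 0 * (w x - w 0))"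
    using G H Gw uH by (simp add: intG intH)
  finally have "u x * w x = u 0 * w 0 + ((LINT s|lborel. G s * w s) + (LINT t|lborel. u t * H t))"
    by (simp add: algebra_simps)
  also have "(LINT s|lborel. G s * w s) + (LINT t|lborel. u t * H t)
      = (LINT t:{0..x}|lborel. g t * w t) + (LINT t:{0..x}|lborel. u t * h t)"
    by (simp add: G_def H_def set_lebesgue_integral_def)
  also have "\<dots> = (LINT t:{0..x}|lborel. g t * w t + u t * h t)"
    using si2 by (intro set_integral_add(2)[symmetric])
  finally show "u x * w x = u 0 * w 0 + (LINT t:{0..x}|lborel. g t * w t + u t * h t)" .
qed

lemma integral_by_parts:
  assumes u: "has_weak_deriv l u g" and w: "has_weak_deriv l w h" and l: "0 \<le> l"
  shows "(LINT t|leb l. g t * w t) + (LINT t|leb l. u t * h t) = u l * w l - u 0 * w 0"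
proof -
  have cont: "continuous_on {0..l} u" "continuous_on {0..l} w"
    using u w by (auto intro: has_weak_deriv_continuous)
  have 1: "integrable (leb l) (\<lambda>x. g x * w x)" "integrable (leb l) (\<lambda>x. u x * h x)"
    by (rule lsq_mult[OF has_weak_deriv_lsq[OF u] continuous_lsq[OF cont(2)]])
      (rule lsq_mult[OF continuous_lsq[OF cont(1)] has_weak_deriv_lsq[OF w]])
  have "u l * w l = u 0 * w 0 + (LINT t:{0..l}|lborel. g t * w t + u t * h t)"
    by (rule has_weak_derivD[OF has_weak_deriv_mult[OF u w]]) (use l in simp)
  then show ?thesis unfolding set_integral_leb using 1 by simp
qed

section \<open>Unimodular flows on trees\<close>

text \<open>
  \<open>simple_path G S s p t\<close>: the steps \<open>p\<close> lead from \<open>s\<close> to \<open>t\<close> and visit pairwise distinct vertices, all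
  in \<open>S\<close>.  A step is an arc with a direction of traversal, as in \<open>undirected_cycle\<close>.
\<close>

fun simple_path :: "('v, 'e) pre_digraph \<Rightarrow> 'v set \<Rightarrow> 'v \<Rightarrow> ('e \<times> bool) list \<Rightarrow> 'v \<Rightarrow> bool" where
  "simple_path G S s [] t \<longleftrightarrow> s = t \<and> s \<in> S"
| "simple_path G S s (x # p) t \<longleftrightarrow> s \<in> S \<and> fst x \<in> arcs G \<and> step_source G x = s \<and>
     simple_path G (S - {s}) (step_target G x) p t"

lemma simple_path_mono: "simple_path G S s p t \<Longrightarrow> S \<subseteq> S' \<Longrightarrow> simple_path G S' s p t"
proof (induction p arbitrary: S S' s)
  case (Cons x p)
  then show ?case using Cons.IH[of "S - {s}" "step_target G x" "S' - {s}"] by auto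
qed auto

lemma simple_path_ends: "simple_path G S s p t \<Longrightarrow> s \<in> S \<and> t \<in> S"
  by (induction p arbitrary: S s) auto

lemma simple_path_sources: "simple_path G S s p t \<Longrightarrow> step_source G ` set p \<subseteq> S \<and> step_target G ` set p \<subseteq> S"
proof (induction p arbitrary: S s)
  case (Cons x p)
  then have sp: "simple_path G (S - {s}) (step_target G x) p t" by simp
  show ?case using Cons.IH[OF sp] simple_path_ends[OF sp] Cons.prems by auto
qed simp

lemma simple_path_arcs: "simple_path G S s p t \<Longrightarrow> fst ` set p \<subseteq> arcs G"
  by (induction p arbitrary: S s) auto

lemma step_ends: "{step_source G x, step_target G x} = {tail G (fst x), head G (fst x)}"
  by (cases x) auto

lemma simple_path_distinct:
  "simple_path G S s p t \<Longrightarrow> distinct (map (step_source G) p) \<and> distinct (map fst p) \<and> t \<notin> step_source G ` set p"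
proof (induction p arbitrary: S s)
  case (Cons x p)
  let ?S = "S - {s}"
  have sp: "simple_path G ?S (step_target G x) p t" and s: "step_source G x = s" using Cons.prems by auto
  have IH: "distinct (map (step_source G) p)" "distinct (map fst p)" "t \<notin> step_source G ` set p"
    using Cons.IH[OF sp] by auto
  have ends: "step_source G ` set p \<subseteq> ?S" "step_target G ` set p \<subseteq> ?S" "t \<in> ?S"
    using simple_path_sources[OF sp] simple_path_ends[OF sp] by auto
  have "fst x \<notin> fst ` set p"
  proof
    assume "fst x \<in> fst ` set p"
    then obtain y where y: "y \<in> set p" "fst y = fst x" by auto
    have "s \<in> {tail G (fst y), head G (fst y)}" using s step_ends[of G x] y(2) by auto
    then have "s \<in> {step_source G y, step_target G y}" using step_ends[of G y] by simp
    then show False using ends y(1) by auto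
  qed
  then show ?case using IH ends s by auto
qed auto

lemma simple_path_chain:
  "simple_path G S s p t \<Longrightarrow> i < length p \<Longrightarrow>
     step_target G (p ! i) = (if Suc i < length p then step_source G (p ! Suc i) else t)"
proof (induction p arbitrary: S s i)
  case (Cons x p)
  show ?case
  proof (cases i)
    case 0
    then show ?thesis using Cons.prems by (cases p) auto
  next
    case (Suc i')
    then show ?thesis using Cons.IH[of "S - {s}" "step_target G x" i'] Cons.prems by auto
  qed
qed simp

text \<open>
  A simple path from \<open>s\<close> to \<open>t\<close> and two different arcs joining \<open>s\<close> and \<open>t\<close> to a vertex off
  the path form a cycle.
\<close>

lemma simple_path_cycle:
  assumes p: "simple_path G S s p t" and w: "w \<notin> S"
    and e: "fst x \<in> arcs G" "step_source G x = w" "step_target G x = s"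
    and f: "fst y \<in> arcs G" "step_source G y = t" "step_target G y = w"
    and ne: "fst x \<noteq> fst y"
  shows "undirected_cycle G (x # p @ [y])"
  unfolding undirected_cycle_def
proof (intro conjI allI impI)
  show "x # p @ [y] \<noteq> []" by simp
  show "fst ` set (x # p @ [y]) \<subseteq> arcs G" using simple_path_arcs[OF p] e(1) f(1) by simp
  have new: "fst z \<notin> fst ` set p" if "w \<in> {tail G (fst z), head G (fst z)}" for z
  proof
    assume "fst z \<in> fst ` set p"
    then obtain c where c: "c \<in> set p" "fst c = fst z" by auto
    then have "w \<in> {step_source G c, step_target G c}" using step_ends[of G c] that by simp
    then show False using simple_path_sources[OF p] c(1) w by auto
  qed
  have "fst x \<notin> fst ` set p"
    by (rule new) (simp add: step_ends[symmetric] e(2))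
  moreover have "fst y \<notin> fst ` set p"
    by (rule new) (simp add: step_ends[symmetric] f(3))
  ultimately show "distinct (map fst (x # p @ [y]))"
    using simple_path_distinct[OF p] ne by simp
  have "w \<notin> step_source G ` set p" using simple_path_sources[OF p] w by blast
  moreover have "w \<noteq> t" using simple_path_ends[OF p] w by blast
  ultimately show "distinct (map (step_source G) (x # p @ [y]))"
    using simple_path_distinct[OF p] by (simp add: e(2) f(2))
next
  fix i assume i: "i < length (x # p @ [y])"
  show "step_target G ((x # p @ [y]) ! i) =
      step_source G ((x # p @ [y]) ! (Suc i mod length (x # p @ [y])))"
  proof (cases i)
    case 0
    then show ?thesis using e(3) f(2) p by (cases p) simp_all
  next
    case (Suc j)
    show ?thesis
    proof (cases "j < length p")
      case True
      then show ?thesis using Suc simple_path_chain[OF p True] f(2) by (simp add: nth_append)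
    next
      case False
      then have "j = length p" using i Suc by simp
      then show ?thesis using Suc e(2) f(3) by (simp add: nth_append)
    qed
  qed
qed

lemma (in compact_metric_tree) no_loops: "e \<in> arcs G \<Longrightarrow> tail G e \<noteq> head G e"
  using no_cycles[of "[(e, True)]"] by (auto simp: undirected_cycle_def)

lemma (in compact_metric_tree) crossing_arc:
  assumes "S \<subseteq> verts G" "S \<noteq> {}" "S \<noteq> verts G"
  obtains x where "fst x \<in> arcs G" "step_source G x \<in> S" "step_target G x \<in> verts G - S"
proof -
  obtain s t where st: "s \<in> S" "t \<in> verts G" "t \<notin> S" using assms by auto
  have "s \<rightarrow>\<^sup>*\<^bsub>with_proj (mk_symmetric G)\<^esub> t"
    using graph_connected st assms(1) unfolding connected_def strongly_connected_def by auto
  then have "(s, t) \<in> rtrancl_on (verts G) (parcs (mk_symmetric G))"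
    by (simp add: reachable_def)
  then have "(s, t) \<in> (parcs (mk_symmetric G))\<^sup>*"
    by (rule rtrancl_on_rtranclI)
  then have "\<exists>a b. (a, b) \<in> parcs (mk_symmetric G) \<and> a \<in> S \<and> b \<notin> S"
    using st(1,3) by (induction rule: rtrancl_induct) auto
  then obtain a b where ab: "(a, b) \<in> parcs (mk_symmetric G)" "a \<in> S" "b \<notin> S" by blast
  then obtain e where e: "e \<in> arcs G" "(a, b) = (tail G e, head G e) \<or> (a, b) = (head G e, tail G e)"
    by (auto simp: parcs_mk_symmetric)
  show ?thesis
  proof (cases "(a, b) = (tail G e, head G e)")
    case True
    then show ?thesis using e(1) ab that[of "(e, True)"] by auto
  next
    case False
    then show ?thesis using e ab that[of "(e, False)"] by auto
  qed
qed

lemma simple_path_snoc: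
  "simple_path G S s p t \<Longrightarrow> w \<notin> S \<Longrightarrow> fst x \<in> arcs G \<Longrightarrow> step_source G x = t \<Longrightarrow> step_target G x = w
     \<Longrightarrow> simple_path G (insert w S) s (p @ [x]) w"
proof (induction p arbitrary: S s)
  case Nil
  then show ?case by auto
next
  case (Cons y p)
  have "insert w S - {s} = insert w (S - {s})" using Cons.prems by auto
  moreover have "simple_path G (insert w (S - {s})) (step_target G y) (p @ [x]) w"
    using Cons.prems by (intro Cons.IH) auto
  ultimately show ?case using Cons.prems by simp
qed

lemma arc_direction:
  assumes "u = tail G e \<and> v = head G e \<or> v = tail G e \<and> u = head G e"
  obtains d where "step_source G (e, d) = u" "step_target G (e, d) = v"
  using assms that[of True] that[of False] by auto

context compact_metric_tree
begin

lemma in_out_disjoint: "in_arcs G v \<inter> out_arcs G v = {}"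
  using no_loops by (auto simp: in_arcs_def out_arcs_def)

lemma incident_card: "vertex_degree G v = card (in_arcs G v \<union> out_arcs G v)"
  unfolding vertex_degree_def in_degree_def out_degree_def
  by (intro card_Un_disjoint[symmetric] finite_in_arcs finite_out_arcs in_out_disjoint)

text \<open>
  Kirchhoff's law for the slopes \<open>a\<close>, taken in the direction from tail to head, at every vertex
  that is not external.
\<close>

definition balanced :: "('e \<Rightarrow> complex) \<Rightarrow> 'v \<Rightarrow> bool" where
  "balanced a v \<longleftrightarrow> vertex_degree G v \<noteq> 1 \<longrightarrow> (\<Sum>e\<in>in_arcs G v. a e) = (\<Sum>e\<in>out_arcs G v. a e)"

text \<open>
  The unimodular slope of one arc at \<open>v\<close> can be extended to the other arcs at \<open>v\<close>: the slopes pointing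
  out of \<open>v\<close> are taken proportional to the \<open>d\<close>-th roots of unity, which add up to zero
  for \<open>d \<ge> 2\<close>, where \<open>d\<close> is the degree of \<open>v\<close>.
\<close>

lemma balance_at_vertex:
  assumes a: "\<And>e. e \<in> arcs G \<Longrightarrow> cmod (a e) = 1" and e0: "e0 \<in> in_arcs G v \<union> out_arcs G v"
  obtains a' where "\<And>e. e \<in> arcs G \<Longrightarrow> cmod (a' e) = 1" "balanced a' v" "a' e0 = a e0"
    "\<And>e. e \<in> arcs G \<Longrightarrow> tail G e \<noteq> v \<Longrightarrow> head G e \<noteq> v \<Longrightarrow> a' e = a e"
proof -
  let ?I = "in_arcs G v \<union> out_arcs G v"
  define d where "d = card ?I"
  have fin: "finite ?I" using finite_in_arcs finite_out_arcs by blast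
  obtain h where h: "bij_betw h ?I {..<d}"
    using ex_bij_betw_finite_nat[OF fin] by (auto simp: d_def atLeast0LessThan)
  \<comment> \<open>The sign turns the slope from tail to head into the slope pointing out of \<open>v\<close>.\<close>
  define \<sigma> :: "'e \<Rightarrow> complex" where "\<sigma> e = (if tail G e = v then 1 else -1)" for e
  define \<omega> where "\<omega> e = cis (2 * pi * real (h e) / real d)" for e
  define c where "c = \<sigma> e0 * a e0 / \<omega> e0"
  define a' where "a' e = (if e \<in> ?I then \<sigma> e * \<omega> e * c else a e)" for e
  have \<sigma>2: "\<sigma> e * \<sigma> e = 1" "cmod (\<sigma> e) = 1" for e by (auto simp: \<sigma>_def)
  have \<omega>1: "cmod (\<omega> e) = 1" "\<omega> e \<noteq> 0" for e by (auto simp: \<omega>_def)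
  have c1: "cmod c = 1" using e0 a by (auto simp: c_def norm_mult norm_divide \<sigma>2 \<omega>1)
  show ?thesis
  proof
    fix e assume "e \<in> arcs G"
    then show "cmod (a' e) = 1" using a by (simp add: a'_def norm_mult \<sigma>2 \<omega>1 c1)
  next
    have "\<sigma> e0 * \<omega> e0 * c = (\<sigma> e0 * \<sigma> e0) * a e0" using \<omega>1(2)[of e0] by (simp add: c_def)
    then show "a' e0 = a e0" using e0 by (simp add: a'_def \<sigma>2)
  next
    fix e assume "e \<in> arcs G" "tail G e \<noteq> v" "head G e \<noteq> v"
    then show "a' e = a e" by (simp add: a'_def)
  next
    show "balanced a' v"
      unfolding balanced_def
    proof
      assume "vertex_degree G v \<noteq> 1"
      moreover have "d \<noteq> 0" using e0 fin by (auto simp: d_def)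
      ultimately have d: "1 < d" by (simp add: incident_card d_def)
      have "(\<Sum>e\<in>?I. \<omega> e) = (\<Sum>k<d. cis (2 * pi * real k / real d))"
        unfolding \<omega>_def by (rule sum.reindex_bij_betw[OF h])
      also have "\<dots> = \<Sum>{z. z ^ d = 1}"
        using sum.reindex_bij_betw[OF Complex.bij_betw_roots_unity[of d], where g = "\<lambda>z. z"] d by simp
      also have "\<dots> = 0" by (rule sum_roots_unity[OF d])
      finally have "0 = (\<Sum>e\<in>?I. \<omega> e * c)" by (simp flip: sum_distrib_right)
      also have "\<dots> = (\<Sum>e\<in>in_arcs G v. \<omega> e * c) + (\<Sum>e\<in>out_arcs G v. \<omega> e * c)"
        by (intro sum.union_disjoint finite_in_arcs finite_out_arcs in_out_disjoint)
      also have "(\<Sum>e\<in>in_arcs G v. \<omega> e * c) = (\<Sum>e\<in>in_arcs G v. - a' e)"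
      proof (rule sum.cong)
        fix e assume e: "e \<in> in_arcs G v"
        then have "tail G e \<noteq> v" using no_loops[of e] by auto
        then show "\<omega> e * c = - a' e" using e by (simp add: a'_def \<sigma>_def)
      qed simp
      also have "(\<Sum>e\<in>out_arcs G v. \<omega> e * c) = (\<Sum>e\<in>out_arcs G v. a' e)"
        by (intro sum.cong) (auto simp: a'_def \<sigma>_def)
      finally show "(\<Sum>e\<in>in_arcs G v. a' e) = (\<Sum>e\<in>out_arcs G v. a' e)"
        by (simp add: sum_negf)
    qed
  qed
qed

text \<open>
  Unimodular slopes that are balanced on \<open>S\<close>, and a potential \<open>\<psi>\<close> with these slopes on the arcs
  inside \<open>S\<close>.
\<close>

definition partial_flow :: "'v set \<Rightarrow> ('e \<Rightarrow> complex) \<Rightarrow> ('v \<Rightarrow> complex) \<Rightarrow> bool" where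
  "partial_flow S a \<psi> \<longleftrightarrow> (\<forall>e\<in>arcs G. cmod (a e) = 1) \<and> (\<forall>v\<in>S. balanced a v) \<and>
     (\<forall>e\<in>arcs G. tail G e \<in> S \<longrightarrow> head G e \<in> S \<longrightarrow> \<psi> (head G e) - \<psi> (tail G e) = a e * of_real (L e))"

text \<open>
  Any two vertices of \<open>S\<close> are joined by a simple path inside \<open>S\<close>.
\<close>

definition path_connected_in :: "'v set \<Rightarrow> bool" where
  "path_connected_in S \<longleftrightarrow> (\<forall>s\<in>S. \<forall>t\<in>S. \<exists>p. simple_path G S s p t)"

lemma unique_crossing_arc:
  assumes S: "path_connected_in S" and w: "w \<notin> S"
    and e: "e \<in> arcs G" "s \<in> S" "s = tail G e \<and> w = head G e \<or> w = tail G e \<and> s = head G e"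
    and f: "f \<in> arcs G" "t \<in> S" "t = tail G f \<and> w = head G f \<or> w = tail G f \<and> t = head G f"
  shows "e = f"
proof (rule ccontr)
  assume ne: "e \<noteq> f"
  obtain p where p: "simple_path G S s p t" using S e f unfolding path_connected_in_def by blast
  obtain d where d: "step_source G (e, d) = w" "step_target G (e, d) = s"
    using arc_direction[of w G e s] e(3) by blast
  obtain d' where d': "step_source G (f, d') = t" "step_target G (f, d') = w"
    using arc_direction[of t G f w] f(3) by blast
  have "undirected_cycle G ((e, d) # p @ [(f, d')])"
    using e f ne by (intro simple_path_cycle[OF p w _ d _ d']) simp_all
  then show False using no_cycles by blast
qed

text \<open>
  A connected vertex set is joined to a new vertex \<open>w\<close> by exactly one arc.  The slope of this arc is kept and
  determines the potential at \<open>w\<close>; the other arcs at \<open>w\<close> are free, since they do not meet \<open>S\<close>.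
\<close>

lemma extend_flow:
  assumes S: "S \<subseteq> verts G" "S \<noteq> {}" "S \<noteq> verts G" "path_connected_in S" and pf: "partial_flow S a \<psi>"
  obtains w a' \<psi>' where "w \<in> verts G - S" "path_connected_in (insert w S)" "partial_flow (insert w S) a' \<psi>'"
proof -
  obtain x where x: "fst x \<in> arcs G" "step_source G x \<in> S" "step_target G x \<in> verts G - S"
    using crossing_arc[OF S(1-3)] .
  define e0 s w where "e0 = fst x" and "s = step_source G x" and "w = step_target G x"
  have e0: "e0 \<in> arcs G" "s \<in> S" and w: "w \<in> verts G" "w \<notin> S"
    using x by (simp_all add: e0_def s_def w_def)
  have ends: "s = tail G e0 \<and> w = head G e0 \<or> w = tail G e0 \<and> s = head G e0"
    unfolding e0_def s_def w_def by (cases x) auto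
  have uniq: "e = e0" if "e \<in> arcs G" "t \<in> S" "t = tail G e \<and> w = head G e \<or> w = tail G e \<and> t = head G e"
    for e t
    by (rule unique_crossing_arc[OF S(4) w(2) that e0 ends])
  have a1: "\<And>e. e \<in> arcs G \<Longrightarrow> cmod (a e) = 1" using pf by (simp add: partial_flow_def)
  have inc: "e0 \<in> in_arcs G w \<union> out_arcs G w" using e0 ends by auto
  obtain a' where a': "\<And>e. e \<in> arcs G \<Longrightarrow> cmod (a' e) = 1" "balanced a' w" "a' e0 = a e0"
      "\<And>e. e \<in> arcs G \<Longrightarrow> tail G e \<noteq> w \<Longrightarrow> head G e \<noteq> w \<Longrightarrow> a' e = a e"
    using balance_at_vertex[of a e0 w, OF a1 inc] by blast
  have same: "a' e = a e" if "e \<in> arcs G" "tail G e \<in> S \<or> head G e \<in> S" for e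
  proof (cases "tail G e = w \<or> head G e = w")
    case True
    then have "e = e0"
    proof
      assume t: "tail G e = w"
      then have "head G e \<in> S" using that w by auto
      then show ?thesis using t by (intro uniq[OF that(1)]) auto
    next
      assume h: "head G e = w"
      then have "tail G e \<in> S" using that w by auto
      then show ?thesis using h by (intro uniq[OF that(1)]) auto
    qed
    then show ?thesis using a' by simp
  qed (use a' that in auto)
  define \<psi>' where "\<psi>' = \<psi>(w := (if tail G e0 = w then \<psi> (head G e0) - a e0 * of_real (L e0)
      else \<psi> (tail G e0) + a e0 * of_real (L e0)))"
  obtain d where d: "step_source G (e0, d) = w" "step_target G (e0, d) = s"
    using arc_direction[of w G e0 s] ends by blast
  have "path_connected_in (insert w S)"
    unfolding path_connected_in_def
  proof (intro ballI)
    fix r t assume rt: "r \<in> insert w S" "t \<in> insert w S"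
    consider "r = w" "t = w" | "r = w" "t \<in> S" | "r \<in> S" "t = w" | "r \<in> S" "t \<in> S" using rt by auto
    then show "\<exists>p. simple_path G (insert w S) r p t"
    proof cases
      case 1
      then show ?thesis by (intro exI[of _ "[]"]) simp
    next
      case 2
      then obtain p where p: "simple_path G S s p t" using S(4) e0 unfolding path_connected_in_def by blast
      have "insert w S - {w} = S" using w by simp
      then have "simple_path G (insert w S) w ((e0, d) # p) t"
        unfolding simple_path.simps d using p e0(1) by simp
      then show ?thesis using 2 by blast
    next
      case 3
      then obtain p where p: "simple_path G S r p s" using S(4) e0 unfolding path_connected_in_def by blast
      have "simple_path G (insert w S) r (p @ [x]) w"
        using simple_path_snoc[OF p w(2) x(1)] by (simp add: s_def w_def)
      then show ?thesis using 3 by blast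
    next
      case 4
      then obtain p where "simple_path G S r p t" using S(4) unfolding path_connected_in_def by blast
      then have "simple_path G (insert w S) r p t" by (rule simple_path_mono) blast
      then show ?thesis by blast
    qed
  qed
  moreover have "partial_flow (insert w S) a' \<psi>'"
    unfolding partial_flow_def
  proof (intro conjI ballI impI)
    fix v assume v: "v \<in> insert w S"
    show "balanced a' v"
    proof (cases "v = w")
      case False
      then have "(\<Sum>e\<in>in_arcs G v. a' e) = (\<Sum>e\<in>in_arcs G v. a e)"
          "(\<Sum>e\<in>out_arcs G v. a' e) = (\<Sum>e\<in>out_arcs G v. a e)"
        using v by (auto intro!: sum.cong same)
      then show ?thesis using pf v False by (simp add: partial_flow_def balanced_def)
    qed (use a' in simp)
  next
    fix e assume e: "e \<in> arcs G" "tail G e \<in> insert w S" "head G e \<in> insert w S"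
    show "\<psi>' (head G e) - \<psi>' (tail G e) = a' e * of_real (L e)"
    proof (cases "tail G e = w \<or> head G e = w")
      case True
      then have "e = e0"
      proof
        assume t: "tail G e = w"
        then have "head G e \<in> S" using e no_loops[OF e(1)] by auto
        then show ?thesis using t by (intro uniq[OF e(1)]) auto
      next
        assume h: "head G e = w"
        then have "tail G e \<in> S" using e no_loops[OF e(1)] by auto
        then show ?thesis using h by (intro uniq[OF e(1)]) auto
      qed
      then show ?thesis using a'(3) no_loops[OF e(1)] ends by (auto simp: \<psi>'_def)
    next
      case False
      then have "\<psi> (head G e) - \<psi> (tail G e) = a e * of_real (L e)"
        using pf e by (simp add: partial_flow_def)
      then show ?thesis using False e same[OF e(1)] by (simp add: \<psi>'_def)
    qed
  qed (use a' in simp)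
  ultimately show ?thesis using that w by blast
qed

text \<open>
  On a metric tree there is a complex, edgewise affine, continuous function whose derivative has
  modulus one on each edge and satisfies Kirchhoff's law at all vertices that are not external.
\<close>

theorem unimodular_flow:
  "\<exists>a \<psi>. (\<forall>e\<in>arcs G. cmod (a e) = 1) \<and> (\<forall>v\<in>verts G. balanced a v) \<and>
     (\<forall>e\<in>arcs G. \<psi> (head G e) - \<psi> (tail G e) = a e * of_real (L e))"
proof -
  have fin: "finite (verts G)" by simp
  have grow: "\<exists>a \<psi>. partial_flow (verts G) a \<psi>"
    if "S \<subseteq> verts G" "S \<noteq> {}" "path_connected_in S" "partial_flow S a \<psi>" for S a \<psi>
    using that
  proof (induction "card (verts G - S)" arbitrary: S a \<psi> rule: less_induct)
    case less
    show ?case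
    proof (cases "S = verts G")
      case False
      obtain w a' \<psi>' where w: "w \<in> verts G - S" "path_connected_in (insert w S)" "partial_flow (insert w S) a' \<psi>'"
        using extend_flow[OF less.prems(1,2) False less.prems(3,4)] .
      have "card (verts G - insert w S) < card (verts G - S)"
        using w fin by (intro psubset_card_mono) auto
      then show ?thesis using less.hyps[OF _ _ _ w(2,3)] w less.prems by auto
    qed (use less in blast)
  qed
  have "verts G \<noteq> {}"
    using graph_connected unfolding connected_def strongly_connected_def by auto
  then obtain v where v: "v \<in> verts G" by blast
  have "\<exists>a. (\<forall>e\<in>arcs G. cmod (a e) = 1) \<and> balanced a v"
  proof (cases "in_arcs G v \<union> out_arcs G v = {}")
    case True
    then show ?thesis by (intro exI[of _ "\<lambda>_. 1"]) (simp add: balanced_def)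
  next
    case False
    then obtain e0 where "e0 \<in> in_arcs G v \<union> out_arcs G v" by blast
    then show ?thesis
    proof (rule balance_at_vertex[of "\<lambda>_. 1" e0 v, rotated])
      fix a' :: "'e \<Rightarrow> complex"
      assume "\<And>e. e \<in> arcs G \<Longrightarrow> cmod (a' e) = 1" "balanced a' v"
      then show ?thesis by blast
    qed simp
  qed
  then obtain a where a: "\<forall>e\<in>arcs G. cmod (a e) = 1" "balanced a v" by blast
  have "partial_flow {v} a (\<lambda>_. 0)"
    using a by (auto simp: partial_flow_def no_loops[symmetric])
  moreover have "path_connected_in {v}"
    unfolding path_connected_in_def by (auto intro!: exI[of _ "[]"])
  ultimately obtain a \<psi> where "partial_flow (verts G) a \<psi>" using grow[of "{v}"] v by blast
  then show ?thesis unfolding partial_flow_def by (intro exI[of _ a] exI[of _ \<psi>]) auto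
qed

end

section \<open>The energy form of a metric tree\<close>

context compact_metric_tree
begin

abbreviation ip where "ip \<equiv> L2_inner G L"
abbreviation D where "D \<equiv> form_domain G L"
abbreviation q where "q \<equiv> dirichlet_form G L"

lemma L_pos: "e \<in> arcs G \<Longrightarrow> 0 < L e" by (rule edge_length_pos)

lemma ip_leb: "ip f g = (\<Sum>e\<in>arcs G. LINT x|leb (L e). f e x * cnj (g e x))"
  unfolding L2_inner_def by (simp add: set_integral_leb)

lemma L2_graph_iff: "f \<in> L2_graph G L \<longleftrightarrow> (\<forall>e\<in>arcs G. f e \<in> lsq (leb (L e)))"
  by (simp add: L2_graph_def L2_interval_lsq)

lemma norm_leb: "Re (ip f f) = (\<Sum>e\<in>arcs G. LINT x|leb (L e). (cmod (f e x))\<^sup>2)"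
  unfolding ip_leb integral_mult_cnj_self by simp

lemma L2_form: "hermitian_form gscale (L2_graph G L) ip"
proof
  show "graph_fun.subspace (L2_graph G L)"
    unfolding graph_fun.subspace_def gscale_def plus_fun_def zero_fun_def
    by (auto simp: L2_graph_iff intro: lsq_add lsq_scale lsq_zero)
next
  fix f g h assume "f \<in> L2_graph G L" "g \<in> L2_graph G L" "h \<in> L2_graph G L"
  then show "ip (f + g) h = ip f h + ip g h"
    unfolding ip_leb sum.distrib[symmetric] L2_graph_iff
    by (intro sum.cong) (simp_all add: distrib_right lsq_mult_cnj)
next
  fix f h c
  show "ip (gscale c f) h = c * ip f h"
    unfolding ip_leb sum_distrib_left gscale_def by (simp add: mult.assoc)
next
  fix f h
  show "ip f h = cnj (ip h f)"
    unfolding ip_leb cnj_sum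
    by (intro sum.cong refl, subst Bochner_Integration.integral_cnj[symmetric]) (simp add: mult.commute)
next
  fix f show "0 \<le> Re (ip f f)" unfolding norm_leb by (intro sum_nonneg) simp
qed

sublocale L2: hermitian_form gscale "L2_graph G L" ip by (rule L2_form)

lemma ip_cong_AE:
  assumes "f \<in> L2_graph G L" "f' \<in> L2_graph G L" "g \<in> L2_graph G L"
    and "\<And>e. e \<in> arcs G \<Longrightarrow> AE x in leb (L e). f e x = f' e x"
  shows "ip f g = ip f' g"
  unfolding ip_leb
proof (rule sum.cong)
  fix e assume e: "e \<in> arcs G"
  then have "(\<lambda>x. f e x * cnj (g e x)) \<in> borel_measurable (leb (L e))"
    "(\<lambda>x. f' e x * cnj (g e x)) \<in> borel_measurable (leb (L e))"
    using assms(1-3) by (auto simp: L2_graph_iff intro!: borel_measurable_integrable[OF lsq_mult_cnj])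
  moreover have "AE x in leb (L e). f e x * cnj (g e x) = f' e x * cnj (g e x)"
    using assms(4)[OF e] by eventually_elim simp
  ultimately show "(LINT x|leb (L e). f e x * cnj (g e x)) = (LINT x|leb (L e). f' e x * cnj (g e x))"
    by (rule integral_cong_AE)
qed simp

text \<open>
  \<open>g\<close> is edgewise a weak derivative of \<open>u\<close>; vertex conditions are not part of this notion.
\<close>

definition gderiv :: "'e graph_fun \<Rightarrow> 'e graph_fun \<Rightarrow> bool" where
  "gderiv u g \<longleftrightarrow> (\<forall>e\<in>arcs G. has_weak_deriv (L e) (u e) (g e))"

lemma gderiv_L2: "gderiv u g \<Longrightarrow> g \<in> L2_graph G L"
  by (auto simp: gderiv_def L2_graph_iff intro: has_weak_deriv_lsq)

lemma gderiv_L2': "gderiv u g \<Longrightarrow> u \<in> L2_graph G L"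
  by (auto simp: gderiv_def L2_graph_iff intro: continuous_lsq has_weak_deriv_continuous)

lemma gderiv_add: "gderiv u g \<Longrightarrow> gderiv v h \<Longrightarrow> gderiv (u + v) (g + h)"
  unfolding gderiv_def plus_fun_def by (auto intro: has_weak_deriv_add)

lemma gderiv_scale: "gderiv u g \<Longrightarrow> gderiv (gscale c u) (gscale c g)"
  unfolding gderiv_def gscale_def by (auto intro: has_weak_deriv_scale)

lemma form_domainI:
  assumes "\<And>e x. e \<notin> arcs G \<or> x \<notin> {0..L e} \<Longrightarrow> u e x = 0" "gderiv u g"
    "vertex_values G L u \<phi>" "\<And>v. v \<in> external_vertices G \<Longrightarrow> \<phi> v = 0"
  shows "u \<in> D"
  using assms unfolding form_domain_def H1_graph_def gderiv_def H1_interval_def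
  by (blast intro: has_weak_deriv_continuous)

lemma form_domain_support: "u \<in> D \<Longrightarrow> e \<notin> arcs G \<or> x \<notin> {0..L e} \<Longrightarrow> u e x = 0"
  unfolding form_domain_def H1_graph_def by blast

lemma form_domain_vertex:
  "u \<in> D \<Longrightarrow> \<exists>\<phi>. vertex_values G L u \<phi> \<and> (\<forall>v\<in>external_vertices G. \<phi> v = 0)"
  unfolding form_domain_def by blast

abbreviation dv :: "'e graph_fun \<Rightarrow> 'e graph_fun" where
  "dv u \<equiv> (\<lambda>e. weak_deriv (L e) (u e))"

lemma form_domain_deriv: "u \<in> D \<Longrightarrow> gderiv u (dv u)"
  unfolding form_domain_def H1_graph_def gderiv_def by (auto intro: weak_deriv)

lemma form_domain_L2: "u \<in> D \<Longrightarrow> u \<in> L2_graph G L"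
  using form_domain_deriv gderiv_L2' by blast

text \<open>
  The energy form may be computed with any weak derivatives in place of those chosen by \<open>weak_deriv\<close>.
\<close>

lemma dirichlet_gderiv:
  assumes "u \<in> D" "v \<in> D" "gderiv u g" "gderiv v h"
  shows "q u v = ip g h"
proof -
  have AE: "AE x in leb (L e). weak_deriv (L e) (w e) x = k e x" if "w \<in> D" "gderiv w k" "e \<in> arcs G" for w k e
    using form_domain_deriv[OF that(1)] that by (auto simp: gderiv_def intro: has_weak_deriv_unique)
  have in_L2: "dv u \<in> L2_graph G L" "dv v \<in> L2_graph G L" "g \<in> L2_graph G L" "h \<in> L2_graph G L"
    using assms form_domain_deriv gderiv_L2 by blast+
  have "q u v = ip (dv u) (dv v)" by (simp add: dirichlet_form_def)
  also have "\<dots> = ip g (dv v)" using in_L2 AE assms by (intro ip_cong_AE) auto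
  also have "\<dots> = cnj (ip (dv v) g)" using in_L2 by (intro L2.ip_sym)
  also have "ip (dv v) g = ip h g" using in_L2 AE assms by (intro ip_cong_AE) auto
  also have "cnj (ip h g) = ip g h" using in_L2 by (intro L2.ip_sym[symmetric])
  finally show ?thesis .
qed

lemma subspace_D: "graph_fun.subspace D"
  unfolding graph_fun.subspace_def
proof (intro conjI ballI allI)
  have "has_weak_deriv l (\<lambda>x. 0) (\<lambda>x. 0)" for l
    by (rule has_weak_derivI) (auto simp: lsq_zero)
  then have "gderiv 0 0" by (simp add: gderiv_def zero_fun_def)
  then show "0 \<in> D" by (intro form_domainI[of 0 0 "\<lambda>v. 0"]) (auto simp: vertex_values_def)
next
  fix u v assume uv: "u \<in> D" "v \<in> D"
  obtain \<phi> where \<phi>: "vertex_values G L u \<phi>" "\<And>v. v \<in> external_vertices G \<Longrightarrow> \<phi> v = 0"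
    using form_domain_vertex[OF uv(1)] by blast
  obtain \<psi> where \<psi>: "vertex_values G L v \<psi>" "\<And>v. v \<in> external_vertices G \<Longrightarrow> \<psi> v = 0"
    using form_domain_vertex[OF uv(2)] by blast
  show "u + v \<in> D"
  proof (rule form_domainI[of _ _ "\<lambda>v. \<phi> v + \<psi> v"])
    show "gderiv (u + v) (dv u + dv v)" using uv by (intro gderiv_add form_domain_deriv)
    show "vertex_values G L (u + v) (\<lambda>v. \<phi> v + \<psi> v)" using \<phi>(1) \<psi>(1) by (simp add: vertex_values_def)
  next
    fix e x assume "e \<notin> arcs G \<or> x \<notin> {0..L e}"
    from form_domain_support[OF uv(1) this] form_domain_support[OF uv(2) this]
    show "(u + v) e x = 0" by simp
  qed (simp add: \<phi> \<psi>)
next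
  fix c u assume u: "u \<in> D"
  obtain \<phi> where \<phi>: "vertex_values G L u \<phi>" "\<And>v. v \<in> external_vertices G \<Longrightarrow> \<phi> v = 0"
    using form_domain_vertex[OF u] by blast
  show "gscale c u \<in> D"
  proof (rule form_domainI[of _ _ "\<lambda>v. c * \<phi> v"])
    show "gderiv (gscale c u) (gscale c (dv u))" using u by (intro gderiv_scale form_domain_deriv)
    show "vertex_values G L (gscale c u) (\<lambda>v. c * \<phi> v)" using \<phi>(1) by (simp add: vertex_values_def gscale_def)
  next
    fix e x assume "e \<notin> arcs G \<or> x \<notin> {0..L e}"
    from form_domain_support[OF u this] show "gscale c u e x = 0" by (simp add: gscale_def)
  qed (simp add: \<phi>)
qed

lemma D_add: "u \<in> D \<Longrightarrow> v \<in> D \<Longrightarrow> u + v \<in> D" using subspace_D by (rule graph_fun.subspace_add)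
lemma D_diff: "u \<in> D \<Longrightarrow> v \<in> D \<Longrightarrow> u - v \<in> D" using subspace_D by (rule graph_fun.subspace_diff)
lemma D_scale: "u \<in> D \<Longrightarrow> gscale c u \<in> D" using subspace_D by (rule graph_fun.subspace_scale)

lemma dv_L2: "u \<in> D \<Longrightarrow> dv u \<in> L2_graph G L" by (rule gderiv_L2[OF form_domain_deriv])

lemma q_dv: "q u v = ip (dv u) (dv v)" by (simp add: dirichlet_form_def)

sublocale F: form_pair gscale "L2_graph G L" ip D q
proof
  show "graph_fun.subspace D" by (rule subspace_D)
  show "D \<subseteq> L2_graph G L" using form_domain_L2 by blast
next
  fix u v w assume D: "u \<in> D" "v \<in> D" "w \<in> D"
  have "q (u + v) w = ip (dv u + dv v) (dv w)"
    using D by (intro dirichlet_gderiv D_add gderiv_add form_domain_deriv)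
  also have "\<dots> = q u w + q v w" using D dv_L2 by (simp add: L2.ip_add q_dv)
  finally show "q (u + v) w = q u w + q v w" .
next
  fix u w c assume D: "u \<in> D" "w \<in> D"
  have "q (gscale c u) w = ip (gscale c (dv u)) (dv w)"
    using D by (intro dirichlet_gderiv D_scale gderiv_scale form_domain_deriv)
  also have "\<dots> = c * q u w" using D dv_L2 by (simp add: L2.ip_scale q_dv)
  finally show "q (gscale c u) w = c * q u w" .
next
  fix u w assume "u \<in> D" "w \<in> D"
  then show "q u w = cnj (q w u)" unfolding q_dv by (intro L2.ip_sym dv_L2)
next
  fix u assume "u \<in> D"
  then show "0 \<le> Re (q u u)" unfolding q_dv by (intro L2.ip_nonneg dv_L2)
qed

lemma eigenspace_eq: "eigenspace G L \<kappa> = {u. F.eigvec \<kappa> u}"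
proof -
  have "neg_laplacian G L u (gscale (of_real \<kappa>) u) \<longleftrightarrow> F.eigvec \<kappa> u" for u
    unfolding neg_laplacian_def F.eigvec_def
    using form_domain_L2 L2.H_scale L2.ip_scale by (auto simp: L2.ip_scale form_domain_L2 L2.H_scale)
  then show ?thesis by (simp add: eigenspace_def)
qed

lemma D_continuous: "u \<in> D \<Longrightarrow> e \<in> arcs G \<Longrightarrow> continuous_on {0..L e} (u e)"
  using form_domain_deriv[of u] by (auto simp: gderiv_def intro: has_weak_deriv_continuous)

lemma ip_definite:
  assumes u: "u \<in> D" and z: "Re (ip u u) = 0"
  shows "u = 0"
proof (intro ext)
  fix e x
  show "u e x = 0 e x"
  proof (cases "e \<in> arcs G \<and> x \<in> {0..L e}")
    case True
    then have e: "e \<in> arcs G" and x: "x \<in> {0..L e}" by auto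
    have cont: "continuous_on {0..L e} (\<lambda>x. (cmod (u e x))\<^sup>2)" by (intro continuous_intros D_continuous u e)
    have "(LINT x|leb (L e). (cmod (u e x))\<^sup>2) = 0"
      using z e unfolding norm_leb by (subst (asm) sum_nonneg_eq_0_iff) auto
    moreover have "set_integrable lborel {0..L e} (\<lambda>x. (cmod (u e x))\<^sup>2)"
      using form_domain_L2[OF u] e unfolding set_integrable_leb by (simp add: L2_graph_iff lsq_def)
    ultimately have "integral {0..L e} (\<lambda>x. (cmod (u e x))\<^sup>2) = 0"
      by (simp add: set_borel_integral_eq_integral(2) flip: set_integral_leb)
    then have "(cmod (u e x))\<^sup>2 = 0"
      using integral_eq_0_iff[OF cont L_pos[OF e]] x by auto
    then show ?thesis by simp
  next
    case False
    then show ?thesis using form_domain_support[OF u, of e x] by auto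
  qed
qed

end

section \<open>Compactness and completeness of the form domain\<close>

context compact_metric_tree
begin

lemma edge_norm_le:
  assumes e: "e \<in> arcs G"
  shows "(LINT x|leb (L e). (cmod (f e x))\<^sup>2) \<le> Re (ip f f)"
  unfolding norm_leb by (rule member_le_sum[OF e]) auto

lemma form_domain_Hoelder:
  assumes u: "u \<in> D" and e: "e \<in> arcs G" and xy: "x \<in> {0..L e}" "y \<in> {0..L e}"
  shows "(cmod (u e x - u e y))\<^sup>2 \<le> \<bar>x - y\<bar> * Re (q u u)"
proof -
  have "(cmod (u e x - u e y))\<^sup>2 \<le> \<bar>x - y\<bar> * (LINT t|leb (L e). (cmod (dv u e t))\<^sup>2)"
    using form_domain_deriv[OF u] e xy by (intro has_weak_deriv_Hoelder) (auto simp: gderiv_def)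
  also have "\<dots> \<le> \<bar>x - y\<bar> * Re (q u u)"
    unfolding q_dv by (intro mult_left_mono edge_norm_le e) auto
  finally show ?thesis .
qed

lemma form_domain_sup_bound:
  assumes u: "u \<in> D" and e: "e \<in> arcs G" and x: "x \<in> {0..L e}"
  shows "(cmod (u e x))\<^sup>2 \<le> 2 / L e * Re (ip u u) + 2 * L e * Re (q u u)"
proof -
  have "(cmod (u e x))\<^sup>2 \<le> 2 / L e * (LINT t|leb (L e). (cmod (u e t))\<^sup>2) + 2 * L e * (LINT t|leb (L e). (cmod (dv u e t))\<^sup>2)"
    using form_domain_deriv[OF u] e x L_pos[OF e] by (intro has_weak_deriv_sup_bound) (auto simp: gderiv_def)
  also have "\<dots> \<le> 2 / L e * Re (ip u u) + 2 * L e * Re (q u u)"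
    unfolding q_dv using L_pos[OF e] by (intro add_mono mult_left_mono edge_norm_le e) auto
  finally show ?thesis .
qed

lemma ip_uniform_bound:
  assumes f: "\<And>e x. e \<in> arcs G \<Longrightarrow> x \<in> {0..L e} \<Longrightarrow> (cmod (f e x))\<^sup>2 \<le> c" and c: "0 \<le> c"
  shows "Re (ip f f) \<le> c * (\<Sum>e\<in>arcs G. L e)"
  unfolding norm_leb sum_distrib_left
proof (rule sum_mono)
  fix e assume e: "e \<in> arcs G"
  show "(LINT x|leb (L e). (cmod (f e x))\<^sup>2) \<le> c * L e"
  proof (cases "integrable (leb (L e)) (\<lambda>x. (cmod (f e x))\<^sup>2)")
    case True
    then have "(LINT x|leb (L e). (cmod (f e x))\<^sup>2) \<le> (LINT x|leb (L e). c)"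
      using f[OF e] by (intro integral_mono) auto
    then show ?thesis using L_pos[OF e] by (simp add: measure_leb mult.commute)
  next
    case False
    then show ?thesis using c L_pos[OF e] by (simp add: not_integrable_integral_eq)
  qed
qed

text \<open>
  The Arzela-Ascoli theorem on one edge after the other.
\<close>

lemma uniform_subsequence:
  assumes v: "\<And>m. v m \<in> D \<and> Re (ip (v m) (v m)) \<le> C \<and> Re (q (v m) (v m)) \<le> C" and A: "A \<subseteq> arcs G"
  shows "\<exists>k::nat \<Rightarrow> nat. strict_mono k \<and> (\<forall>e\<in>A. \<forall>r>0. \<exists>N. \<forall>i\<ge>N. \<forall>j\<ge>N. \<forall>x\<in>{0..L e}.
    cmod (v (k i) e x - v (k j) e x) < r)"
proof -
  have "finite A" using A finite_arcs finite_subset by blast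
  then show ?thesis using A
  proof (induction A)
    case empty
    show ?case by (intro exI[of _ id]) (auto simp: strict_mono_def)
  next
    case (insert e A)
    then obtain k :: "nat \<Rightarrow> nat" where k: "strict_mono k" "\<forall>e\<in>A. \<forall>r>0. \<exists>N. \<forall>i\<ge>N. \<forall>j\<ge>N. \<forall>x\<in>{0..L e}.
        cmod (v (k i) e x - v (k j) e x) < r" by auto
    have e: "e \<in> arcs G" using insert by simp
    have C: "0 \<le> C" using v[of 0] L2.ip_nonneg[OF form_domain_L2, of "v 0"] by simp
    let ?M = "sqrt (2 / L e * C + 2 * L e * C)"
    obtain g k' where k': "strict_mono (k' :: nat \<Rightarrow> nat)"
        "\<And>r. 0 < r \<Longrightarrow> \<exists>N. \<forall>n x. n \<ge> N \<and> x \<in> {0..L e} \<longrightarrow> norm (v (k (k' n)) e x - g x) < r"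
    proof (rule Arzela_Ascoli[of "{0..L e}" "\<lambda>m. v (k m) e" ?M])
      show "compact {0..L e}" by simp
    next
      fix n x assume x: "x \<in> {0..L e}"
      have "(cmod (v (k n) e x))\<^sup>2 \<le> 2 / L e * Re (ip (v (k n)) (v (k n))) + 2 * L e * Re (q (v (k n)) (v (k n)))"
        using v x e by (intro form_domain_sup_bound) auto
      also have "\<dots> \<le> 2 / L e * C + 2 * L e * C"
        using v L_pos[OF e] by (intro add_mono mult_left_mono) auto
      finally show "norm (v (k n) e x) \<le> ?M" by (rule real_le_rsqrt)
    next
      fix x r assume x: "x \<in> {0..L e}" and r: "(0::real) < r"
      show "\<exists>d. 0 < d \<and> (\<forall>n y. y \<in> {0..L e} \<and> norm (x - y) < d \<longrightarrow> norm (v (k n) e x - v (k n) e y) < r)"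
      proof (intro exI[of _ "r\<^sup>2 / (C + 1)"] conjI allI impI)
        show "0 < r\<^sup>2 / (C + 1)" using r C by simp
        fix n y assume y: "y \<in> {0..L e} \<and> norm (x - y) < r\<^sup>2 / (C + 1)"
        have "(cmod (v (k n) e x - v (k n) e y))\<^sup>2 \<le> \<bar>x - y\<bar> * Re (q (v (k n)) (v (k n)))"
          using v x y e by (intro form_domain_Hoelder) auto
        also have "\<dots> \<le> \<bar>x - y\<bar> * (C + 1)" using v[of "k n"] by (intro mult_left_mono) auto
        also have "\<dots> < r\<^sup>2" using y C by (simp add: field_simps)
        finally show "norm (v (k n) e x - v (k n) e y) < r" using r by (simp add: power2_less_imp_less)
      qed
    next
      fix g' :: "real \<Rightarrow> complex" and k'' :: "nat \<Rightarrow> nat"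
      assume "strict_mono k''"
        "\<And>r. 0 < r \<Longrightarrow> \<exists>N. \<forall>n x. n \<ge> N \<and> x \<in> {0..L e} \<longrightarrow> norm (v (k (k'' n)) e x - g' x) < r"
      then show ?thesis by (rule that)
    qed
    show ?case
    proof (intro exI[of _ "k \<circ> k'"] conjI ballI allI impI)
      show "strict_mono (k \<circ> k')" using k(1) k'(1) by (rule strict_mono_o)
      fix e' r assume e': "e' \<in> insert e A" and r: "(0::real) < r"
      show "\<exists>N. \<forall>i\<ge>N. \<forall>j\<ge>N. \<forall>x\<in>{0..L e'}. cmod (v ((k \<circ> k') i) e' x - v ((k \<circ> k') j) e' x) < r"
      proof (cases "e' = e")
        case True
        obtain N where N: "\<And>n x. n \<ge> N \<Longrightarrow> x \<in> {0..L e} \<Longrightarrow> cmod (v (k (k' n)) e x - g x) < r / 2"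
          using k'(2)[of "r / 2"] r by auto
        show ?thesis
        proof (intro exI[of _ N] allI impI ballI)
          fix i j x assume ij: "N \<le> i" "N \<le> j" and x: "x \<in> {0..L e'}"
          have "cmod (v (k (k' i)) e x - v (k (k' j)) e x) < r / 2 + r / 2"
            using N[OF ij(1)] N[OF ij(2)] x True by (intro norm_diff_triangle_less[of _ "g x"]) (auto simp: norm_minus_commute)
          then show "cmod (v ((k \<circ> k') i) e' x - v ((k \<circ> k') j) e' x) < r" using True by simp
        qed
      next
        case False
        then obtain N where N: "\<forall>i\<ge>N. \<forall>j\<ge>N. \<forall>x\<in>{0..L e'}. cmod (v (k i) e' x - v (k j) e' x) < r"
          using k(2) e' r by blast
        then show ?thesis using seq_suble[OF k'(1)]
          by (intro exI[of _ N]) (auto intro: order_trans)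
      qed
    qed
  qed
qed

lemma compact_embedding:
  assumes v: "\<And>m. v m \<in> D \<and> Re (ip (v m) (v m)) \<le> C \<and> Re (q (v m) (v m)) \<le> C"
  shows "\<exists>k::nat \<Rightarrow> nat. strict_mono k \<and> F.cauchy ip (v \<circ> k)"
proof -
  obtain k :: "nat \<Rightarrow> nat" where k: "strict_mono k" "\<And>e r. e \<in> arcs G \<Longrightarrow> 0 < r \<Longrightarrow>
      \<exists>N. \<forall>i\<ge>N. \<forall>j\<ge>N. \<forall>x\<in>{0..L e}. cmod (v (k i) e x - v (k j) e x) < r"
    using uniform_subsequence[of v, OF v subset_refl] by blast
  have "F.cauchy ip (v \<circ> k)"
    unfolding F.cauchy_def
  proof (intro allI impI)
    fix r :: real assume r: "0 < r"
    let ?S = "\<Sum>e\<in>arcs G. L e"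
    have S: "0 \<le> ?S" using L_pos by (intro sum_nonneg) (auto intro: less_imp_le)
    define d where "d = sqrt (r / (?S + 1))"
    have d: "0 < d" "d\<^sup>2 = r / (?S + 1)" using r S by (simp_all add: d_def)
    have "\<forall>e\<in>arcs G. \<exists>N. \<forall>i\<ge>N. \<forall>j\<ge>N. \<forall>x\<in>{0..L e}. cmod (v (k i) e x - v (k j) e x) < d"
      using k(2) d by blast
    from bchoice[OF this] obtain N where N: "\<And>e i j x. e \<in> arcs G \<Longrightarrow> N e \<le> i \<Longrightarrow> N e \<le> j \<Longrightarrow> x \<in> {0..L e} \<Longrightarrow>
        cmod (v (k i) e x - v (k j) e x) < d" by blast
    show "\<exists>N. \<forall>i\<ge>N. \<forall>j\<ge>N. Re (ip ((v \<circ> k) i - (v \<circ> k) j) ((v \<circ> k) i - (v \<circ> k) j)) < r"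
    proof (intro exI[of _ "\<Sum>e\<in>arcs G. N e"] allI impI)
      fix i j assume ij: "(\<Sum>e\<in>arcs G. N e) \<le> i" "(\<Sum>e\<in>arcs G. N e) \<le> j"
      have "Re (ip ((v \<circ> k) i - (v \<circ> k) j) ((v \<circ> k) i - (v \<circ> k) j)) \<le> d\<^sup>2 * ?S"
      proof (rule ip_uniform_bound)
        fix e x assume e: "e \<in> arcs G" and x: "x \<in> {0..L e}"
        have "N e \<le> (\<Sum>e\<in>arcs G. N e)" using e by (intro member_le_sum) auto
        then have "cmod (v (k i) e x - v (k j) e x) < d" using ij e x by (intro N) auto
        then show "(cmod (((v \<circ> k) i - (v \<circ> k) j) e x))\<^sup>2 \<le> d\<^sup>2" by (intro power_mono) auto
      qed simp
      also have "\<dots> < r" unfolding d(2) using r S by (simp add: field_simps)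
      finally show "Re (ip ((v \<circ> k) i - (v \<circ> k) j) ((v \<circ> k) i - (v \<circ> k) j)) < r" .
    qed
  qed
  then show ?thesis using k(1) by blast
qed

lemma primitive_tendsto:
  assumes g: "\<And>m. g m \<in> lsq (leb l)" "h \<in> lsq (leb l)"
    and lim: "(\<lambda>m. LINT x|leb l. (cmod (g m x - h x))\<^sup>2) \<longlonglongrightarrow> 0" and x: "x \<in> {0..l}"
  shows "(\<lambda>m. LINT t:{0..x}|lborel. g m t) \<longlonglongrightarrow> (LINT t:{0..x}|lborel. h t)"
proof -
  have ind: "(\<lambda>t. indicator {0..x} t :: complex) \<in> lsq (leb l)"
    by (rule leb.lsq_bounded[of _ _ 1]) (auto simp: indicator_def intro: measurable_restrict_space1)
  have diff: "(\<lambda>t. g m t - h t) \<in> lsq (leb l)" for m by (intro lsq_diff g)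
  have eq: "(LINT t:{0..x}|lborel. k t) = (LINT t|leb l. k t * cnj (indicator {0..x} t))" for k :: "real \<Rightarrow> complex"
    using x by (subst integral_initial[of x l]) (auto intro!: Bochner_Integration.integral_cong simp: indicator_def)
  have "(\<lambda>m. LINT t|leb l. (g m t - h t) * cnj (indicator {0..x} t)) \<longlonglongrightarrow> 0"
  proof (rule Lim_null_comparison)
    let ?I = "LINT t|leb l. (cmod (indicator {0..x} t))\<^sup>2"
    show "\<forall>\<^sub>F m in sequentially. norm (LINT t|leb l. (g m t - h t) * cnj (indicator {0..x} t))
        \<le> sqrt ((LINT t|leb l. (cmod (g m t - h t))\<^sup>2) * ?I)"
      using lsq_Cauchy_Schwarz[OF diff ind] by (intro always_eventually allI real_le_rsqrt)
    show "(\<lambda>m. sqrt ((LINT t|leb l. (cmod (g m t - h t))\<^sup>2) * ?I)) \<longlonglongrightarrow> 0"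
      using tendsto_real_sqrt[OF tendsto_mult_left_zero[OF lim, of ?I]] by simp
  qed
  then have "(\<lambda>m. (LINT t:{0..x}|lborel. g m t) - (LINT t:{0..x}|lborel. h t)) \<longlonglongrightarrow> 0"
    unfolding eq using lsq_mult_cnj[OF g(1) ind] lsq_mult_cnj[OF g(2) ind]
    by (simp add: left_diff_distrib)
  then show ?thesis by (rule LIM_zero_cancel)
qed

text \<open>
  The limit is taken pointwise for the functions and in square mean for the derivatives; the primitive
  of the limit derivative is the limit function.
\<close>

lemma form_complete:
  assumes v: "\<And>m. v m \<in> D" and ip_cauchy: "F.cauchy ip v" and q_cauchy: "F.cauchy q v"
  shows "\<exists>w\<in>D. (\<lambda>m. Re (ip (v m - w) (v m - w))) \<longlonglongrightarrow> 0 \<and> (\<lambda>m. Re (q (v m - w) (v m - w))) \<longlonglongrightarrow> 0"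
proof -
  have vij: "v i - v j \<in> D" for i j by (intro D_diff v)
  have gd: "gderiv (v m) (dv (v m))" for m by (rule form_domain_deriv[OF v])
  have gdiff: "gderiv (u - w) (g - h)" if "gderiv u g" "gderiv w h" for u w g h
    using gderiv_add[OF that(1) gderiv_scale[OF that(2), of "-1"]] by (simp add: gscale_def fun_diff_def plus_fun_def)
  have q_diff: "q (v i - v j) (v i - v j) = ip (dv (v i) - dv (v j)) (dv (v i) - dv (v j))" for i j
    by (intro dirichlet_gderiv vij gdiff gd)
  have dlsq: "dv (v m) e \<in> lsq (leb (L e))" if "e \<in> arcs G" for m e
    using gderiv_L2[OF gd] that by (simp add: L2_graph_iff)
  have "\<exists>h. h \<in> lsq (leb (L e)) \<and> (\<lambda>m. LINT x|leb (L e). (cmod (dv (v m) e x - h x))\<^sup>2) \<longlonglongrightarrow> 0"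
    if e: "e \<in> arcs G" for e
  proof -
    have "\<exists>h\<in>lsq (leb (L e)). (\<lambda>m. LINT x|leb (L e). (cmod (dv (v m) e x - h x))\<^sup>2) \<longlonglongrightarrow> 0"
    proof (rule leb.lsq_complete)
      fix r :: real assume "0 < r"
      then obtain N where N: "\<And>i j. i \<ge> N \<Longrightarrow> j \<ge> N \<Longrightarrow> Re (q (v i - v j) (v i - v j)) < r"
        using q_cauchy unfolding F.cauchy_def by blast
      show "\<exists>N. \<forall>i\<ge>N. \<forall>j\<ge>N. (LINT x|leb (L e). (cmod (dv (v i) e x - dv (v j) e x))\<^sup>2) < r"
      proof (intro exI[of _ N] allI impI)
        fix i j assume ij: "N \<le> i" "N \<le> j"
        have "(LINT x|leb (L e). (cmod (dv (v i) e x - dv (v j) e x))\<^sup>2) \<le> Re (q (v i - v j) (v i - v j))"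
          unfolding q_diff using edge_norm_le[OF e, of "dv (v i) - dv (v j)"] by simp
        also have "\<dots> < r" by (rule N[OF ij])
        finally show "(LINT x|leb (L e). (cmod (dv (v i) e x - dv (v j) e x))\<^sup>2) < r" .
      qed
    qed (rule dlsq[OF e])
    then show ?thesis by blast
  qed
  then have "\<forall>e\<in>arcs G. \<exists>h. h \<in> lsq (leb (L e)) \<and> (\<lambda>m. LINT x|leb (L e). (cmod (dv (v m) e x - h x))\<^sup>2) \<longlonglongrightarrow> 0"
    by blast
  from bchoice[OF this] obtain h where h: "\<And>e. e \<in> arcs G \<Longrightarrow> h e \<in> lsq (leb (L e))"
      "\<And>e. e \<in> arcs G \<Longrightarrow> (\<lambda>m. LINT x|leb (L e). (cmod (dv (v m) e x - h e x))\<^sup>2) \<longlonglongrightarrow> 0"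
    by blast
  have unif: "\<exists>N. \<forall>i\<ge>N. \<forall>j\<ge>N. \<forall>x\<in>{0..L e}. (cmod (v i e x - v j e x))\<^sup>2 < r"
    if e: "e \<in> arcs G" and r: "0 < r" for e r
  proof -
    define d where "d = r / (2 / L e + 2 * L e)"
    have p: "0 < 2 / L e + 2 * L e" using L_pos[OF e] by (simp add: add_pos_pos)
    have d: "0 < d" using r p by (simp add: d_def)
    obtain N1 where N1: "\<And>i j. i \<ge> N1 \<Longrightarrow> j \<ge> N1 \<Longrightarrow> Re (ip (v i - v j) (v i - v j)) < d"
      using ip_cauchy d unfolding F.cauchy_def by blast
    obtain N2 where N2: "\<And>i j. i \<ge> N2 \<Longrightarrow> j \<ge> N2 \<Longrightarrow> Re (q (v i - v j) (v i - v j)) < d"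
      using q_cauchy d unfolding F.cauchy_def by blast
    show ?thesis
    proof (intro exI[of _ "max N1 N2"] allI impI ballI)
      fix i j x assume ij: "max N1 N2 \<le> i" "max N1 N2 \<le> j" and x: "x \<in> {0..L e}"
      have "(cmod ((v i - v j) e x))\<^sup>2 \<le> 2 / L e * Re (ip (v i - v j) (v i - v j)) + 2 * L e * Re (q (v i - v j) (v i - v j))"
        by (rule form_domain_sup_bound[OF vij e x])
      also have "\<dots> < 2 / L e * d + 2 * L e * d"
        using N1[of i j] N2[of i j] ij L_pos[OF e] by (intro add_strict_mono mult_strict_left_mono) auto
      also have "\<dots> = (2 / L e + 2 * L e) * d" by (simp add: distrib_right)
      also have "\<dots> = r" using p by (simp add: d_def)
      finally show "(cmod (v i e x - v j e x))\<^sup>2 < r" by simp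
    qed
  qed
  \<comment> \<open>Off the graph all terms are zero, so that the limit vanishes there as well.\<close>
  define w where "w e x = lim (\<lambda>m. v m e x)" for e x
  have conv: "(\<lambda>m. v m e x) \<longlonglongrightarrow> w e x" if e: "e \<in> arcs G" and x: "x \<in> {0..L e}" for e x
  proof -
    have "Cauchy (\<lambda>m. v m e x)"
    proof (rule CauchyI)
      fix r :: real assume r: "0 < r"
      obtain N where N: "\<forall>i\<ge>N. \<forall>j\<ge>N. \<forall>x\<in>{0..L e}. (cmod (v i e x - v j e x))\<^sup>2 < r\<^sup>2"
        using unif[OF e, of "r\<^sup>2"] r by auto
      show "\<exists>M. \<forall>m\<ge>M. \<forall>n\<ge>M. norm (v m e x - v n e x) < r"
        using N x r by (intro exI[of _ N] allI impI) (auto intro!: power2_less_imp_less[of _ r])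
    qed
    then show ?thesis unfolding w_def by (simp add: Cauchy_convergent_iff convergent_LIMSEQ_iff)
  qed
  have supp: "w e x = 0" if "e \<notin> arcs G \<or> x \<notin> {0..L e}" for e x
    unfolding w_def using form_domain_support[OF v that] by simp
  have wd: "gderiv w h"
    unfolding gderiv_def
  proof
    fix e assume e: "e \<in> arcs G"
    show "has_weak_deriv (L e) (w e) (h e)"
    proof (rule has_weak_derivI)
      show "h e \<in> lsq (leb (L e))" by (rule h(1)[OF e])
      fix x assume x: "x \<in> {0..L e}"
      have "(\<lambda>m. v m e 0 + (LINT t:{0..x}|lborel. dv (v m) e t)) \<longlonglongrightarrow> w e 0 + (LINT t:{0..x}|lborel. h e t)"
        using L_pos[OF e] by (intro tendsto_add conv[OF e] primitive_tendsto[OF dlsq[OF e] h(1)[OF e] h(2)[OF e] x]) auto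
      moreover have "v m e 0 + (LINT t:{0..x}|lborel. dv (v m) e t) = v m e x" for m
        using has_weak_derivD[OF _ x, of "v m e" "dv (v m) e"] gd[of m] e by (auto simp: gderiv_def)
      ultimately have "(\<lambda>m. v m e x) \<longlonglongrightarrow> w e 0 + (LINT t:{0..x}|lborel. h e t)" by simp
      then show "w e x = w e 0 + (LINT t:{0..x}|lborel. h e t)" using conv[OF e x] LIMSEQ_unique by blast
    qed
  qed
  have "\<exists>\<phi>. vertex_values G L (v m) \<phi> \<and> (\<forall>v\<in>external_vertices G. \<phi> v = 0)" for m
    by (rule form_domain_vertex[OF v])
  then obtain \<phi> where \<phi>: "\<And>m. vertex_values G L (v m) (\<phi> m)" "\<And>m v. v \<in> external_vertices G \<Longrightarrow> \<phi> m v = 0"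
    by metis
  have wD: "w \<in> D"
  proof (rule form_domainI[OF supp wd])
    show "vertex_values G L w (\<lambda>p. lim (\<lambda>m. \<phi> m p))"
      unfolding vertex_values_def
    proof (intro ballI conjI)
      fix e assume e: "e \<in> arcs G"
      have "\<phi> m (tail G e) = v m e 0" "\<phi> m (head G e) = v m e (L e)" for m
        using \<phi>(1)[of m] e by (simp_all add: vertex_values_def)
      then show "w e 0 = lim (\<lambda>m. \<phi> m (tail G e))" "w e (L e) = lim (\<lambda>m. \<phi> m (head G e))"
        by (simp_all add: w_def)
    qed
  qed (use \<phi>(2) in auto)
  have "(\<lambda>m. Re (q (v m - w) (v m - w))) \<longlonglongrightarrow> 0"
  proof -
    have "q (v m - w) (v m - w) = ip (dv (v m) - h) (dv (v m) - h)" for m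
      by (intro dirichlet_gderiv D_diff v wD gdiff gd wd)
    then have "Re (q (v m - w) (v m - w)) = (\<Sum>e\<in>arcs G. LINT x|leb (L e). (cmod (dv (v m) e x - h e x))\<^sup>2)" for m
      by (simp add: norm_leb)
    then show ?thesis using tendsto_sum[of "arcs G" "\<lambda>e m. LINT x|leb (L e). (cmod (dv (v m) e x - h e x))\<^sup>2" "\<lambda>e. 0"] h(2)
      by simp
  qed
  moreover have "(\<lambda>m. Re (ip (v m - w) (v m - w))) \<longlonglongrightarrow> 0"
  proof (rule LIMSEQ_I)
    fix r :: real assume r: "0 < r"
    let ?S = "\<Sum>e\<in>arcs G. L e"
    have S: "0 \<le> ?S" using L_pos by (intro sum_nonneg) (auto intro: less_imp_le)
    define d where "d = r / (?S + 1)"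
    have d: "0 < d" using r S by (simp add: d_def)
    have "\<forall>e\<in>arcs G. \<exists>N. \<forall>i\<ge>N. \<forall>j\<ge>N. \<forall>x\<in>{0..L e}. (cmod (v i e x - v j e x))\<^sup>2 < d"
      using unif d by blast
    from bchoice[OF this] obtain N where N: "\<And>e i j x. e \<in> arcs G \<Longrightarrow> N e \<le> i \<Longrightarrow> N e \<le> j \<Longrightarrow> x \<in> {0..L e} \<Longrightarrow>
        (cmod (v i e x - v j e x))\<^sup>2 < d" by blast
    show "\<exists>no. \<forall>m\<ge>no. norm (Re (ip (v m - w) (v m - w)) - 0) < r"
    proof (intro exI[of _ "\<Sum>e\<in>arcs G. N e"] allI impI)
      fix m assume m: "(\<Sum>e\<in>arcs G. N e) \<le> m"
      have "Re (ip (v m - w) (v m - w)) \<le> d * ?S"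
      proof (rule ip_uniform_bound)
        fix e x assume e: "e \<in> arcs G" and x: "x \<in> {0..L e}"
        have "N e \<le> (\<Sum>e\<in>arcs G. N e)" using e by (intro member_le_sum) auto
        then have Nm: "N e \<le> m" using m by simp
        have "(\<lambda>j. (cmod (v m e x - v j e x))\<^sup>2) \<longlonglongrightarrow> (cmod (v m e x - w e x))\<^sup>2"
          by (intro tendsto_intros conv[OF e x])
        then have "(cmod (v m e x - w e x))\<^sup>2 \<le> d"
          using N[OF e Nm _ x] by (intro LIMSEQ_le_const2) (auto intro: less_imp_le)
        then show "(cmod ((v m - w) e x))\<^sup>2 \<le> d" by simp
      qed (use d in simp)
      also have "\<dots> < r" unfolding d_def using r S by (simp add: field_simps)
      finally show "norm (Re (ip (v m - w) (v m - w)) - 0) < r"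
        using L2.ip_nonneg[OF form_domain_L2[OF D_diff[OF v wD]], of m] by simp
    qed
  qed
  ultimately show ?thesis using wD by blast
qed

end

section \<open>Edgewise affine multipliers\<close>

context compact_metric_tree
begin

text \<open>
  Multiplication by the edgewise affine function with value \<open>p v\<close> at the vertex \<open>v\<close> and slope \<open>b e\<close>
  on the edge \<open>e\<close>.
\<close>

definition ramp :: "('e \<Rightarrow> real) \<Rightarrow> ('v \<Rightarrow> real) \<Rightarrow> 'e graph_fun \<Rightarrow> 'e graph_fun" where
  "ramp b p u = (\<lambda>e x. of_real (p (tail G e) + b e * x) * u e x)"

text \<open>
  Multiplication by the derivative of this edgewise affine function.
\<close>

definition slope :: "('e \<Rightarrow> real) \<Rightarrow> 'e graph_fun \<Rightarrow> 'e graph_fun" where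
  "slope b u = (\<lambda>e x. of_real (b e) * u e x)"

lemma slope_L2: "f \<in> L2_graph G L \<Longrightarrow> slope b f \<in> L2_graph G L"
  by (auto simp: L2_graph_iff slope_def intro: lsq_scale)

lemma ramp_L2: "f \<in> L2_graph G L \<Longrightarrow> ramp b p f \<in> L2_graph G L"
  by (auto simp: L2_graph_iff ramp_def intro!: continuous_mult_lsq continuous_intros)

lemma ip_slope: "ip (slope b f) g = ip f (slope b g)"
  unfolding ip_leb slope_def by (simp add: mult.assoc mult.left_commute)

lemma ip_ramp: "ip (ramp b p f) g = ip f (ramp b p g)"
  unfolding ip_leb ramp_def by (simp add: mult.assoc mult.left_commute)

lemma ramp_slope: "ramp b p (slope b f) = slope b (ramp b p f)"
  unfolding ramp_def slope_def by (simp add: fun_eq_iff mult.left_commute)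

lemma slope_add: "slope b (f + g) = slope b f + slope b g"
  unfolding slope_def by (simp add: fun_eq_iff distrib_left)

text \<open>
  The function with vertex values \<open>p\<close> and slopes \<open>b\<close> is continuous and satisfies Kirchhoff's law.
\<close>

definition kirchhoff_potential :: "('e \<Rightarrow> real) \<Rightarrow> ('v \<Rightarrow> real) \<Rightarrow> bool" where
  "kirchhoff_potential b p \<longleftrightarrow> (\<forall>e\<in>arcs G. p (head G e) - p (tail G e) = b e * L e) \<and>
     (\<forall>v\<in>verts G. balanced (\<lambda>e. of_real (b e)) v)"

lemma sum_over_ends:
  fixes F :: "'v \<Rightarrow> 'e \<Rightarrow> complex"
  shows "(\<Sum>e\<in>arcs G. F (head G e) e) = (\<Sum>v\<in>verts G. \<Sum>e\<in>in_arcs G v. F v e)"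
    and "(\<Sum>e\<in>arcs G. F (tail G e) e) = (\<Sum>v\<in>verts G. \<Sum>e\<in>out_arcs G v. F v e)"
proof -
  have "(\<Sum>e\<in>arcs G. F (head G e) e) = (\<Sum>v\<in>verts G. \<Sum>e\<in>{e \<in> arcs G. head G e = v}. F (head G e) e)"
    by (intro sum.group[symmetric]) auto
  also have "\<dots> = (\<Sum>v\<in>verts G. \<Sum>e\<in>in_arcs G v. F v e)"
    unfolding in_arcs_def by (intro sum.cong) auto
  finally show "(\<Sum>e\<in>arcs G. F (head G e) e) = (\<Sum>v\<in>verts G. \<Sum>e\<in>in_arcs G v. F v e)" .
  have "(\<Sum>e\<in>arcs G. F (tail G e) e) = (\<Sum>v\<in>verts G. \<Sum>e\<in>{e \<in> arcs G. tail G e = v}. F (tail G e) e)"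
    by (intro sum.group[symmetric]) auto
  also have "\<dots> = (\<Sum>v\<in>verts G. \<Sum>e\<in>out_arcs G v. F v e)"
    unfolding out_arcs_def by (intro sum.cong) auto
  finally show "(\<Sum>e\<in>arcs G. F (tail G e) e) = (\<Sum>v\<in>verts G. \<Sum>e\<in>out_arcs G v. F v e)" .
qed

text \<open>
  The slope-weighted boundary terms of an integration by parts add up to zero: at an external vertex
  by the Dirichlet condition, at the other vertices by Kirchhoff's law for the slopes.
\<close>

lemma boundary_terms_cancel:
  assumes u: "u \<in> D" and w: "w \<in> D" and gu: "gderiv u g" and gw: "gderiv w h"
    and bal: "\<And>v. v \<in> verts G \<Longrightarrow> balanced (\<lambda>e. of_real (b e)) v"
  shows "ip (slope b g) w + ip (slope b u) h = 0"
proof -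
  obtain \<phi> where \<phi>: "vertex_values G L u \<phi>" "\<And>v. v \<in> external_vertices G \<Longrightarrow> \<phi> v = 0"
    using form_domain_vertex[OF u] by blast
  obtain \<psi> where \<psi>: "vertex_values G L w \<psi>" "\<And>v. v \<in> external_vertices G \<Longrightarrow> \<psi> v = 0"
    using form_domain_vertex[OF w] by blast
  define \<theta> where "\<theta> v = \<phi> v * cnj (\<psi> v)" for v
  have "ip (slope b g) w + ip (slope b u) h
      = (\<Sum>e\<in>arcs G. of_real (b e) * ((LINT x|leb (L e). g e x * cnj (w e x)) + (LINT x|leb (L e). u e x * cnj (h e x))))"
    unfolding ip_leb slope_def sum.distrib[symmetric] by (simp add: mult.assoc distrib_left)
  also have "\<dots> = (\<Sum>e\<in>arcs G. of_real (b e) * (\<theta> (head G e) - \<theta> (tail G e)))"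
  proof (rule sum.cong)
    fix e assume e: "e \<in> arcs G"
    have "(LINT x|leb (L e). g e x * cnj (w e x)) + (LINT x|leb (L e). u e x * cnj (h e x))
        = u e (L e) * cnj (w e (L e)) - u e 0 * cnj (w e 0)"
      using gu gw e L_pos[OF e] by (intro integral_by_parts has_weak_deriv_cnj) (auto simp: gderiv_def)
    also have "\<dots> = \<theta> (head G e) - \<theta> (tail G e)"
      using \<phi>(1) \<psi>(1) e by (simp add: vertex_values_def \<theta>_def)
    finally show "of_real (b e) * ((LINT x|leb (L e). g e x * cnj (w e x)) + (LINT x|leb (L e). u e x * cnj (h e x)))
        = of_real (b e) * (\<theta> (head G e) - \<theta> (tail G e))" by simp
  qed simp
  also have "\<dots> = (\<Sum>v\<in>verts G. (\<Sum>e\<in>in_arcs G v. of_real (b e) * \<theta> v) - (\<Sum>e\<in>out_arcs G v. of_real (b e) * \<theta> v))"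
    using sum_over_ends[of "\<lambda>v e. of_real (b e) * \<theta> v"] by (simp add: right_diff_distrib sum_subtractf)
  also have "\<dots> = 0"
  proof (rule sum.neutral, rule ballI)
    fix v assume v: "v \<in> verts G"
    show "(\<Sum>e\<in>in_arcs G v. of_real (b e) * \<theta> v) - (\<Sum>e\<in>out_arcs G v. of_real (b e) * \<theta> v) = 0"
    proof (cases "vertex_degree G v = 1")
      case True
      then have "\<theta> v = 0" using \<phi>(2) v by (simp add: \<theta>_def external_vertices_def)
      then show ?thesis by simp
    next
      case False
      then show ?thesis using bal[OF v] by (simp add: balanced_def flip: sum_distrib_right)
    qed
  qed
  finally show ?thesis .
qed

context
  fixes b :: "'e \<Rightarrow> real" and p :: "'v \<Rightarrow> real"
  assumes kp: "kirchhoff_potential b p"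
begin

lemma ramp_gderiv: "gderiv u g \<Longrightarrow> gderiv (ramp b p u) (slope b u + ramp b p g)"
  unfolding gderiv_def
proof
  fix e assume u: "\<forall>e\<in>arcs G. has_weak_deriv (L e) (u e) (g e)" and e: "e \<in> arcs G"
  have "has_weak_deriv (L e) (\<lambda>x. (of_real (p (tail G e)) + of_real (b e) * of_real x) * u e x)
      (\<lambda>x. of_real (b e) * u e x + (of_real (p (tail G e)) + of_real (b e) * of_real x) * g e x)"
    using u e L_pos[OF e] by (intro has_weak_deriv_mult has_weak_deriv_affine) auto
  then show "has_weak_deriv (L e) (ramp b p u e) ((slope b u + ramp b p g) e)"
    by (simp add: ramp_def slope_def plus_fun_def)
qed

lemma ramp_in_D:
  assumes u: "u \<in> D"
  shows "ramp b p u \<in> D"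
proof -
  obtain \<phi> where \<phi>: "vertex_values G L u \<phi>" "\<And>v. v \<in> external_vertices G \<Longrightarrow> \<phi> v = 0"
    using form_domain_vertex[OF u] by blast
  show ?thesis
  proof (rule form_domainI[OF _ ramp_gderiv[OF form_domain_deriv[OF u]]])
    show "vertex_values G L (ramp b p u) (\<lambda>v. of_real (p v) * \<phi> v)"
      unfolding vertex_values_def
    proof (intro ballI conjI)
      fix e assume e: "e \<in> arcs G"
      have "p (tail G e) + b e * L e = p (head G e)"
        using kp e unfolding kirchhoff_potential_def by (simp add: algebra_simps)
      then show "ramp b p u e (L e) = of_real (p (head G e)) * \<phi> (head G e)"
        using \<phi>(1) e unfolding ramp_def vertex_values_def by simp
      show "ramp b p u e 0 = of_real (p (tail G e)) * \<phi> (tail G e)"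
        using \<phi>(1) e unfolding ramp_def vertex_values_def by simp
    qed
  next
    fix e x assume "e \<notin> arcs G \<or> x \<notin> {0..L e}"
    from form_domain_support[OF u this] show "ramp b p u e x = 0" by (simp add: ramp_def)
  qed (simp add: \<phi>)
qed

lemma slopes_balanced: "v \<in> verts G \<Longrightarrow> balanced (\<lambda>e. of_real (b e)) v"
  using kp by (simp add: kirchhoff_potential_def)

text \<open>
  The commutator identity: \<open>-\<Delta>(\<phi>u) = l\<phi>u - 2\<phi>'u'\<close> in weak form, for an eigenfunction \<open>u\<close> and
  \<open>\<phi>\<close> the edgewise affine function.
\<close>

lemma ramp_commutator:
  assumes eig: "F.eigvec l u" and w: "w \<in> D"
  shows "q (ramp b p u) w = of_real l * ip (ramp b p u) w - 2 * ip (slope b (dv u)) w"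
proof -
  have u: "u \<in> D" using eig by (simp add: F.eigvec_def)
  note L2s = slope_L2 ramp_L2 form_domain_L2 dv_L2 u w
  have "q (ramp b p u) w = ip (slope b u + ramp b p (dv u)) (dv w)"
    by (intro dirichlet_gderiv ramp_in_D ramp_gderiv form_domain_deriv u w)
  also have "\<dots> = ip (slope b u) (dv w) + ip (dv u) (ramp b p (dv w))"
    using L2s by (simp add: L2.ip_add ip_ramp)
  finally have 1: "q (ramp b p u) w = ip (slope b u) (dv w) + ip (dv u) (ramp b p (dv w))" .
  have "of_real l * ip (ramp b p u) w = of_real l * ip u (ramp b p w)" by (simp add: ip_ramp)
  also have "\<dots> = q u (ramp b p w)" using eig ramp_in_D[OF w] by (simp add: F.eigvec_def)
  also have "\<dots> = ip (dv u) (slope b w + ramp b p (dv w))"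
    by (intro dirichlet_gderiv ramp_in_D ramp_gderiv form_domain_deriv u w)
  also have "\<dots> = ip (slope b (dv u)) w + ip (dv u) (ramp b p (dv w))"
    using L2s by (simp add: L2.ip_add_right ip_slope)
  finally have 2: "of_real l * ip (ramp b p u) w = ip (slope b (dv u)) w + ip (dv u) (ramp b p (dv w))" .
  have 3: "ip (slope b (dv u)) w + ip (slope b u) (dv w) = 0"
    by (intro boundary_terms_cancel u w form_domain_deriv slopes_balanced)
  show ?thesis unfolding 1 2 using 3 by (simp add: algebra_simps eq_neg_iff_add_eq_0)
qed

lemma ramp_weight:
  assumes u: "u \<in> D"
  shows "- 2 * Re (ip (slope b (dv u)) (ramp b p u)) = Re (ip (slope b u) (slope b u))"
proof -
  note L2s = slope_L2 ramp_L2 form_domain_L2 dv_L2 u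
  have "ip (slope b (slope b u + ramp b p (dv u))) u + ip (slope b (ramp b p u)) (dv u) = 0"
    by (intro boundary_terms_cancel u ramp_in_D ramp_gderiv form_domain_deriv slopes_balanced)
  moreover have "ip (slope b (slope b u + ramp b p (dv u))) u
      = ip (slope b u) (slope b u) + ip (slope b (dv u)) (ramp b p u)"
    using L2s by (simp add: slope_add L2.ip_add ip_slope[of b "slope b u"] ip_ramp flip: ramp_slope)
  moreover have "ip (slope b (ramp b p u)) (dv u) = cnj (ip (slope b (dv u)) (ramp b p u))"
    using L2s L2.ip_sym[of "ramp b p u" "slope b (dv u)"] by (simp add: ip_slope)
  ultimately have "Re (ip (slope b u) (slope b u) + ip (slope b (dv u)) (ramp b p u)
      + cnj (ip (slope b (dv u)) (ramp b p u))) = 0" by simp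
  then show ?thesis by simp
qed

lemma ramp_symmetric:
  assumes "u \<in> D" "w \<in> D"
  shows "ip (ramp b p u) w = cnj (ip (ramp b p w) u)"
  using L2.ip_sym[of u "ramp b p w"] assms by (simp add: ip_ramp ramp_L2 form_domain_L2)

end

lemma slope_norm:
  assumes a: "\<And>e. e \<in> arcs G \<Longrightarrow> cmod (a e) = 1" and f: "f \<in> L2_graph G L"
  shows "Re (ip (slope (\<lambda>e. Re (a e)) f) (slope (\<lambda>e. Re (a e)) f))
       + Re (ip (slope (\<lambda>e. Im (a e)) f) (slope (\<lambda>e. Im (a e)) f)) = Re (ip f f)"
  unfolding norm_leb sum.distrib[symmetric]
proof (rule sum.cong)
  fix e assume e: "e \<in> arcs G"
  have "(Re (a e))\<^sup>2 + (Im (a e))\<^sup>2 = 1" using a[OF e] by (simp flip: cmod_power2)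
  then have "((Re (a e))\<^sup>2 + (Im (a e))\<^sup>2) * c = c" for c by simp
  then show "(LINT x|leb (L e). (cmod (slope (\<lambda>e. Re (a e)) f e x))\<^sup>2)
       + (LINT x|leb (L e). (cmod (slope (\<lambda>e. Im (a e)) f e x))\<^sup>2) = (LINT x|leb (L e). (cmod (f e x))\<^sup>2)"
    by (simp add: slope_def norm_mult power_mult_distrib flip: distrib_right)
qed simp

lemma balanced_parts:
  assumes "balanced a v"
  shows "balanced (\<lambda>e. of_real (Re (a e))) v" "balanced (\<lambda>e. of_real (Im (a e))) v"
  using assms unfolding balanced_def by (auto simp flip: of_real_sum Re_sum Im_sum)

text \<open>
  The commutator bounds for the real and the imaginary part of the unimodular potential are added.  Since
  the squares of the two slopes add up to one on each edge, their weights combine to the norms of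
  \<open>u j\<close> and of its derivative, which are \<open>1\<close> and \<open>ev j\<close>.
\<close>

theorem yang_inequality:
  assumes ev: "eigenvalue_list G L ev" and z: "\<And>j. j \<in> {1..n} \<Longrightarrow> ev j \<le> z" "z \<le> ev (n + 1)"
  shows "(\<Sum>j=1..n. (z - ev j)\<^sup>2) \<le> 4 * (\<Sum>j=1..n. (z - ev j) * ev j)"
proof -
  interpret spec: discrete_spectrum gscale "L2_graph G L" ip D q ev
  proof
    show "u = 0" if "u \<in> D" "Re (ip u u) = 0" for u using that by (rule ip_definite)
    show "mono_on {1..} ev" using ev by (simp add: eigenvalue_list_def)
    show "finite {j. 1 \<le> j \<and> ev j = r}" for r using ev unfolding eigenvalue_list_def by blast
    show "\<exists>B. finite B \<and> B \<subseteq> {u. F.eigvec r u} \<and> graph_fun.independent B \<and>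
           {u. F.eigvec r u} \<subseteq> graph_fun.span B \<and> card B = card {j. 1 \<le> j \<and> ev j = r}" for r
      using ev unfolding eigenvalue_list_def eigenspace_eq by blast
  qed
  obtain u where on: "L2.orthonormal u {1..n}" and eig: "\<And>j. j \<in> {1..n} \<Longrightarrow> F.eigvec (ev j) (u j)"
    using spec.orthonormal_eigenvectors by blast
  have uD: "u j \<in> D" if "j \<in> {1..n}" for j using eig[OF that] by (simp add: F.eigvec_def)
  have gap: "z * Re (ip v v) \<le> Re (q v v)"
    if v: "v \<in> D" "\<And>k. k \<in> {1..n} \<Longrightarrow> ip v (u k) = 0" for v
  proof (rule ccontr)
    assume "\<not> z * Re (ip v v) \<le> Re (q v v)"
    then have less: "Re (q v v) < z * Re (ip v v)" by simp
    have "\<exists>w r. F.eigvec r w \<and> r < z \<and> ip w w = 1 \<and> (\<forall>k\<in>{1..n}. ip w (u k) = 0)"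
    proof (rule F.minimizer[OF _ _ on eig v less])
      fix w :: "nat \<Rightarrow> 'e graph_fun" and C
      assume "\<And>m. w m \<in> D \<and> Re (ip (w m) (w m)) \<le> C \<and> Re (q (w m) (w m)) \<le> C"
      then show "\<exists>k::nat \<Rightarrow> nat. strict_mono k \<and> F.cauchy ip (w \<circ> k)" by (rule compact_embedding)
    qed (auto intro: form_complete)
    then obtain w r where w: "F.eigvec r w" "r < z" "ip w w = 1" "\<forall>k\<in>{1..n}. ip w (u k) = 0" by blast
    have "ev (n + 1) \<le> r" using w(4) by (intro spec.no_further_eigenvector[OF on eig w(1,3)]) auto
    then show False using w(2) z(2) by simp
  qed
  obtain a \<psi> where a: "\<And>e. e \<in> arcs G \<Longrightarrow> cmod (a e) = 1" "\<And>v. v \<in> verts G \<Longrightarrow> balanced a v"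
      "\<And>e. e \<in> arcs G \<Longrightarrow> \<psi> (head G e) - \<psi> (tail G e) = a e * of_real (L e)"
    using unimodular_flow by blast
  have bound: "(\<Sum>j=1..n. (z - ev j)\<^sup>2 * Re (ip (slope b (u j)) (slope b (u j))))
      \<le> 4 * (\<Sum>j=1..n. (z - ev j) * Re (ip (slope b (dv (u j))) (slope b (dv (u j)))))"
    if kp: "kirchhoff_potential b p" for b p
  proof -
    have "(\<Sum>j=1..n. (z - ev j)\<^sup>2 * (- 2 * Re (ip (slope b (dv (u j))) (ramp b p (u j)))))
      \<le> 4 * (\<Sum>j=1..n. (z - ev j) * Re (ip (slope b (dv (u j))) (slope b (dv (u j)))))"
      by (rule F.commutator_bound[OF on eig gap z(1)])
        (rule ramp_in_D[OF kp] slope_L2 dv_L2 uD ramp_symmetric[OF kp] ramp_commutator[OF kp] eig | assumption)+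
    moreover have "(\<Sum>j=1..n. (z - ev j)\<^sup>2 * (- 2 * Re (ip (slope b (dv (u j))) (ramp b p (u j)))))
      = (\<Sum>j=1..n. (z - ev j)\<^sup>2 * Re (ip (slope b (u j)) (slope b (u j))))"
      by (intro sum.cong refl) (simp only: ramp_weight[OF kp uD])
    ultimately show ?thesis by simp
  qed
  have kp1: "kirchhoff_potential (\<lambda>e. Re (a e)) (\<lambda>v. Re (\<psi> v))"
    unfolding kirchhoff_potential_def
    using balanced_parts(1)[OF a(2)] arg_cong[OF a(3), of _ Re] by simp
  have kp2: "kirchhoff_potential (\<lambda>e. Im (a e)) (\<lambda>v. Im (\<psi> v))"
    unfolding kirchhoff_potential_def
    using balanced_parts(2)[OF a(2)] arg_cong[OF a(3), of _ Im] by simp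
  have nu: "Re (ip (u j) (u j)) = 1" if "j \<in> {1..n}" for j
    using on that by (simp add: L2.orthonormal_def)
  have nq: "Re (ip (dv (u j)) (dv (u j))) = ev j" if j: "j \<in> {1..n}" for j
  proof -
    have "q (u j) (u j) = of_real (ev j) * ip (u j) (u j)" using eig[OF j] uD[OF j] by (simp add: F.eigvec_def)
    then show ?thesis using nu[OF j] by (simp add: q_dv)
  qed
  have w1: "(\<Sum>j=1..n. (z - ev j)\<^sup>2 * Re (ip (slope (\<lambda>e. Re (a e)) (u j)) (slope (\<lambda>e. Re (a e)) (u j))))
      + (\<Sum>j=1..n. (z - ev j)\<^sup>2 * Re (ip (slope (\<lambda>e. Im (a e)) (u j)) (slope (\<lambda>e. Im (a e)) (u j))))
      = (\<Sum>j=1..n. (z - ev j)\<^sup>2)"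
    unfolding sum.distrib[symmetric] distrib_left[symmetric]
    using slope_norm[of a, OF a(1) form_domain_L2[OF uD]] nu by (intro sum.cong) auto
  have w2: "(\<Sum>j=1..n. (z - ev j) * Re (ip (slope (\<lambda>e. Re (a e)) (dv (u j))) (slope (\<lambda>e. Re (a e)) (dv (u j)))))
      + (\<Sum>j=1..n. (z - ev j) * Re (ip (slope (\<lambda>e. Im (a e)) (dv (u j))) (slope (\<lambda>e. Im (a e)) (dv (u j)))))
      = (\<Sum>j=1..n. (z - ev j) * ev j)"
    unfolding sum.distrib[symmetric] distrib_left[symmetric]
    using slope_norm[of a, OF a(1) dv_L2[OF uD]] nq by (intro sum.cong) auto
  show ?thesis using add_mono[OF bound[OF kp1] bound[OF kp2]] unfolding w1 distrib_left[of 4, symmetric] w2 .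
qed

end

text \<open>
  For \<open>z\<close> between \<open>ev n\<close> and \<open>ev (n + 1)\<close>, Yang's inequality is a quadratic inequality in
  \<open>z\<close>, namely \<open>(z - m)\<^sup>2 \<le> \<Delta>\<close> with \<open>m\<close> three times the mean of the first \<open>n\<close> eigenvalues and
  \<open>\<Delta>\<close> the discriminant.
\<close>

theorem theorem5p3:
  fixes G :: "('v, 'e) pre_digraph" and L :: "'e \<Rightarrow> real"
    and ev :: "nat \<Rightarrow> real" and n :: nat
  assumes "compact_metric_tree G L"
    and "eigenvalue_list G L ev"
    and "2 \<le> n"
  shows "gap_discriminant ev n \<ge> 0 \<and>
    ev n \<ge> 3 / real n * (\<Sum>j=1..n. ev j) - sqrt (gap_discriminant ev n) \<and>
    ev (n + 1) \<le> 3 / real n * (\<Sum>j=1..n. ev j) + sqrt (gap_discriminant ev n) \<and>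
    ev (n + 1) - ev n \<le> 2 * sqrt (gap_discriminant ev n)"
proof -
  define m where "m = 3 / real n * (\<Sum>j=1..n. ev j)"
  define \<Delta> where "\<Delta> = gap_discriminant ev n"
  have n: "0 < real n" using assms(3) by simp
  have mono: "ev i \<le> ev j" if "1 \<le> i" "i \<le> j" for i j
    using assms(2) that by (auto simp: eigenvalue_list_def mono_on_def)
  have quad: "(z - m)\<^sup>2 \<le> \<Delta>" if z: "ev n \<le> z" "z \<le> ev (n + 1)" for z
  proof -
    have le: "ev j \<le> z" if "j \<in> {1..n}" for j using mono[of j n] that z(1) by simp
    have "(\<Sum>j=1..n. (z - ev j)\<^sup>2) \<le> 4 * (\<Sum>j=1..n. (z - ev j) * ev j)"
      by (rule compact_metric_tree.yang_inequality[OF assms(1,2) le z(2)])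
    moreover have "(\<Sum>j=1..n. (z - ev j)\<^sup>2) = real n * z\<^sup>2 - 2 * z * (\<Sum>j=1..n. ev j) + (\<Sum>j=1..n. (ev j)\<^sup>2)"
      by (simp add: power2_diff sum.distrib sum_subtractf sum_distrib_left mult.assoc)
    moreover have "(\<Sum>j=1..n. (z - ev j) * ev j) = z * (\<Sum>j=1..n. ev j) - (\<Sum>j=1..n. (ev j)\<^sup>2)"
      by (simp add: left_diff_distrib sum_subtractf sum_distrib_left power2_eq_square)
    ultimately have "real n * z\<^sup>2 - 6 * z * (\<Sum>j=1..n. ev j) + 5 * (\<Sum>j=1..n. (ev j)\<^sup>2) \<le> 0"
      by (simp add: algebra_simps)
    then have "z\<^sup>2 - 2 * z * m + 5 / real n * (\<Sum>j=1..n. (ev j)\<^sup>2) \<le> 0"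
      using n by (simp add: m_def field_simps)
    moreover have "\<Delta> = m\<^sup>2 - 5 / real n * (\<Sum>j=1..n. (ev j)\<^sup>2)"
      by (simp only: \<Delta>_def gap_discriminant_def m_def)
    ultimately show ?thesis unfolding power2_diff by linarith
  qed
  have "ev n \<le> ev (n + 1)" using mono[of n "n + 1"] assms(3) by simp
  then have q1: "(ev n - m)\<^sup>2 \<le> \<Delta>" and q2: "(ev (n + 1) - m)\<^sup>2 \<le> \<Delta>" by (auto intro: quad)
  have "0 \<le> \<Delta>" using q1 zero_le_power2 order_trans by blast
  moreover have "\<bar>ev n - m\<bar> \<le> sqrt \<Delta>" "\<bar>ev (n + 1) - m\<bar> \<le> sqrt \<Delta>"
    using q1 q2 by (simp_all add: real_le_rsqrt)
  ultimately show ?thesis unfolding m_def[symmetric] \<Delta>_def[symmetric] by linarith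
qed

end
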